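(* Let the system $\dot u = Lu+R(u,v,\mu,\varepsilon)=:F(u,v,\mu,\varepsilon)$, $\dot v=\varepsilon G(u,v,\mu,\varepsilon)$ satisfy the vector field assumption (with an integer $k\ge2$), the spectral decomposition assumption and the hyperbolic linear equation assumption described in the context, with $G\in C^k(V_u\times V_v\times V_\mu\times V_\varepsilon,\mathbb R^m)$, and let $\Psi$ be the reduction function of the centre-manifold data described in the context. Assume there exist a one-parameter continuous family of linear maps $T_\varphi$ on $X$, for $\varphi\in\mathbb R/2l\mathbb Z$, $l\in\mathbb R$, and a symmetry $S$ on $X$ such that: $T_\varphi\circ T_\psi=T_{\varphi+\psi}$ and $ST_\varphi=T_{-\varphi}S$ for $\varphi,\psi\in\mathbb R/2l\mathbb Z$; $T_0=\mathrm{id}$ and $S^2=\mathrm{id}$; and the fast vector field $u\mapsto F(u,v,\mu,\varepsilon)$ commutes with $T_\varphi$ and $S$. Assume further that $0$ is a double eigenvalue of $L$ and no other eigenvalue is in $\sigma_c$ for $(\varepsilon,\mu)=(0,0)$, and that the action of $T_\varphi$ on $E_c$ is not trivial. Then there exist neighbourhoods $O_u,O_v,O_\mu,O_\varepsilon$ of $0$ in $\mathbb R^2$, $\mathbb R^m$, $\mathbb R^p$ and $\mathbb R$, respectively, such that for any $(\mu,\varepsilon)\in O_\mu\times O_\varepsilon$, in a suitable basis $(\zeta,\bar\zeta)$ of $\ker L$, $$u_c=A\zeta+\bar A\bar\zeta+\Phi(A\zeta+\bar A\bar\zeta,B,\mu,\varepsilon),\qquad v=B,$$ with $A\in\mathbb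 C$, $B\in\mathbb R^m$, $\Phi(\cdot,v,\mu,\varepsilon)$ a polynomial of degree $k$, $\Phi(0,0,0,0)=0$, $D_u\Phi(0,0,0,0)=0$, and whose monomials of degree $q$ are functions of $(v,\mu,\varepsilon)$ of class $C^{k-q}$. The reduced equation $$\dot u_c=P_cF(u_c+\Psi(u_c,v,\mu,\varepsilon),v,\mu,\varepsilon),\qquad \dot v=\varepsilon G(u_c+\Psi(u_c,v,\mu,\varepsilon),v,\mu,\varepsilon)$$ for $(u_c,v)\in O_u\times O_v$ has, at third order in $(A,\bar A)$, the expression $$\dot A=\alpha(B,\mu,\varepsilon)A+\beta A|A|^2+O\big((|B|+|\mu|+\varepsilon+|A|^2)^2\big),$$ $$\dot B=\varepsilon G\big(A\zeta+\bar A\bar\zeta+\Phi(A\zeta+\bar A\bar\zeta,B,\mu,\varepsilon),B,\mu,\varepsilon\big),$$ where $\alpha$ is a real linear form on $\mathbb R^m\times\mathbb R^p\times\mathbb R$ and $\beta$ is real.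
   Context: Let $m,p\in\mathbb N$ and let $Z\hookrightarrow Y\hookrightarrow X$ be Banach spaces on the field $\mathbb R$ or $\mathbb C$, with continuous embeddings; a bar denotes complex conjugation. In the system, $u$ is the fast variable in $X$, $v\in\mathbb R^m$ is the slow variable, $(\mu,\varepsilon)\in\mathbb R^p\times\mathbb R$ are parameters, $L:Z\to X$ is linear, $R:Z\times\mathbb R^m\times\mathbb R^p\times\mathbb R\to Y$ and $G:Z\times\mathbb R^m\times\mathbb R^p\times\mathbb R\to\mathbb R^m$. Solutions $(u,v)$ on an interval $I$ satisfy $u\in C(I,Z)\cap C^1(I,X)$, $v\in C^1(I,\mathbb R^m)$ and the equations in $X$ and $\mathbb R^m$ for all $t\in I$. The resolvent set $\rho(L)$ is the set of $\lambda\in\mathbb C$ for which $\lambda\,\mathrm{id}-L$ is invertible with $(\lambda\,\mathrm{id}-L)^{-1}\in\mathcal L(X)$, and $\sigma(L)=\mathbb C\setminus\rho(L)$. For a Banach space $W$ and $\eta\ge0$, $C_\eta(\mathbb R,W)=\{u\in C^0(\mathbb R,W):\ \sup_{t\in\mathbb R}e^{-\eta|t|}\|u(t)\|_W<\infty\}$, with this supremum as norm. Vector field assumption: $L\in\mathcal L(Z,X)$; there are an integer $k\ge2$ and neighbourhoods $V_u\subset Z$, $V_v\subset\mathbb R^m$, $V_\mu\subset\mathbb R^p$, $V_\varepsilon\subset\mathbb R$ of $0$ such that $R\in C^k(V_u\times V_v\times V_\mu\times V_\varepsilon,Y)$, $R(0,0,0,0)=0$ and $D_uR(0,0,0,0)=0$.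 Spectral decomposition assumption: let $\sigma_u,\sigma_c,\sigma_s$ be the subsets of $\sigma(L)$ of elements with positive, zero, negative real part respectively. Then $\sigma_c$ consists of a finite number $n>0$ of eigenvalues with finite algebraic multiplicities, and there is a constant $\gamma>0$ with $\inf_{\lambda\in\sigma_u}\mathrm{Re}\,\lambda>\gamma$ and $\sup_{\lambda\in\sigma_s}\mathrm{Re}\,\lambda<-\gamma$. Notation: $P_c\in\mathcal L(X,Z)$ is the spectral projector associated with $\sigma_c$, $P_{su}=\mathrm{id}_X-P_c$, $E_c=\mathrm{range}\,P_c\subset Z$ (in the claim, two-dimensional and identified with $\mathbb R^2$), $X_{su}=P_{su}X$, $Y_{su}=P_{su}Y$, $Z_{su}=P_{su}Z$, and $L_{su}$ is the restriction of $L$ to $Z_{su}$. Hyperbolic linear equation assumption: for any $\eta\in[0,\gamma]$ and any $f\in C_\eta(\mathbb R,Y_{su})$ the problem $\dot u_{su}=L_{su}u_{su}+f(t)$ has a unique solution $u_{su}=K_{su}f\in C_\eta(\mathbb R,Z_{su})$; the linear map $K_{su}$ belongs to $\mathcal L(C_\eta(\mathbb R,Y_{su}),C_\eta(\mathbb R,Z_{su}))$, and its operator norm is bounded by $\Pi(\eta)$ for some $\Pi\in C([0,\gamma],\mathbb R)$. Centre-manifold data: under these assumptions there exist $\Psi\in C^k(E_c\times\mathbb R^m\times\mathbb R^p\times\mathbb R,Z_{su})$ with $\Psi(0,0,0,0)=0$, $D_u\Psi(0,0,0,0)=0$ and a neighbourhood $N_u\times N_v\times N_\mu\times N_\varepsilon$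 of $0\in Z\times\mathbb R^m\times\mathbb R^p\times\mathbb R$ such that for all $(\mu,\varepsilon)\in N_\mu\times N_\varepsilon$ the manifold $M_c(\mu,\varepsilon)=\{(u_c+\Psi(u_c,v,\mu,\varepsilon),v):u_c\in E_c,\ v\in N_v\}$ is locally invariant (a solution starting in $M_c(\mu,\varepsilon)\cap(N_u\times N_v)$ and staying in $N_u\times N_v$ for $t\in[0,T]$ stays in $M_c(\mu,\varepsilon)$ for $t\in[0,T]$) and contains $(u(0),v(0))$ for every solution staying in $N_u\times N_v$ for all $t\in\mathbb R$. Solutions lying on $M_c(\mu,\varepsilon)$ for $t\in[0,T]$ have $u=u_c+\Psi(u_c,v,\mu,\varepsilon)$ with $(u_c,v)$, $u_c\in E_c$, satisfying the reduced equation displayed in the claim.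
   Formalization: Assumes l≠0 and that solutions of the reduced equation lift to solutions on M_c; ε is |ε| in the remainder; for k=2,3 the equation for A gains a remainder o(|(A,B,μ,ε)|^k); the equation for B gains O(|ε|(|B|+|μ|+|ε|+|A|²)), the effect of Ψ. *)

theory Defs
  imports "HOL-Analysis.Analysis" "HOL-Library.Landau_Symbols"
begin

section \<open>Maps of class \<open>C\<^sup>k\<close> between normed spaces\<close>

definition bounded_multilinear_on ::
  "'a::real_normed_vector set \<Rightarrow> nat \<Rightarrow> ('a list \<Rightarrow> 'b::real_normed_vector) \<Rightarrow> bool" where
  "bounded_multilinear_on E j M \<longleftrightarrow>
     (\<forall>hs\<in>lists E. length hs = j \<longrightarrow> (\<forall>i<j. \<forall>x\<in>E. \<forall>y\<in>E. \<forall>a b.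
        M (hs[i := a *\<^sub>R x + b *\<^sub>R y]) = a *\<^sub>R M (hs[i := x]) + b *\<^sub>R M (hs[i := y]))) \<and>
     (\<exists>C. \<forall>hs\<in>lists E. length hs = j \<longrightarrow> norm (M hs) \<le> C * (\<Prod>h\<leftarrow>hs. norm h))"

text \<open>
  \<open>E\<close> is the linear space on which \<open>f\<close> lives and \<open>U\<close> is a (relatively open) subset of \<open>E\<close>.
  The \<open>j\<close>-th Frechet derivative at \<open>x\<close> is the \<open>j\<close>-linear map \<open>D j x\<close>, acting on lists of length
  \<open>j\<close>: the iterated spaces of bounded linear maps in which the derivatives take their values are
  identified, as usual, with spaces of bounded multilinear maps.  The last two clauses are Frechet
  differentiability of \<open>D j\<close> and continuity of \<open>D j\<close> with respect to the norm of multilinear maps.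
\<close>

definition Ck_on ::
  "nat \<Rightarrow> 'a::real_normed_vector set \<Rightarrow> 'a set \<Rightarrow> ('a \<Rightarrow> 'b::real_normed_vector) \<Rightarrow> bool" where
  "Ck_on k E U f \<longleftrightarrow> (\<exists>D :: nat \<Rightarrow> 'a \<Rightarrow> 'a list \<Rightarrow> 'b.
     (\<forall>x\<in>U. D 0 x [] = f x) \<and>
     (\<forall>j\<le>k. \<forall>x\<in>U. bounded_multilinear_on E j (D j x)) \<and>
     (\<forall>j<k. \<forall>x\<in>U. \<forall>e>0. \<forall>\<^sub>F y in at x within U. \<forall>hs\<in>lists E. length hs = j \<longrightarrow>
        norm (D j y hs - D j x hs - D (Suc j) x ((y - x) # hs))
          \<le> e * norm (y - x) * (\<Prod>h\<leftarrow>hs. norm h)) \<and>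
     (\<forall>j\<le>k. \<forall>x\<in>U. \<forall>e>0. \<forall>\<^sub>F y in at x within U. \<forall>hs\<in>lists E. length hs = j \<longrightarrow>
        norm (D j y hs - D j x hs) \<le> e * (\<Prod>h\<leftarrow>hs. norm h)))"


section \<open>Complexification and spectrum\<close>

text \<open>The pair \<open>(a, b)\<close> represents the element \<open>a + \<i> b\<close> of the complexification.\<close>

definition cscale :: "complex \<Rightarrow> 'a::real_vector \<times> 'a \<Rightarrow> 'a \<times> 'a" where
  "cscale c p = (Re c *\<^sub>R fst p - Im c *\<^sub>R snd p, Im c *\<^sub>R fst p + Re c *\<^sub>R snd p)"

definition cconj :: "'a::real_vector \<times> 'a \<Rightarrow> 'a \<times> 'a" where
  "cconj p = (fst p, - snd p)"

definition cmap :: "('a \<Rightarrow> 'b) \<Rightarrow> 'a \<times> 'a \<Rightarrow> 'b \<times> 'b" where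
  "cmap f = map_prod f f"

text \<open>
  In this section \<open>L\<close> is a linear operator in \<open>'x\<close> whose domain \<open>'z\<close> is embedded by \<open>\<iota>\<close>;
  \<open>shifted \<iota> L z\<close> is \<open>z id - L\<close> on the complexification.
\<close>

definition shifted ::
  "('z::banach \<Rightarrow> 'x::banach) \<Rightarrow> ('z \<Rightarrow> 'x) \<Rightarrow> complex \<Rightarrow> 'z \<times> 'z \<Rightarrow> 'x \<times> 'x" where
  "shifted \<iota> L z w = cscale z (cmap \<iota> w) - cmap L w"

definition resolvent_set :: "('z::banach \<Rightarrow> 'x::banach) \<Rightarrow> ('z \<Rightarrow> 'x) \<Rightarrow> complex set" where
  "resolvent_set \<iota> L =
     {z. bij (shifted \<iota> L z) \<and> bounded_linear (\<lambda>x. cmap \<iota> (inv (shifted \<iota> L z) x))}"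

definition spectrum :: "('z::banach \<Rightarrow> 'x::banach) \<Rightarrow> ('z \<Rightarrow> 'x) \<Rightarrow> complex set" where
  "spectrum \<iota> L = - resolvent_set \<iota> L"

definition unstable_spectrum :: "('z::banach \<Rightarrow> 'x::banach) \<Rightarrow> ('z \<Rightarrow> 'x) \<Rightarrow> complex set" where
  "unstable_spectrum \<iota> L = {z \<in> spectrum \<iota> L. Re z > 0}"

definition centre_spectrum :: "('z::banach \<Rightarrow> 'x::banach) \<Rightarrow> ('z \<Rightarrow> 'x) \<Rightarrow> complex set" where
  "centre_spectrum \<iota> L = {z \<in> spectrum \<iota> L. Re z = 0}"

definition stable_spectrum :: "('z::banach \<Rightarrow> 'x::banach) \<Rightarrow> ('z \<Rightarrow> 'x) \<Rightarrow> complex set" where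
  "stable_spectrum \<iota> L = {z \<in> spectrum \<iota> L. Re z < 0}"

definition eigenvalue :: "('z::banach \<Rightarrow> 'x::banach) \<Rightarrow> ('z \<Rightarrow> 'x) \<Rightarrow> complex \<Rightarrow> bool" where
  "eigenvalue \<iota> L z \<longleftrightarrow> (\<exists>w. w \<noteq> 0 \<and> shifted \<iota> L z w = 0)"

text \<open>
  The Dunford integral of the resolvent over the circle of radius \<open>r\<close> around the isolated spectral
  point \<open>z0\<close>, divided by \<open>2 \<pi> \<i>\<close> and parametrised by \<open>z = z0 + r exp (\<i> \<theta>)\<close>, so that
  \<open>dz / (2 \<pi> \<i>) = r exp (\<i> \<theta>) d\<theta> / (2 \<pi>)\<close>.  Its value does not depend on small \<open>r\<close>.
\<close>

definition riesz_projector ::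
  "('z::banach \<Rightarrow> 'x::banach) \<Rightarrow> ('z \<Rightarrow> 'x) \<Rightarrow> complex \<Rightarrow> 'x \<times> 'x \<Rightarrow> 'z \<times> 'z" where
  "riesz_projector \<iota> L z0 x = (THE y. \<forall>\<^sub>F r in at_right 0.
     ((\<lambda>\<theta>. cscale (rcis r \<theta> / of_real (2 * pi)) (inv (shifted \<iota> L (z0 + rcis r \<theta>)) x))
        has_integral y) {0..2 * pi})"

definition finite_alg_mult ::
  "('z::banach \<Rightarrow> 'x::banach) \<Rightarrow> ('z \<Rightarrow> 'x) \<Rightarrow> complex \<Rightarrow> bool" where
  "finite_alg_mult \<iota> L z \<longleftrightarrow> (\<exists>B. finite B \<and> range (riesz_projector \<iota> L z) \<subseteq> span B)"

text \<open>The library's \<open>dim\<close> is the real dimension, which is twice the complex one.\<close>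

definition alg_mult :: "('z::banach \<Rightarrow> 'x::banach) \<Rightarrow> ('z \<Rightarrow> 'x) \<Rightarrow> complex \<Rightarrow> nat" where
  "alg_mult \<iota> L z = dim (range (riesz_projector \<iota> L z)) div 2"

text \<open>
  The centre spectrum of a real operator is invariant under complex conjugation, so the sum below
  maps real elements to real elements and its second component vanishes.
\<close>

definition centre_projector ::
  "('z::banach \<Rightarrow> 'x::banach) \<Rightarrow> ('z \<Rightarrow> 'x) \<Rightarrow> 'x \<Rightarrow> 'z" where
  "centre_projector \<iota> L x = fst (\<Sum>z\<in>centre_spectrum \<iota> L. riesz_projector \<iota> L z (x, 0))"

text \<open>The extended reals give the bounds their meaning for an empty unstable or stable part.\<close>

definition spectral_decomposition ::
  "('z::banach \<Rightarrow> 'x::banach) \<Rightarrow> ('z \<Rightarrow> 'x) \<Rightarrow> real \<Rightarrow> bool" where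
  "spectral_decomposition \<iota> L \<gamma> \<longleftrightarrow>
     finite (centre_spectrum \<iota> L) \<and> centre_spectrum \<iota> L \<noteq> {} \<and>
     (\<forall>z\<in>centre_spectrum \<iota> L. eigenvalue \<iota> L z \<and> finite_alg_mult \<iota> L z) \<and>
     \<gamma> > 0 \<and>
     (INF z\<in>unstable_spectrum \<iota> L. ereal (Re z)) > ereal \<gamma> \<and>
     (SUP z\<in>stable_spectrum \<iota> L. ereal (Re z)) < ereal (- \<gamma>)"


section \<open>Hyperbolic linear equation\<close>

text \<open>\<open>x\<close> is continuously differentiable on \<open>I\<close> with derivative \<open>y\<close>.\<close>

definition C1_derivative_on ::
  "real set \<Rightarrow> (real \<Rightarrow> 'a::real_normed_vector) \<Rightarrow> (real \<Rightarrow> 'a) \<Rightarrow> bool" where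
  "C1_derivative_on I x y \<longleftrightarrow>
     (\<forall>t\<in>I. (x has_vector_derivative y t) (at t within I)) \<and> continuous_on I y"

definition weighted_space :: "real \<Rightarrow> 'w::banach set \<Rightarrow> (real \<Rightarrow> 'w) set" where
  "weighted_space \<eta> W = {u. continuous_on UNIV u \<and> range u \<subseteq> W \<and>
     bdd_above (range (\<lambda>t. exp (- \<eta> * \<bar>t\<bar>) * norm (u t)))}"

definition weighted_norm :: "real \<Rightarrow> (real \<Rightarrow> 'w::banach) \<Rightarrow> real" where
  "weighted_norm \<eta> u = (SUP t. exp (- \<eta> * \<bar>t\<bar>) * norm (u t))"

text \<open>The range of \<open>id - P\<^sub>c\<close> on \<open>'w\<close>, where \<open>e\<close> embeds \<open>'z\<close> into \<open>'w\<close> and \<open>d\<close> embeds \<open>'w\<close> into \<open>'x\<close>.\<close>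

definition hyperbolic_part ::
  "('z::banach \<Rightarrow> 'w::banach) \<Rightarrow> ('w \<Rightarrow> 'x::banach) \<Rightarrow> ('x \<Rightarrow> 'z) \<Rightarrow> 'w set" where
  "hyperbolic_part e d Pc = range (\<lambda>w. w - e (Pc (d w)))"

definition hyperbolic_linear_equation ::
  "('z::banach \<Rightarrow> 'y::banach) \<Rightarrow> ('y \<Rightarrow> 'x::banach) \<Rightarrow> ('z \<Rightarrow> 'x) \<Rightarrow> ('x \<Rightarrow> 'z) \<Rightarrow> real \<Rightarrow> bool" where
  "hyperbolic_linear_equation iZY iYX L Pc \<gamma> \<longleftrightarrow>
     (let iZX = iYX \<circ> iZY;
          Ysu = hyperbolic_part iZY iYX Pc;
          Zsu = hyperbolic_part id iZX Pc;
          solves = (\<lambda>f u. C1_derivative_on UNIV (\<lambda>t. iZX (u t)) (\<lambda>t. L (u t) + iYX (f t)))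
      in \<exists>K C. continuous_on {0..\<gamma>} C \<and> (\<forall>\<eta>\<in>{0..\<gamma>}.
        (\<forall>f\<in>weighted_space \<eta> Ysu.
           K f \<in> weighted_space \<eta> Zsu \<and> solves f (K f) \<and>
           (\<forall>u\<in>weighted_space \<eta> Zsu. solves f u \<longrightarrow> u = K f) \<and>
           weighted_norm \<eta> (K f) \<le> C \<eta> * weighted_norm \<eta> f) \<and>
        (\<forall>f\<in>weighted_space \<eta> Ysu. \<forall>g\<in>weighted_space \<eta> Ysu. \<forall>a b.
           K (\<lambda>t. a *\<^sub>R f t + b *\<^sub>R g t) = (\<lambda>t. a *\<^sub>R K f t + b *\<^sub>R K g t))))"


section \<open>The slow-fast system and its centre manifolds\<close>

definition full_solution ::
  "('z::banach \<Rightarrow> 'x::banach)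
    \<Rightarrow> ('z \<times> 'v::real_normed_vector \<times> 'p \<times> real \<Rightarrow> 'x) \<Rightarrow> ('z \<times> 'v \<times> 'p \<times> real \<Rightarrow> 'v)
    \<Rightarrow> 'p \<Rightarrow> real \<Rightarrow> real set \<Rightarrow> (real \<Rightarrow> 'z) \<Rightarrow> (real \<Rightarrow> 'v) \<Rightarrow> bool" where
  "full_solution iZX F G \<mu> \<epsilon> I u v \<longleftrightarrow>
     continuous_on I u \<and>
     C1_derivative_on I (\<lambda>t. iZX (u t)) (\<lambda>t. F (u t, v t, \<mu>, \<epsilon>)) \<and>
     C1_derivative_on I v (\<lambda>t. \<epsilon> *\<^sub>R G (u t, v t, \<mu>, \<epsilon>))"

definition reduced_solution ::
  "('z::banach \<times> 'v::real_normed_vector \<times> 'p \<times> real \<Rightarrow> 'x::banach)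
    \<Rightarrow> ('z \<times> 'v \<times> 'p \<times> real \<Rightarrow> 'v)
    \<Rightarrow> ('x \<Rightarrow> 'z) \<Rightarrow> ('z \<times> 'v \<times> 'p \<times> real \<Rightarrow> 'z)
    \<Rightarrow> 'p \<Rightarrow> real \<Rightarrow> real set \<Rightarrow> (real \<Rightarrow> 'z) \<Rightarrow> (real \<Rightarrow> 'v) \<Rightarrow> bool" where
  "reduced_solution F G Pc \<Psi> \<mu> \<epsilon> I uc v \<longleftrightarrow>
     C1_derivative_on I uc (\<lambda>t. Pc (F (uc t + \<Psi> (uc t, v t, \<mu>, \<epsilon>), v t, \<mu>, \<epsilon>))) \<and>
     C1_derivative_on I v (\<lambda>t. \<epsilon> *\<^sub>R G (uc t + \<Psi> (uc t, v t, \<mu>, \<epsilon>), v t, \<mu>, \<epsilon>))"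

definition centre_manifold ::
  "'z::banach set \<Rightarrow> ('z \<times> 'v \<times> 'p \<times> real \<Rightarrow> 'z) \<Rightarrow> 'v set \<Rightarrow> 'p \<Rightarrow> real \<Rightarrow> ('z \<times> 'v) set" where
  "centre_manifold Ec \<Psi> Nv \<mu> \<epsilon> = {(uc + \<Psi> (uc, v, \<mu>, \<epsilon>), v) | uc v. uc \<in> Ec \<and> v \<in> Nv}"

text \<open>
  The last clause says that the solutions lying on the centre manifold are exactly the curves
  \<open>(u\<^sub>c + \<Psi>, v)\<close> for which \<open>(u\<^sub>c, v)\<close> solves the reduced equation.  Since the initial value problem
  may be ill-posed, its direction from right to left (the reduced flow is a flow of the full
  system) is not a consequence of the two preceding clauses, which only speak about given
  solutions of the full system.
\<close>

definition reduction_function ::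
  "('z::banach \<Rightarrow> 'x::banach)
    \<Rightarrow> ('z \<times> 'v::euclidean_space \<times> 'p::euclidean_space \<times> real \<Rightarrow> 'x)
    \<Rightarrow> ('z \<times> 'v \<times> 'p \<times> real \<Rightarrow> 'v) \<Rightarrow> ('x \<Rightarrow> 'z) \<Rightarrow> nat
    \<Rightarrow> ('z \<times> 'v \<times> 'p \<times> real \<Rightarrow> 'z) \<Rightarrow> bool" where
  "reduction_function iZX F G Pc k \<Psi> \<longleftrightarrow>
     Ck_on k (range Pc \<times> UNIV) (range Pc \<times> UNIV) \<Psi> \<and>
     \<Psi> ` (range Pc \<times> UNIV) \<subseteq> hyperbolic_part id iZX Pc \<and>
     \<Psi> (0, 0, 0, 0) = 0 \<and>
     ((\<lambda>u. \<Psi> (u, 0, 0, 0)) has_derivative (\<lambda>_. 0)) (at 0 within range Pc) \<and>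
     (\<exists>Nu Nv N\<mu> N\<epsilon>. open Nu \<and> 0 \<in> Nu \<and> open Nv \<and> 0 \<in> Nv \<and>
        open N\<mu> \<and> 0 \<in> N\<mu> \<and> open N\<epsilon> \<and> 0 \<in> N\<epsilon> \<and>
        (\<forall>\<mu>\<in>N\<mu>. \<forall>\<epsilon>\<in>N\<epsilon>.
           (\<forall>T\<ge>0. \<forall>u v. full_solution iZX F G \<mu> \<epsilon> {0..T} u v \<longrightarrow>
              (u 0, v 0) \<in> centre_manifold (range Pc) \<Psi> Nv \<mu> \<epsilon> \<longrightarrow>
              (\<forall>t\<in>{0..T}. u t \<in> Nu \<and> v t \<in> Nv) \<longrightarrow>
              (\<forall>t\<in>{0..T}. (u t, v t) \<in> centre_manifold (range Pc) \<Psi> Nv \<mu> \<epsilon>)) \<and>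
           (\<forall>u v. full_solution iZX F G \<mu> \<epsilon> UNIV u v \<longrightarrow>
              (\<forall>t. u t \<in> Nu \<and> v t \<in> Nv) \<longrightarrow>
              (u 0, v 0) \<in> centre_manifold (range Pc) \<Psi> Nv \<mu> \<epsilon>) \<and>
           (\<forall>T\<ge>0. \<forall>uc v.
              (\<forall>t\<in>{0..T}. uc t \<in> range Pc \<and> uc t + \<Psi> (uc t, v t, \<mu>, \<epsilon>) \<in> Nu \<and> v t \<in> Nv) \<longrightarrow>
              (full_solution iZX F G \<mu> \<epsilon> {0..T} (\<lambda>t. uc t + \<Psi> (uc t, v t, \<mu>, \<epsilon>)) v \<longleftrightarrow>
               reduced_solution F G Pc \<Psi> \<mu> \<epsilon> {0..T} uc v))))"


section \<open>Symmetries and complex coordinates on the kernel\<close>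

text \<open>
  \<open>A\<close> acts on \<open>'x\<close> while the first argument of \<open>F\<close> lies in \<open>'z\<close>, so commutation includes that \<open>A\<close>
  leaves the embedded copy of \<open>'z\<close> invariant.
\<close>

definition commutes_with_field ::
  "('z::banach \<Rightarrow> 'x::banach) \<Rightarrow> ('z \<times> 'q \<Rightarrow> 'x) \<Rightarrow> ('x \<Rightarrow> 'x) \<Rightarrow> bool" where
  "commutes_with_field iZX F A \<longleftrightarrow>
     (\<forall>u q. \<exists>u'. iZX u' = A (iZX u) \<and> F (u', q) = A (F (u, q)))"

text \<open>\<open>(\<zeta>, cconj \<zeta>)\<close> is a complex basis of the complexified kernel of \<open>L\<close>.\<close>

definition conjugate_basis_of_kernel ::
  "('z::real_vector \<Rightarrow> 'x::real_vector) \<Rightarrow> 'z \<times> 'z \<Rightarrow> bool" where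
  "conjugate_basis_of_kernel L \<zeta> \<longleftrightarrow> cmap L \<zeta> = 0 \<and> cmap L (cconj \<zeta>) = 0 \<and>
     (\<forall>w. cmap L w = 0 \<longrightarrow>
        (\<exists>!cd. w = cscale (fst cd) \<zeta> + cscale (snd cd) (cconj \<zeta>)))"

text \<open>The element \<open>A \<zeta> + cnj A cconj \<zeta>\<close> of the complexification is real; this is its real part.\<close>

definition real_combination :: "complex \<Rightarrow> 'z::real_vector \<times> 'z \<Rightarrow> 'z" where
  "real_combination A \<zeta> = fst (cscale A \<zeta> + cscale (cnj A) (cconj \<zeta>))"

definition normal_form_chart ::
  "'z::real_vector \<times> 'z \<Rightarrow> ('z \<times> 'q \<Rightarrow> 'z) \<Rightarrow> complex \<Rightarrow> 'q \<Rightarrow> 'z" where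
  "normal_form_chart \<zeta> \<Phi> A w = real_combination A \<zeta> + \<Phi> (real_combination A \<zeta>, w)"

end

theory Submission
  imports Defs
begin

text \<open>
  Why the theorem holds.  The circle \<open>T\<close> acts on the two-dimensional centre space without invariant
  lines, and the kernel of \<open>L\<close> is an invariant subspace of it.  So the centre space is the kernel of
  \<open>L\<close>, and it has a complex coordinate \<open>A\<close> in which \<open>T\<close> acts by all rotations \<open>A \<mapsto> c A\<close>, \<open>|c| = 1\<close>, and
  \<open>S\<close> by conjugation (lemmas \<open>plane_circle_action\<close> and \<open>circle_coordinates\<close>).  A homogeneous map of
  degree \<open>q\<close> that commutes with these maps is \<open>A \<mapsto> r A |A|\<^sup>q\<^sup>-\<^sup>1\<close> with a real number \<open>r\<close>
  (\<open>circle_equivariant_homogeneous\<close>); a quadratic one vanishes, since it is even and commutes with the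
  half turn.

  Give \<open>A\<close> the weight one and \<open>w = (B, \<mu>, \<epsilon>)\<close> the weight two.  The error term \<open>\<rho>\<close> takes everything of
  weight four, and \<open>\<tau>\<close> takes the Peano remainder if \<open>k < 4\<close>.  The linear term in \<open>A\<close> is zero because \<open>L\<close>
  vanishes on the centre space, so the only terms of smaller weight in the Taylor expansion of an
  equivariant field are \<open>\<alpha>(w) A\<close> and \<open>\<beta> A |A|\<^sup>2\<close>.  Hence the linear coordinate already gives the normal
  form and \<open>\<Phi> = 0\<close>.

  The reduction function \<open>\<Psi>\<close> is an arbitrary one and may fail to be equivariant.  However, only its
  coefficients of weight two, the linear part \<open>\<psi>1 w\<close> and the quadratic part \<open>Q A\<close>, enter the terms of
  the reduced field of weight less than four.  The manifold is invariant, and the corresponding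
  parts of the invariance equation (\<open>invariance_linear\<close>, \<open>invariance_quadratic\<close>) express \<open>L (\<psi>1 w)\<close> and
  \<open>L (Q A)\<close> by equivariant data.  As \<open>L\<close> is injective on the complement of its kernel, both coefficients
  are equivariant (\<open>\<psi>1_fixed\<close>, \<open>Q_equivariant\<close>).  The invariance equation itself is obtained by solving
  the reduced equation through each point near the origin (\<open>reduced_flow_invariance\<close>).

  What this requires of analysis: the Riesz projector is bounded, fixes the kernel and commutes with
  the symmetries; maps of class \<open>C\<^sup>k\<close> have Taylor expansions with Peano remainder (\<open>Ck_on_cubic_jet\<close>);
  and these are inserted into each other to expand the reduced field (\<open>reduced_field_expansion\<close>).
\<close>

section \<open>The bounded inverse theorem\<close>

text \<open>
  The Dunford integral of the resolvent is taken in the domain of the operator, so the resolvent has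
  to be bounded as a map into the domain.  This comes from its bijectivity: by Baire's theorem the
  closure of the image of some ball contains a ball around the origin, so every \<open>y\<close> has an
  approximate preimage of comparable size with an error of at most half of \<open>y\<close>; repeating this with
  the error gives a geometric series that sums to the preimage.
\<close>

lemma bounded_inverse:
  fixes A :: "'a::banach \<Rightarrow> 'b::banach"
  assumes A: "bounded_linear A" and bij: "bij A"
  shows "bounded_linear (inv A)"
proof -
  interpret A: bounded_linear A by fact
  define B where "B n = closure (A ` cball 0 (real n))" for n
  have cov: "\<Union> (range B) = UNIV"
  proof (intro equalityI subsetI UNIV_I)
    fix y
    obtain x where "y = A x" using bij by (metis bij_pointE)
    moreover obtain n where "norm x \<le> real n" using real_arch_simple by blast
    ultimately have "y \<in> A ` cball 0 (real n)" by auto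
    then show "y \<in> \<Union> (range B)" unfolding B_def using closure_subset by fast
  qed
  have "\<exists>n. interior (B n) \<noteq> {}"
  proof (rule ccontr)
    assume "\<not> ?thesis"
    then have empty: "closedin euclidean T \<and> euclidean interior_of T = {}" if "T \<in> range B" for T
      using that unfolding B_def by (auto simp flip: closed_closedin)
    have "completely_metrizable_space (euclidean :: 'b topology)"
      using Met_TC.completely_metrizable_space_mtopology complete_UNIV by auto
    then have "euclidean interior_of \<Union> (range B) = {}"
      by (intro Baire_category_alt empty) auto
    then show False unfolding cov by simp
  qed
  then obtain n y0 where "y0 \<in> interior (B n)" by auto
  then obtain r where r: "r > 0" "ball y0 r \<subseteq> B n" by (meson mem_interior)
  \<comment> \<open>A ball of \<open>B n\<close> around \<open>y0\<close> can be moved to the origin since \<open>B n\<close> is convex and symmetric.\<close>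
  have conv: "convex (B n)" unfolding B_def
    by (intro convex_closure convex_linear_image A.linear_axioms convex_cball)
  have symm: "- y \<in> B n" if "y \<in> B n" for y
  proof -
    have "A ` cball 0 (real n) = uminus ` A ` cball 0 (real n)"
    proof (intro equalityI subsetI)
      fix y assume "y \<in> A ` cball 0 (real n)"
      then obtain x where "y = A x" "norm x \<le> n" by auto
      then have "y = - A (-x)" "norm (-x) \<le> n" by (auto simp: A.neg)
      then show "y \<in> uminus ` A ` cball 0 (real n)" by auto
    next
      fix y assume "y \<in> uminus ` A ` cball 0 (real n)"
      then obtain x where "y = - A x" "norm x \<le> n" by auto
      then have "y = A (-x)" "norm (-x) \<le> n" by (auto simp: A.neg)
      then show "y \<in> A ` cball 0 (real n)" by auto
    qed
    then have "A ` cball 0 (real n) = (*\<^sub>R) (-1) ` A ` cball 0 (real n)"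
      by simp
    then have "B n = (*\<^sub>R) (-1) ` B n" unfolding B_def
      by (metis closure_scaleR)
    then have "B n = uminus ` B n" by simp
    with that show ?thesis by (metis add.inverse_inverse image_iff)
  qed
  have ball0: "y \<in> B n" if "norm y < r" for y
  proof -
    have "y0 + y \<in> B n" "y0 - y \<in> B n" using r(2) that by (auto simp: subset_iff dist_norm)
    then have "(1/2) *\<^sub>R (y0 + y) + (1/2) *\<^sub>R (- (y0 - y)) \<in> B n"
      by (intro convexD[OF conv] symm) auto
    moreover have "(1/2) *\<^sub>R (y0 + y) + (1/2) *\<^sub>R (- (y0 - y)) = y"
      by (simp add: algebra_simps) (metis scaleR_left.add scaleR_one field_sum_of_halves)
    ultimately show ?thesis by simp
  qed
  define K where "K = 2 * real n / r"
  have K0: "K \<ge> 0" using r by (simp add: K_def)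
  have step: "\<exists>x. norm x \<le> K * norm y \<and> norm (y - A x) \<le> norm y / 2" for y
  proof (cases "y = 0")
    case True then show ?thesis by (intro exI[of _ 0]) (simp add: A.zero)
  next
    case False
    define s where "s = r / (2 * norm y)"
    have s: "s > 0" using r False by (simp add: s_def)
    have "norm (s *\<^sub>R y) < r" using r False by (simp add: s_def)
    then have "s *\<^sub>R y \<in> closure (A ` cball 0 (real n))" using ball0 B_def by auto
    moreover have "s * norm y / 2 > 0" using s False by simp
    ultimately obtain x where x: "norm x \<le> n" "dist (A x) (s *\<^sub>R y) < s * norm y / 2"
      unfolding closure_approachable by fastforce
    have "y - A (x /\<^sub>R s) = (s *\<^sub>R y - A x) /\<^sub>R s"
      using s by (simp add: A.scaleR scaleR_diff_right)
    then have "norm (y - A (x /\<^sub>R s)) = dist (A x) (s *\<^sub>R y) / s"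
      using s by (simp add: dist_norm norm_minus_commute divide_inverse_commute)
    also have "\<dots> \<le> (s * norm y / 2) / s" using x s by (intro divide_right_mono) auto
    finally have 1: "norm (y - A (x /\<^sub>R s)) \<le> norm y / 2" using s by simp
    have "norm (x /\<^sub>R s) = norm x / s" using s by (simp add: divide_inverse_commute)
    also have "\<dots> \<le> n / s" using x s by (intro divide_right_mono) auto
    also have "\<dots> = K * norm y" using r False by (simp add: K_def s_def)
    finally show ?thesis using 1 by blast
  qed
  then obtain g where g: "\<And>y. norm (g y) \<le> K * norm y" "\<And>y. norm (y - A (g y)) \<le> norm y / 2"
    by metis
  have bound: "norm (inv A y) \<le> norm y * (2 * K)" for y
  proof -
    define u where "u i = ((\<lambda>z. z - A (g z)) ^^ i) y" for i
    have u_Suc: "u (Suc i) = u i - A (g (u i))" for i by (simp add: u_def)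
    have un: "norm (u i) \<le> norm y * (1/2) ^ i" for i
    proof (induction i)
      case 0 then show ?case by (simp add: u_def)
    next
      case (Suc i)
      have "norm (u (Suc i)) \<le> norm (u i) / 2" unfolding u_Suc by (rule g)
      with Suc show ?case by simp
    qed
    have gn: "norm (g (u i)) \<le> K * norm y * (1/2) ^ i" for i
      using order_trans[OF g(1) mult_left_mono[OF un K0]] by (simp add: mult.assoc)
    have geo: "(\<lambda>i. K * norm y * (1/2) ^ i) sums (K * norm y * 2)"
      using sums_mult[OF geometric_sums[of "1/2::real"]] by simp
    have summ: "summable (\<lambda>i. norm (g (u i)))"
      by (rule summable_comparison_test[OF _ sums_summable[OF geo]]) (use gn in auto)
    have "(\<lambda>i. A (g (u i))) sums A (\<Sum>i. g (u i))"
      by (rule A.sums[OF summable_sums[OF summable_norm_cancel[OF summ]]])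
    moreover have "(\<lambda>i. A (g (u i))) sums (u 0 - 0)"
    proof -
      have "(\<lambda>i. norm y * (1/2) ^ i) \<longlonglongrightarrow> 0"
        by (intro tendsto_mult_right_zero LIMSEQ_realpow_zero) auto
      then have "u \<longlonglongrightarrow> 0" by (rule Lim_null_comparison[rotated]) (use un in auto)
      from telescope_sums'[OF this] show ?thesis by (simp add: u_Suc)
    qed
    ultimately have "A (\<Sum>i. g (u i)) = y" by (metis sums_unique2 diff_zero u_def funpow_0)
    then have "inv A y = (\<Sum>i. g (u i))" using bij by (metis bij_inv_eq_iff)
    also have "norm \<dots> \<le> (\<Sum>i. norm (g (u i)))" by (rule summable_norm[OF summ])
    also have "\<dots> \<le> (\<Sum>i. K * norm y * (1/2) ^ i)"
      by (intro suminf_le gn summ sums_summable[OF geo])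
    also have "\<dots> = norm y * (2 * K)" unfolding sums_unique[OF geo, symmetric] by simp
    finally show ?thesis .
  qed
  have lin: "linear (inv A)"
  proof (rule linearI)
    show "inv A (x + y) = inv A x + inv A y" for x y
      using bij by (metis A.add bij_inv_eq_iff)
    show "inv A (c *\<^sub>R x) = c *\<^sub>R inv A x" for c x
      using bij by (metis A.scaleR bij_inv_eq_iff)
  qed
  show ?thesis
    by (rule bounded_linear_intro[of _ "2 * K"]) (auto simp: linear_add[OF lin] linear_scale[OF lin] bound)
qed

section \<open>Complex scalars on pairs\<close>

lemma cscale_simps:
  "cscale c (cscale d p) = cscale (c * d) p"
  "cscale 1 p = p" "cscale 0 p = 0" "cscale c 0 = 0"
  "cscale (c + d) p = cscale c p + cscale d p"
  "cscale (c - d) p = cscale c p - cscale d p"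
  "cscale c (p + q) = cscale c p + cscale c q"
  "cscale c (p - q) = cscale c p - cscale c q"
  "cscale (- c) p = - cscale c p" "cscale c (- p) = - cscale c p"
  "cscale (of_real r) p = r *\<^sub>R p"
  by (auto simp: cscale_def algebra_simps prod_eq_iff scaleR_diff_right scaleR_add_right)

lemma bounded_bilinear_cscale:
  "bounded_bilinear (cscale :: complex \<Rightarrow> 'a::real_normed_vector \<times> 'a \<Rightarrow> 'a \<times> 'a)"
proof
  show "\<exists>K. \<forall>(a::complex) (b :: 'a \<times> 'a). norm (cscale a b) \<le> norm a * norm b * K"
  proof (intro exI allI)
    fix a :: complex and b :: "'a \<times> 'a"
    have 1: "norm (fst b) \<le> norm b" "norm (snd b) \<le> norm b"
      by (metis norm_fst_le prod.collapse) (metis norm_snd_le prod.collapse)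
    note m = mult_mono[OF abs_Re_le_cmod[of a] 1(1)] mult_mono[OF abs_Im_le_cmod[of a] 1(1)]
      mult_mono[OF abs_Re_le_cmod[of a] 1(2)] mult_mono[OF abs_Im_le_cmod[of a] 1(2)]
    have "norm (cscale a b) \<le> norm (Re a *\<^sub>R fst b - Im a *\<^sub>R snd b) + norm (Im a *\<^sub>R fst b + Re a *\<^sub>R snd b)"
      unfolding cscale_def by (rule norm_Pair_le)
    also have "\<dots> \<le> norm (Re a *\<^sub>R fst b) + norm (Im a *\<^sub>R snd b) + (norm (Im a *\<^sub>R fst b) + norm (Re a *\<^sub>R snd b))"
      by (intro add_mono norm_triangle_ineq norm_triangle_ineq4)
    also have "\<dots> \<le> norm a * norm b * 4" using m by simp
    finally show "norm (cscale a b) \<le> norm a * norm b * 4" .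
  qed
qed (auto simp: cscale_def algebra_simps prod_eq_iff)

interpretation cscale: bounded_bilinear cscale by (rule bounded_bilinear_cscale)

lemma bounded_linear_cmap: "bounded_linear f \<Longrightarrow> bounded_linear (cmap f)"
  unfolding cmap_def map_prod_def case_prod_beta
  by (intro bounded_linear_Pair bounded_linear_compose[OF _ bounded_linear_fst]
      bounded_linear_compose[OF _ bounded_linear_snd])

lemma cmap_cscale: "linear f \<Longrightarrow> cmap f (cscale c w) = cscale c (cmap f w)"
  by (simp add: cmap_def cscale_def linear_add linear_diff linear_scale)

lemma cmap_cconj: "linear f \<Longrightarrow> cmap f (cconj w) = cconj (cmap f w)"
  by (simp add: cmap_def cconj_def linear_neg)

lemma cconj_cscale: "cconj (cscale c w) = cscale (cnj c) (cconj w)"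
  by (simp add: cconj_def cscale_def)

lemma bounded_linear_cconj: "bounded_linear (cconj :: 'a::real_normed_vector \<times> 'a \<Rightarrow> 'a \<times> 'a)"
  unfolding cconj_def by (intro bounded_linear_Pair bounded_linear_fst bounded_linear_minus bounded_linear_snd)

section \<open>The resolvent near an isolated spectral point\<close>

text \<open>
  \<open>L\<close> is an operator in \<open>'x\<close> with domain \<open>'z\<close>, embedded by \<open>j\<close>, whose spectrum meets the disc of
  radius \<open>r0\<close> at most in \<open>0\<close>.
\<close>

locale isolated_zero =
  fixes j :: "'z::banach \<Rightarrow> 'x::banach" and L :: "'z \<Rightarrow> 'x" and r0 :: real
  assumes j: "bounded_linear j" and L: "bounded_linear L" and r0: "r0 > 0"
    and resolvent: "\<And>z. 0 < cmod z \<Longrightarrow> cmod z < r0 \<Longrightarrow> bij (shifted j L z)"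
begin

definition \<Omega> where "\<Omega> = {z. 0 < cmod z \<and> cmod z < r0}"

abbreviation "A z \<equiv> shifted j L z"
definition "Res z = inv (shifted j L z)"

lemma linear_j: "linear j" and linear_L: "linear L"
  using j L bounded_linear.linear by auto

lemma bounded_linear_cmap_j: "bounded_linear (cmap j)" and bounded_linear_cmap_L: "bounded_linear (cmap L)"
  using j L by (auto intro: bounded_linear_cmap)

sublocale cj: bounded_linear "cmap j" by (rule bounded_linear_cmap_j)
sublocale cL: bounded_linear "cmap L" by (rule bounded_linear_cmap_L)

lemma bounded_linear_shifted: "bounded_linear (A z)"
  unfolding shifted_def
  by (intro bounded_linear_sub bounded_linear_cmap_L bounded_linear_compose[OF cscale.bounded_linear_right bounded_linear_cmap_j])

lemma A_Res: "z \<in> \<Omega> \<Longrightarrow> A z (Res z x) = x"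
  unfolding Res_def \<Omega>_def using resolvent by (simp add: bij_is_surj surj_f_inv_f)

lemma Res_A: "z \<in> \<Omega> \<Longrightarrow> Res z (A z w) = w"
  unfolding Res_def \<Omega>_def using resolvent by (simp add: bij_is_inj)

lemma Res_eqI: "z \<in> \<Omega> \<Longrightarrow> A z w = x \<Longrightarrow> Res z x = w"
  using Res_A by blast

lemma bounded_linear_Res: "z \<in> \<Omega> \<Longrightarrow> bounded_linear (Res z)"
  unfolding Res_def \<Omega>_def using resolvent by (auto intro: bounded_inverse bounded_linear_shifted)

lemma A_cscale: "A z (cscale c w) = cscale c (A z w)"
  by (simp add: shifted_def cmap_cscale linear_j linear_L cscale_simps mult.commute)

lemma Res_cscale: "z \<in> \<Omega> \<Longrightarrow> Res z (cscale c x) = cscale c (Res z x)"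
  by (rule Res_eqI) (simp_all add: A_cscale A_Res)

lemma resolvent_identity:
  assumes "z \<in> \<Omega>" "z0 \<in> \<Omega>"
  shows "Res z x - Res z0 x = Res z0 (cscale (z0 - z) (cmap j (Res z x)))"
proof -
  have "A z0 (Res z x) = x + cscale (z0 - z) (cmap j (Res z x))"
    using A_Res[OF assms(1), of x] by (simp add: shifted_def cscale_simps algebra_simps)
  then have "Res z x = Res z0 (x + cscale (z0 - z) (cmap j (Res z x)))"
    using Res_A[OF assms(2)] by metis
  then have "Res z x = Res z0 x + Res z0 (cscale (z0 - z) (cmap j (Res z x)))"
    by (simp only: linear_add[OF bounded_linear.linear[OF bounded_linear_Res[OF assms(2)]]])
  then show ?thesis unfolding diff_eq_eq by (simp only: add.commute)
qed

text \<open>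
  The resolvent identity bounds \<open>Res z x - Res z0 x\<close> by a multiple of \<open>|z - z0|\<close> times the unknown
  \<open>Res z x\<close> itself; for \<open>z\<close> close to \<open>z0\<close> that factor is at most \<open>1/2\<close> and the unknown is absorbed.
  The bound is uniform in \<open>x\<close>, which gives joint continuity and norm bounds on compact sets.
\<close>

lemma Res_local_Lipschitz:
  assumes z0: "z0 \<in> \<Omega>"
  shows "\<exists>C d. C \<ge> 0 \<and> d > 0 \<and>
    (\<forall>z x. z \<in> \<Omega> \<longrightarrow> norm (z - z0) < d \<longrightarrow> norm (Res z x - Res z0 x) \<le> C * norm (z - z0) * norm x)"
proof -
  obtain M where M: "M > 0" "\<And>x. norm (Res z0 x) \<le> norm x * M"
    using bounded_linear.pos_bounded[OF bounded_linear_Res[OF z0]] by auto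
  obtain c1 where c1: "c1 > 0" "\<And>a (b::'x\<times>'x). norm (cscale a b) \<le> norm a * norm b * c1"
    using cscale.pos_bounded by auto
  obtain c2 where c2: "c2 > 0" "\<And>w. norm (cmap j w) \<le> norm w * c2"
    using cj.pos_bounded by auto
  define c where "c = c1 * c2 * M"
  have c: "c > 0" using M c1 c2 by (simp add: c_def)
  have est: "norm (Res z x - Res z0 x) \<le> c * norm (z - z0) * norm (Res z x)" if "z \<in> \<Omega>" for z x
  proof -
    have "norm (Res z x - Res z0 x) \<le> norm (cscale (z0 - z) (cmap j (Res z x))) * M"
      unfolding resolvent_identity[OF that z0] by (rule M)
    also have "\<dots> \<le> norm (z0 - z) * (norm (Res z x) * c2) * c1 * M"
      using M c1 c2 by (intro mult_right_mono order_trans[OF c1(2)] mult_left_mono c2) auto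
    finally show ?thesis by (simp add: c_def norm_minus_commute mult_ac)
  qed
  show ?thesis
  proof (intro exI conjI allI impI)
    fix z x assume z: "z \<in> \<Omega>" "norm (z - z0) < 1 / (2 * c)"
    then have "c * norm (z - z0) \<le> 1/2" using c by (simp add: field_simps)
    then have "c * norm (z - z0) * norm (Res z x) \<le> 1/2 * norm (Res z x)"
      by (rule mult_right_mono) simp
    moreover have "norm (Res z x) \<le> norm (Res z0 x) + norm (Res z x - Res z0 x)"
      by (metis norm_triangle_sub)
    ultimately have "norm (Res z x) \<le> 2 * norm (Res z0 x)" using est[OF z(1), of x] by linarith
    also have "\<dots> \<le> 2 * (norm x * M)" using M(2)[of x] by simp
    finally have "c * norm (z - z0) * norm (Res z x) \<le> c * norm (z - z0) * (2 * (norm x * M))"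
      using c by (intro mult_left_mono) auto
    with est[OF z(1), of x] show "norm (Res z x - Res z0 x) \<le> (2 * c * M) * norm (z - z0) * norm x"
      by (simp add: mult_ac)
  qed (use c M in auto)
qed

text \<open>
  The complex derivative of \<open>z \<mapsto> Res z x\<close>.
\<close>

definition "dRes x z = - Res z (cmap j (Res z x))"

lemma Res_has_derivative:
  assumes z0: "z0 \<in> \<Omega>" 
  shows "((\<lambda>z. Res z x) has_derivative (\<lambda>h. cscale h (dRes x z0))) (at z0)"
proof -
  interpret R: bounded_linear "Res z0" by (rule bounded_linear_Res[OF z0])
  obtain C d where C: "C \<ge> 0" "d > 0" 
    "\<And>z x. z \<in> \<Omega> \<Longrightarrow> norm (z - z0) < d \<Longrightarrow> norm (Res z x - Res z0 x) \<le> C * norm (z - z0) * norm x"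
    using Res_local_Lipschitz[OF z0] by blast
  obtain M where M: "M > 0" "\<And>x. norm (Res z0 x) \<le> norm x * M"
    using R.pos_bounded by auto
  obtain c1 where c1: "c1 > 0" "\<And>a (b::'x\<times>'x). norm (cscale a b) \<le> norm a * norm b * c1"
    using cscale.pos_bounded by auto
  obtain c2 where c2: "c2 > 0" "\<And>w. norm (cmap j w) \<le> norm w * c2"
    using cj.pos_bounded by auto
  define K where "K = C * norm x * c2 * c1 * M"
  have K0: "K \<ge> 0" using C M c1 c2 by (simp add: K_def)
  have op: "open \<Omega>" unfolding \<Omega>_def by (intro open_Collect_conj open_Collect_less continuous_intros)
  then obtain d' where d': "d' > 0" "ball z0 d' \<subseteq> \<Omega>" using z0 by (meson openE)
  have est: "norm (Res z x - Res z0 x - cscale (z - z0) (dRes x z0)) \<le> K * norm (z - z0) * norm (z - z0)"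
    if z: "norm (z - z0) < d" "norm (z - z0) < d'" for z
  proof -
    have zO: "z \<in> \<Omega>" using d' z by (auto simp: dist_norm norm_minus_commute)
    have 1: "cscale (z - z0) (dRes x z0) = Res z0 (cscale (z0 - z) (cmap j (Res z0 x)))"
      by (simp add: dRes_def Res_cscale[OF z0] cscale_simps R.diff)
    have 2: "Res z x - Res z0 x - cscale (z - z0) (dRes x z0) =
        Res z0 (cscale (z0 - z) (cmap j (Res z x - Res z0 x)))"
      unfolding 1 by (simp only: cj.diff cscale.diff_right R.diff) (subst resolvent_identity[OF zO z0], rule refl)
    have "norm (Res z0 (cscale (z0 - z) (cmap j (Res z x - Res z0 x))))
       \<le> norm (z0 - z) * (norm (Res z x - Res z0 x) * c2) * c1 * M"
      using M c1 c2 by (intro order_trans[OF M(2)] mult_right_mono order_trans[OF c1(2)] mult_left_mono c2) auto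
    also have "\<dots> \<le> norm (z0 - z) * ((C * norm (z - z0) * norm x) * c2) * c1 * M"
      using M c1 c2 C(3)[OF zO z(1)] by (intro mult_right_mono mult_left_mono) auto
    also have "\<dots> = K * norm (z - z0) * norm (z - z0)"
      by (simp add: K_def norm_minus_commute mult_ac)
    finally show ?thesis unfolding 2 .
  qed
  show ?thesis
  proof (rule has_derivativeI)
    show "bounded_linear (\<lambda>h. cscale h (dRes x z0))" by (rule cscale.bounded_linear_left)
    have "((\<lambda>z. norm (z - z0) * K) \<longlongrightarrow> norm (z0 - z0) * K) (at z0)"
      by (intro tendsto_intros)
    then have lim: "((\<lambda>z. norm (z - z0) * K) \<longlongrightarrow> 0) (at z0)" by simp
    have ev: "\<forall>\<^sub>F z in at z0. norm (z - z0) < min d d'"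
      unfolding eventually_at using C d' by (intro exI[of _ "min d d'"]) (auto simp: dist_norm)
    show "((\<lambda>z. ((Res z x - Res z0 x) - cscale (z - z0) (dRes x z0)) /\<^sub>R norm (z - z0)) \<longlongrightarrow> 0) (at z0)"
    proof (rule Lim_null_comparison[OF eventually_mono[OF ev] lim])
      fix z assume z: "norm (z - z0) < min d d'"
      show "norm ((Res z x - Res z0 x - cscale (z - z0) (dRes x z0)) /\<^sub>R norm (z - z0)) \<le> norm (z - z0) * K"
      proof (cases "z = z0")
        case False
        define v where "v = Res z x - Res z0 x - cscale (z - z0) (dRes x z0)"
        have "norm v \<le> (norm (z - z0) * K) * norm (z - z0)" unfolding v_def using est[of z] z by (simp add: mult_ac)
        then have "norm v / norm (z - z0) \<le> norm (z - z0) * K" using False by (simp add: pos_divide_le_eq)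
        then show ?thesis unfolding v_def[symmetric] by (simp add: divide_inverse_commute)
      qed (use K0 in simp)
    qed
  qed
qed

lemma continuous_on_Res:
  assumes "continuous_on S y" "continuous_on S f" "f ` S \<subseteq> \<Omega>"
  shows "continuous_on S (\<lambda>s. Res (f s) (y s))"
  unfolding continuous_on_def
proof
  fix s assume s: "s \<in> S"
  then have z0: "f s \<in> \<Omega>" using assms by auto
  interpret R: bounded_linear "Res (f s)" by (rule bounded_linear_Res[OF z0])
  obtain C d where C: "C \<ge> 0" "d > 0" 
    "\<And>z x. z \<in> \<Omega> \<Longrightarrow> norm (z - f s) < d \<Longrightarrow> norm (Res z x - Res (f s) x) \<le> C * norm (z - f s) * norm x"
    using Res_local_Lipschitz[OF z0] by blast
  have f: "(f \<longlongrightarrow> f s) (at s within S)" and y: "(y \<longlongrightarrow> y s) (at s within S)"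
    using assms s by (auto simp: continuous_on_def)
  have 1: "((\<lambda>t. Res (f s) (y t)) \<longlongrightarrow> Res (f s) (y s)) (at s within S)"
    by (rule R.tendsto[OF y])
  have "((\<lambda>t. C * norm (f t - f s) * norm (y t)) \<longlongrightarrow> C * norm (f s - f s) * norm (y s)) (at s within S)"
    by (intro tendsto_intros f y)
  then have lim: "((\<lambda>t. C * norm (f t - f s) * norm (y t)) \<longlongrightarrow> 0) (at s within S)" by simp
  have "\<forall>\<^sub>F t in at s within S. dist (f t) (f s) < d" using f C(2) by (rule tendstoD)
  moreover have "\<forall>\<^sub>F t in at s within S. t \<in> S" by (simp add: eventually_at_filter)
  ultimately have "\<forall>\<^sub>F t in at s within S. norm (Res (f t) (y t) - Res (f s) (y t)) \<le> C * norm (f t - f s) * norm (y t)"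
    by eventually_elim (rule C(3), use assms in \<open>auto simp: dist_norm\<close>)
  from Lim_null_comparison[OF this lim] 1
  have "((\<lambda>t. (Res (f t) (y t) - Res (f s) (y t)) + Res (f s) (y t)) \<longlongrightarrow> 0 + Res (f s) (y s)) (at s within S)"
    by (rule tendsto_add)
  then show "((\<lambda>s. Res (f s) (y s)) \<longlongrightarrow> Res (f s) (y s)) (at s within S)" by simp
qed

lemma Res_bounded_on_compact:
  assumes "compact K" "K \<subseteq> \<Omega>"
  obtains M where "M \<ge> 0" "\<And>z x. z \<in> K \<Longrightarrow> norm (Res z x) \<le> M * norm x"
proof -
  have "continuous_on K (\<lambda>z. onorm (Res z))"
    unfolding continuous_on_def
  proof
    fix z0 assume "z0 \<in> K"
    then have z0: "z0 \<in> \<Omega>" using assms by auto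
    obtain C d where C: "C \<ge> 0" "d > 0" 
      "\<And>z x. z \<in> \<Omega> \<Longrightarrow> norm (z - z0) < d \<Longrightarrow> norm (Res z x - Res z0 x) \<le> C * norm (z - z0) * norm x"
      using Res_local_Lipschitz[OF z0] by blast
    have "((\<lambda>z. C * norm (z - z0)) \<longlongrightarrow> C * norm (z0 - z0)) (at z0 within K)"
      by (intro tendsto_intros)
    then have lim: "((\<lambda>z. C * norm (z - z0)) \<longlongrightarrow> 0) (at z0 within K)" by simp
    have est: "norm (onorm (Res z) - onorm (Res z0)) \<le> C * norm (z - z0)"
      if z: "z \<in> \<Omega>" "norm (z - z0) < d" for z
    proof -
      have "onorm (Res z) \<le> onorm (Res z0) + C * norm (z - z0)"
      proof (rule onorm_bound)
        fix x
        have "norm (Res z x) \<le> norm (Res z0 x) + norm (Res z x - Res z0 x)"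
          by (metis norm_triangle_sub)
        also have "\<dots> \<le> onorm (Res z0) * norm x + C * norm (z - z0) * norm x"
          by (intro add_mono onorm bounded_linear_Res z0 C z)
        finally show "norm (Res z x) \<le> (onorm (Res z0) + C * norm (z - z0)) * norm x"
          by (simp add: algebra_simps)
      qed (use C onorm_pos_le[OF bounded_linear_Res[OF z0]] in auto)
      moreover have "onorm (Res z0) \<le> onorm (Res z) + C * norm (z - z0)"
      proof (rule onorm_bound)
        fix x
        have "norm (Res z0 x) \<le> norm (Res z x) + norm (Res z x - Res z0 x)"
          by (metis norm_triangle_sub norm_minus_commute)
        also have "\<dots> \<le> onorm (Res z) * norm x + C * norm (z - z0) * norm x"
          by (intro add_mono onorm bounded_linear_Res z C)
        finally show "norm (Res z0 x) \<le> (onorm (Res z) + C * norm (z - z0)) * norm x"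
          by (simp add: algebra_simps)
      qed (use C onorm_pos_le[OF bounded_linear_Res[OF z(1)]] in auto)
      ultimately show ?thesis by (simp add: abs_le_iff)
    qed
    have "\<forall>\<^sub>F z in at z0 within K. norm (onorm (Res z) - onorm (Res z0)) \<le> C * norm (z - z0)"
      unfolding eventually_at using C(2) assms est by (intro exI[of _ d]) (auto simp: dist_norm)
    from Lim_null_comparison[OF this lim]
    show "((\<lambda>z. onorm (Res z)) \<longlongrightarrow> onorm (Res z0)) (at z0 within K)"
      by (simp add: LIM_zero_iff)
  qed
  from compact_imp_bounded[OF compact_continuous_image[OF this assms(1)]]
  obtain M where "\<forall>y\<in>(\<lambda>z. onorm (Res z)) ` K. norm y \<le> M"
    unfolding bounded_iff by blast
  then have M: "onorm (Res z) \<le> M" if "z \<in> K" for z using that by fastforce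
  show thesis
  proof (rule that[of "\<bar>M\<bar>"])
    fix z x assume z: "z \<in> K"
    then have "norm (Res z x) \<le> onorm (Res z) * norm x" using assms by (intro onorm bounded_linear_Res) auto
    also have "\<dots> \<le> \<bar>M\<bar> * norm x" using M[OF z] by (intro mult_right_mono) auto
    finally show "norm (Res z x) \<le> \<bar>M\<bar> * norm x" .
  qed simp
qed

end

context isolated_zero
begin

section \<open>The Riesz projector\<close>

lemma rcis_in: "0 < r \<Longrightarrow> r < r0 \<Longrightarrow> rcis r \<theta> \<in> \<Omega>"
  by (simp add: \<Omega>_def)

definition "integrand r x \<theta> = cscale (rcis r \<theta> / of_real (2 * pi)) (Res (rcis r \<theta>) x)"

lemma continuous_rcis: "continuous_on S f \<Longrightarrow> continuous_on S g \<Longrightarrow> continuous_on S (\<lambda>s. rcis (f s) (g s))"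
  unfolding rcis_def cis_conv_exp by (intro continuous_intros)

lemma continuous_integrand: "0 < r \<Longrightarrow> r < r0 \<Longrightarrow> continuous_on S (integrand r x)"
  unfolding integrand_def
  by (intro continuous_on_Res cscale.continuous_on continuous_rcis continuous_intros)
    (auto simp: rcis_in)

lemma integrand_integrable: "0 < r \<Longrightarrow> r < r0 \<Longrightarrow> integrand r x integrable_on {0..2*pi}"
  by (intro integrable_continuous_interval continuous_integrand)

definition "integrand_dr r x \<theta> = cscale (cis \<theta> / of_real (2 * pi)) (Res (rcis r \<theta>) x)
   + cscale (rcis r \<theta> / of_real (2 * pi)) (cscale (cis \<theta>) (dRes x (rcis r \<theta>)))"

lemma Res_curve:
  assumes "(f has_vector_derivative f') (at t within S)" "f t \<in> \<Omega>"
  shows "((\<lambda>t. Res (f t) x) has_vector_derivative cscale f' (dRes x (f t))) (at t within S)"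
proof -
  have "((\<lambda>t. Res (f t) x) has_derivative (\<lambda>h. cscale (h *\<^sub>R f') (dRes x (f t)))) (at t within S)"
    using has_derivative_compose[OF assms(1)[unfolded has_vector_derivative_def] Res_has_derivative[OF assms(2)]]
    by simp
  then show ?thesis unfolding has_vector_derivative_def by (simp add: cscale.scaleR_left)
qed

lemma integrand_radius_derivative:
  assumes "0 < r" "r < r0"
  shows "((\<lambda>r. integrand r x \<theta>) has_vector_derivative integrand_dr r x \<theta>) (at r within S)"
proof -
  have 1: "((\<lambda>r. rcis r \<theta>) has_vector_derivative cis \<theta>) (at r within S)"
    unfolding rcis_def has_vector_derivative_def
    by (rule derivative_eq_intros refl | simp add: scaleR_conv_of_real)+
  have 2: "((\<lambda>r. rcis r \<theta> / of_real (2*pi)) has_vector_derivative cis \<theta> / of_real (2*pi)) (at r within S)"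
    by (rule has_vector_derivative_divide[OF 1])
  show ?thesis
    using cscale.has_vector_derivative[OF 2 Res_curve[OF 1 rcis_in[OF assms]]]
    unfolding integrand_def integrand_dr_def by (simp add: add.commute)
qed

text \<open>
  The integrand is \<open>r e\<^sup>i\<^sup>\<theta> Res (r e\<^sup>i\<^sup>\<theta>) x\<close> up to a constant.  By analyticity of the resolvent its
  derivative in \<open>r\<close> is \<open>- \<i>\<close> times the derivative in \<open>\<theta>\<close> of the periodic function \<open>e\<^sup>i\<^sup>\<theta> Res (r e\<^sup>i\<^sup>\<theta>) x\<close>.
  This replaces Cauchy's theorem for vector-valued functions.
\<close>

lemma integrand_dr_integral_zero:
  assumes "0 < r" "r < r0"
  shows "integral {0..2*pi} (integrand_dr r x) = 0"
proof -
  define H where "H \<theta> = cscale (cis \<theta> / of_real (2*pi)) (Res (rcis r \<theta>) x)" for \<theta>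
  have "(H has_vector_derivative cscale \<i> (integrand_dr r x \<theta>)) (at \<theta> within {0..2*pi})" for \<theta>
  proof -
    have 1: "(cis has_vector_derivative \<i> * cis \<theta>) (at \<theta> within {0..2*pi})"
      unfolding has_vector_derivative_def by (rule has_derivative_cis[OF has_derivative_ident])
    have 2: "(rcis r has_vector_derivative \<i> * rcis r \<theta>) (at \<theta> within {0..2*pi})"
      unfolding rcis_def using has_vector_derivative_mult_right[OF 1, of "of_real r"] by (simp add: mult_ac)
    have 3: "((\<lambda>\<theta>. cis \<theta> / of_real (2*pi)) has_vector_derivative \<i> * cis \<theta> / of_real (2*pi)) (at \<theta> within {0..2*pi})"
      by (rule has_vector_derivative_divide[OF 1])
    show ?thesis
      using cscale.has_vector_derivative[OF 3 Res_curve[OF 2 rcis_in[OF assms]]]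
      unfolding H_def integrand_dr_def
      by (simp add: cscale_simps add.commute mult_ac)
  qed
  then have "((\<lambda>\<theta>. cscale \<i> (integrand_dr r x \<theta>)) has_integral H (2*pi) - H 0) {0..2*pi}"
    by (intro fundamental_theorem_of_calculus) auto
  moreover have "H (2*pi) = H 0" by (simp add: H_def rcis_def)
  ultimately have "((\<lambda>\<theta>. cscale \<i> (integrand_dr r x \<theta>)) has_integral 0) {0..2*pi}" by simp
  from has_integral_linear[OF this cscale.bounded_linear_right[of "-\<i>"]]
  show ?thesis by (simp add: o_def cscale_simps integral_unique)
qed

lemma continuous_integrand_dr:
  assumes "S \<subseteq> {0<..<r0}"
  shows "continuous_on (S \<times> K) (\<lambda>(r, \<theta>). integrand_dr r x \<theta>)"
proof -
  have c: "continuous_on (S \<times> K) (\<lambda>p. cis (snd p))"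
    unfolding cis_conv_exp by (intro continuous_intros)
  show ?thesis
    unfolding integrand_dr_def dRes_def case_prod_beta
    by (intro continuous_on_Res cscale.continuous_on continuous_rcis continuous_intros c
        bounded_linear.continuous_on[OF bounded_linear_cmap_j])
      (use assms in \<open>auto intro!: rcis_in\<close>)
qed

lemma dunford_integral_radius_independent:
  assumes "0 < r" "r < r0" "0 < s" "s < r0"
  shows "integral {0..2*pi} (integrand r x) = integral {0..2*pi} (integrand s x)"
proof -
  let ?U = "{0<..<r0}"
  have "((\<lambda>r. integral (cbox 0 (2*pi)) (integrand r x)) has_vector_derivative 0) (at r within ?U)" if "r \<in> ?U" for r
  proof -
    have "((\<lambda>r. integral (cbox 0 (2*pi)) (integrand r x)) has_vector_derivative
        integral (cbox 0 (2*pi)) (integrand_dr r x)) (at r within ?U)"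
    proof (rule leibniz_rule_vector_derivative[OF _ _ continuous_integrand_dr that])
      show "((\<lambda>r. integrand r x \<theta>) has_vector_derivative integrand_dr r x \<theta>) (at r within ?U)" if "r \<in> ?U" for r \<theta>
        using that by (intro integrand_radius_derivative) auto
      show "integrand r x integrable_on cbox 0 (2*pi)" if "r \<in> ?U" for r
        using that integrand_integrable[of r x] by simp
    qed auto
    then show ?thesis using integrand_dr_integral_zero[of r x] that by simp
  qed
  then have D: "((\<lambda>r. integral {0..2*pi} (integrand r x)) has_derivative (\<lambda>h. 0)) (at r within ?U)" if "r \<in> ?U" for r
    using that by (simp add: has_vector_derivative_def)
  obtain c where "\<And>r. r \<in> ?U \<Longrightarrow> integral {0..2*pi} (integrand r x) = c"
    using has_derivative_zero_constant[OF _ D] by auto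
  then show ?thesis using assms by simp
qed

definition "P = riesz_projector j L 0"

text \<open>
  The Riesz projector is a definite description of the common value of the integrals over all small
  circles, so it has a value precisely because the integrals exist and do not depend on the radius.
\<close>

lemma P_has_integral:
  assumes "0 < r" "r < r0"
  shows "(integrand r x has_integral P x) {0..2*pi}"
proof -
  have k: "(\<lambda>\<theta>. cscale (rcis r \<theta> / of_real (2 * pi)) (inv (shifted j L (0 + rcis r \<theta>)) x)) = integrand r x" for r
    by (auto simp: integrand_def Res_def)
  let ?I = "integral {0..2*pi} (integrand r x)"
  have "P x = ?I"
    unfolding P_def riesz_projector_def k
  proof (rule the_equality)
    have "\<forall>\<^sub>F s in at_right 0. s \<in> {0<..<r0}"
      using r0 by (rule eventually_at_right_real)
    then show "\<forall>\<^sub>F s in at_right 0. (integrand s x has_integral ?I) {0..2*pi}"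
    proof (rule eventually_mono)
      fix s assume s: "s \<in> {0<..<r0}"
      then have "(integrand s x has_integral integral {0..2*pi} (integrand s x)) {0..2*pi}"
        by (intro integrable_integral integrand_integrable) auto
      then show "(integrand s x has_integral ?I) {0..2*pi}"
        using dunford_integral_radius_independent[OF assms, of s x] s by simp
    qed
  next
    fix y assume "\<forall>\<^sub>F s in at_right 0. (integrand s x has_integral y) {0..2*pi}"
    moreover have "\<forall>\<^sub>F s in at_right 0. s \<in> {0<..<r0}"
      using r0 by (rule eventually_at_right_real)
    ultimately have "\<forall>\<^sub>F s in at_right (0::real). y = ?I"
    proof eventually_elim
      case (elim s)
      then show ?case
        using dunford_integral_radius_independent[OF assms, of s x] integral_unique[OF elim(1)] by simp
    qed
    then show "y = ?I" by simp
  qed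
  then show ?thesis using integrable_integral[OF integrand_integrable[OF assms]] by simp
qed

lemma half_radius: "0 < r0/2" "r0/2 < r0" using r0 by auto

lemma P_eqI: "(integrand (r0/2) x has_integral y) {0..2*pi} \<Longrightarrow> P x = y"
  by (rule has_integral_unique[OF P_has_integral[OF half_radius]])

lemma P_cscale: "P (cscale c x) = cscale c (P x)"
proof (rule P_eqI)
  have "integrand (r0/2) (cscale c x) = cscale c \<circ> integrand (r0/2) x"
    unfolding integrand_def by (simp add: fun_eq_iff Res_cscale[OF rcis_in[OF half_radius]] cscale_simps(1) mult.commute)
  then show "(integrand (r0/2) (cscale c x) has_integral cscale c (P x)) {0..2*pi}"
    using has_integral_linear[OF P_has_integral[OF half_radius, of x] cscale.bounded_linear_right[of c]] by simp
qed

lemma bounded_linear_P: "bounded_linear P"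
proof -
  note R = bounded_linear_Res[OF rcis_in[OF half_radius], THEN bounded_linear.linear]
  have add: "P (x + y) = P x + P y" for x y
  proof (rule P_eqI)
    have "integrand (r0/2) (x + y) = (\<lambda>\<theta>. integrand (r0/2) x \<theta> + integrand (r0/2) y \<theta>)"
      unfolding integrand_def by (simp add: fun_eq_iff linear_add[OF R] cscale_simps(7))
    then show "(integrand (r0/2) (x + y) has_integral P x + P y) {0..2*pi}"
      using has_integral_add[OF P_has_integral[OF half_radius, of x] P_has_integral[OF half_radius, of y]] by simp
  qed
  have scale: "P (c *\<^sub>R x) = c *\<^sub>R P x" for c x
    using P_cscale[of "of_real c" x] by (simp add: cscale_simps)
  have "compact (rcis (r0/2) ` {0..2*pi})"
    by (intro compact_continuous_image continuous_rcis continuous_intros) auto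
  moreover have "rcis (r0/2) ` {0..2*pi} \<subseteq> \<Omega>" using rcis_in[OF half_radius] by auto
  ultimately obtain M where M: "M \<ge> 0" "\<And>z x. z \<in> rcis (r0/2) ` {0..2*pi} \<Longrightarrow> norm (Res z x) \<le> M * norm x"
    by (rule Res_bounded_on_compact) blast
  obtain c1 where c1: "c1 > 0" "\<And>a (b::'z\<times>'z). norm (cscale a b) \<le> norm a * norm b * c1"
    using cscale.pos_bounded by auto
  have "norm (P x) \<le> norm x * (r0/2 / (2*pi) * M * c1 * (2*pi))" for x
  proof -
    have "norm (P x) \<le> (r0/2 / (2*pi) * (M * norm x) * c1) * measure lborel (cbox 0 (2*pi))"
    proof (rule has_integral_bound)
      show "(integrand (r0/2) x has_integral P x) (cbox 0 (2*pi))" using P_has_integral[OF half_radius] by simp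
      fix \<theta> assume "\<theta> \<in> cbox 0 (2*pi)"
      then have m: "norm (Res (rcis (r0/2) \<theta>) x) \<le> M * norm x" by (intro M) auto
      have "norm (integrand (r0/2) x \<theta>) \<le> norm (rcis (r0/2) \<theta> / of_real (2*pi)) * norm (Res (rcis (r0/2) \<theta>) x) * c1"
        unfolding integrand_def by (rule c1)
      also have "\<dots> \<le> norm (rcis (r0/2) \<theta> / of_real (2*pi)) * (M * norm x) * c1"
        using c1 by (intro mult_right_mono mult_left_mono m) auto
      also have "\<dots> = r0/2 / (2*pi) * (M * norm x) * c1" using r0 by (simp add: norm_divide norm_mult)
      finally show "norm (integrand (r0/2) x \<theta>) \<le> r0/2 / (2*pi) * (M * norm x) * c1" .
    qed (use M c1 r0 in auto)
    then show ?thesis by (simp add: mult_ac)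
  qed
  then show ?thesis by (intro bounded_linear_intro add scale)
qed

text \<open>
  On the kernel of \<open>L\<close> the resolvent is multiplication by \<open>1 / z\<close>, whose residue is \<open>1\<close>.
\<close>

lemma P_fixes_kernel:
  assumes "cmap L w = 0"
  shows "P (cmap j w) = w"
proof (rule P_eqI)
  have "integrand (r0/2) (cmap j w) = (\<lambda>\<theta>. (1 / (2*pi)) *\<^sub>R w)"
  proof
    fix \<theta>
    let ?z = "rcis (r0/2) \<theta>"
    have z: "?z \<in> \<Omega>" by (rule rcis_in[OF half_radius])
    then have "Res ?z (cscale ?z (cmap j w)) = w"
      by (intro Res_eqI) (auto simp: shifted_def assms)
    then have 1: "cscale ?z (Res ?z (cmap j w)) = w" by (simp only: Res_cscale[OF z])
    have "integrand (r0/2) (cmap j w) \<theta> = cscale (of_real (1 / (2*pi)) * ?z) (Res ?z (cmap j w))"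
      by (simp add: integrand_def)
    also have "\<dots> = cscale (of_real (1 / (2*pi))) (cscale ?z (Res ?z (cmap j w)))"
      by (simp only: cscale_simps(1))
    also have "\<dots> = (1 / (2*pi)) *\<^sub>R w" unfolding 1 by (rule cscale_simps(11))
    finally show "integrand (r0/2) (cmap j w) \<theta> = (1 / (2*pi)) *\<^sub>R w" .
  qed
  then show "(integrand (r0/2) (cmap j w) has_integral w) {0..2*pi}"
    using has_integral_const_real[of "(1 / (2*pi)) *\<^sub>R w" 0 "2*pi"] by simp
qed

text \<open>
  The two integrals are compared after the embedding into the large space, where the bounded operator
  \<open>B\<close> can be moved through the integral.
\<close>

lemma P_commutes:
  assumes B: "bounded_linear B" and comm: "\<And>u. j (BZ u) = B (j u)" "\<And>u. L (BZ u) = B (L u)"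
  shows "cmap j (P (cmap B x)) = cmap B (cmap j (P x))"
proof -
  have BZ: "cmap j (cmap BZ w) = cmap B (cmap j w)" "cmap L (cmap BZ w) = cmap B (cmap L w)" for w
    by (cases w; simp add: cmap_def comm)+
  have lB: "linear B" using B by (rule bounded_linear.linear)
  have bB: "bounded_linear (cmap B)" by (rule bounded_linear_cmap[OF B])
  have "cmap j (integrand (r0/2) (cmap B x) \<theta>) = cmap B (cmap j (integrand (r0/2) x \<theta>))" for \<theta>
  proof -
    let ?z = "rcis (r0/2) \<theta>"
    have z: "?z \<in> \<Omega>" by (rule rcis_in[OF half_radius])
    have "A ?z (cmap BZ (Res ?z x)) = cmap B (A ?z (Res ?z x))"
      using bB by (simp add: shifted_def BZ cmap_cscale[OF lB] bounded_linear.linear linear_diff)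
    then have "Res ?z (cmap B x) = cmap BZ (Res ?z x)"
      by (intro Res_eqI[OF z]) (simp add: A_Res[OF z])
    then show ?thesis
      by (simp add: integrand_def cmap_cscale[OF linear_j] cmap_cscale[OF lB] BZ)
  qed
  then have eq: "cmap j \<circ> integrand (r0/2) (cmap B x) = (cmap B \<circ> cmap j) \<circ> integrand (r0/2) x" by auto
  have "(cmap j \<circ> integrand (r0/2) (cmap B x) has_integral cmap j (P (cmap B x))) {0..2*pi}"
    by (rule has_integral_linear[OF P_has_integral[OF half_radius] bounded_linear_cmap_j])
  moreover have "((cmap B \<circ> cmap j) \<circ> integrand (r0/2) x has_integral (cmap B \<circ> cmap j) (P x)) {0..2*pi}"
    by (rule has_integral_linear[OF P_has_integral[OF half_radius]]) (simp add: o_def bounded_linear_compose[OF bB bounded_linear_cmap_j])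
  ultimately show ?thesis unfolding eq by (auto dest: has_integral_unique)
qed

lemma P_L: "cmap j (P (cmap L w)) = cmap L (P (cmap j w))"
proof -
  have "cmap j (integrand (r0/2) (cmap L w) \<theta>) = cmap L (integrand (r0/2) (cmap j w) \<theta>)" for \<theta>
  proof -
    let ?z = "rcis (r0/2) \<theta>"
    have z: "?z \<in> \<Omega>" by (rule rcis_in[OF half_radius])
    note lR = bounded_linear_Res[OF z, THEN bounded_linear.linear]
    have "w = Res ?z (cscale ?z (cmap j w)) - Res ?z (cmap L w)"
      using Res_A[OF z, of w] by (simp add: shifted_def linear_diff[OF lR])
    then have "Res ?z (cmap L w) = cscale ?z (Res ?z (cmap j w)) - w"
      by (simp add: Res_cscale[OF z] algebra_simps)
    then have "cmap j (Res ?z (cmap L w)) = cscale ?z (cmap j (Res ?z (cmap j w))) - cmap j w"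
      by (simp add: cj.diff cmap_cscale[OF linear_j])
    also have "\<dots> = cmap L (Res ?z (cmap j w))"
      using A_Res[OF z, of "cmap j w"] by (simp add: shifted_def algebra_simps)
    finally show ?thesis by (simp add: integrand_def cmap_cscale[OF linear_j] cmap_cscale[OF linear_L])
  qed
  then have eq: "cmap j \<circ> integrand (r0/2) (cmap L w) = cmap L \<circ> integrand (r0/2) (cmap j w)" by auto
  have "(cmap j \<circ> integrand (r0/2) (cmap L w) has_integral cmap j (P (cmap L w))) {0..2*pi}"
    by (rule has_integral_linear[OF P_has_integral[OF half_radius] bounded_linear_cmap_j])
  moreover have "(cmap L \<circ> integrand (r0/2) (cmap j w) has_integral cmap L (P (cmap j w))) {0..2*pi}"
    by (rule has_integral_linear[OF P_has_integral[OF half_radius] bounded_linear_cmap_L])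
  ultimately show ?thesis unfolding eq by (auto dest: has_integral_unique)
qed

lemma P_cconj: "P (cconj x) = cconj (P x)"
proof (rule P_eqI)
  have A: "A (cnj z) (cconj w) = cconj (A z w)" for z w
    by (simp add: shifted_def cmap_cconj linear_j linear_L cconj_cscale
        linear_diff[OF bounded_linear.linear[OF bounded_linear_cconj]])
  have "integrand (r0/2) (cconj x) \<theta> = cconj (integrand (r0/2) x (2*pi - \<theta>))" for \<theta>
  proof -
    let ?z = "rcis (r0/2) (2*pi - \<theta>)"
    have z: "?z \<in> \<Omega>" by (rule rcis_in[OF half_radius])
    \<comment> \<open>Conjugation maps the circle to itself, with \<open>\<theta>\<close> replaced by \<open>2 \<pi> - \<theta>\<close>.\<close>
    have cz: "rcis (r0/2) \<theta> = cnj ?z" 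
      by (simp add: complex_eq_iff rcis_def cos_diff sin_diff)
    have "cnj ?z \<in> \<Omega>" using z by (simp add: \<Omega>_def)
    then have "Res (cnj ?z) (cconj x) = cconj (Res ?z x)"
      by (intro Res_eqI) (auto simp: A A_Res[OF z])
    then show ?thesis unfolding integrand_def cz by (simp add: cconj_cscale)
  qed
  then have eq: "integrand (r0/2) (cconj x) = (\<lambda>\<theta>. cconj (integrand (r0/2) x (2*pi - \<theta>)))" by auto
  have "((\<lambda>\<theta>. integrand (r0/2) x (-\<theta>)) has_integral P x) {-(2*pi)..0}"
    using P_has_integral[OF half_radius, of x] has_integral_reflect_real[of "integrand (r0/2) x" "P x" "2*pi" 0] by simp
  then have "((\<lambda>\<theta>. integrand (r0/2) x (- (\<theta> - 2*pi))) has_integral P x) {-(2*pi) + 2*pi..0 + 2*pi}"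
    by (subst has_integral_shift_Icc_real[symmetric]) (simp add: o_def)
  then have "((\<lambda>\<theta>. integrand (r0/2) x (2*pi - \<theta>)) has_integral P x) {0..2*pi}" by simp
  from has_integral_linear[OF this bounded_linear_cconj]
  show "(integrand (r0/2) (cconj x) has_integral cconj (P x)) {0..2*pi}" unfolding eq by (simp add: o_def)
qed

end

section \<open>The centre projector\<close>

text \<open>
  Apart from \<open>0\<close>, spectral points have a real part of absolute value greater than \<open>\<gamma>\<close>.
\<close>

lemma isolated_zero_spectral:
  assumes j: "bounded_linear j" and L: "bounded_linear L"
    and spec: "spectral_decomposition j L \<gamma>"
    and only: "\<And>z. eigenvalue j L z \<Longrightarrow> z \<in> centre_spectrum j L \<Longrightarrow> z = 0"
  shows "isolated_zero j L \<gamma>"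
proof (rule isolated_zero.intro)
  show "bounded_linear j" "bounded_linear L" by fact+
  show "\<gamma> > 0" using spec by (simp add: spectral_decomposition_def)
  fix z assume z: "0 < cmod z" "cmod z < \<gamma>"
  have re: "\<bar>Re z\<bar> < \<gamma>" using z abs_Re_le_cmod[of z] by linarith
  show "bij (shifted j L z)"
  proof (rule ccontr)
    assume "\<not> bij (shifted j L z)"
    then have sp: "z \<in> spectrum j L" by (simp add: spectrum_def resolvent_set_def)
    consider "Re z > 0" | "Re z = 0" | "Re z < 0" by linarith
    then show False
    proof cases
      case 1
      with sp have "z \<in> unstable_spectrum j L" by (simp add: unstable_spectrum_def)
      then have "(INF z\<in>unstable_spectrum j L. ereal (Re z)) \<le> ereal (Re z)" by (rule INF_lower)
      moreover have "(INF z\<in>unstable_spectrum j L. ereal (Re z)) > ereal \<gamma>"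
        using spec by (simp add: spectral_decomposition_def)
      ultimately have "ereal \<gamma> < ereal (Re z)" by (rule less_le_trans[rotated])
      then show False using re by simp
    next
      case 2
      with sp have c: "z \<in> centre_spectrum j L" by (simp add: centre_spectrum_def)
      then have "eigenvalue j L z" using spec by (simp add: spectral_decomposition_def)
      then show False using only[OF _ c] z by simp
    next
      case 3
      with sp have "z \<in> stable_spectrum j L" by (simp add: stable_spectrum_def)
      then have "ereal (Re z) \<le> (SUP z\<in>stable_spectrum j L. ereal (Re z))" by (rule SUP_upper)
      moreover have "(SUP z\<in>stable_spectrum j L. ereal (Re z)) < ereal (- \<gamma>)"
        using spec by (simp add: spectral_decomposition_def)
      ultimately have "ereal (Re z) < ereal (- \<gamma>)" by (rule le_less_trans)
      then show False using re by simp
    qed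
  qed
qed

lemma centre_spectrum_eq_0:
  assumes spec: "spectral_decomposition j L \<gamma>"
    and only: "\<And>z. eigenvalue j L z \<Longrightarrow> z \<in> centre_spectrum j L \<Longrightarrow> z = 0"
  shows "centre_spectrum j L = {0}"
  using spec only by (auto simp: spectral_decomposition_def)

lemma independent_product_basis:
  assumes B: "independent B" 
  shows "independent ((\<lambda>b. (b, 0)) ` B \<union> (\<lambda>b. (0, b)) ` B)" (is "independent ?C")
proof -
  have "a \<notin> span (?C - {a})" if a: "a \<in> ?C" for a
  proof
    assume s: "a \<in> span (?C - {a})"
    from a consider b where "b \<in> B" "a = (b, 0)" | b where "b \<in> B" "a = (0, b)" by auto
    then show False
    proof cases
      case 1
      have "span (?C - {a}) \<subseteq> fst -` span (B - {b})"
        using 1 by (intro span_minimal linear_subspace_vimage linear_fst subspace_span)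
          (auto intro: span_base span_zero)
      with s 1 have "b \<in> span (B - {b})" by auto
      with B 1 show False by (auto simp: dependent_def)
    next
      case 2
      have "span (?C - {a}) \<subseteq> snd -` span (B - {b})"
        using 2 by (intro span_minimal linear_subspace_vimage linear_snd subspace_span)
          (auto intro: span_base span_zero)
      with s 2 have "b \<in> span (B - {b})" by auto
      with B 2 show False by (auto simp: dependent_def)
    qed
  qed
  then show ?thesis by (auto simp: dependent_def)
qed

context isolated_zero
begin

text \<open>
  \<open>P\<close> commutes with conjugation, so the second component is zero on real elements.
\<close>

definition "pc x = fst (P (x, 0))"

lemma P_pc: "P (x, y) = (pc x, pc y)"
proof -
  have lP: "linear P" by (rule bounded_linear.linear[OF bounded_linear_P])
  have real: "P (x, 0) = (pc x, 0)" for x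
  proof -
    have "cconj (P (x, 0)) = P (x, 0)" using P_cconj[of "(x, 0)"] by (simp add: cconj_def)
    then have "- snd (P (x, 0)) = snd (P (x, 0))" by (simp add: cconj_def prod_eq_iff)
    then have "2 *\<^sub>R snd (P (x, 0)) = 0" by (metis add.left_inverse scaleR_2)
    then show ?thesis by (simp add: pc_def prod_eq_iff)
  qed
  have "P (x, y) = P (x, 0) + P (cscale \<i> (y, 0))"
    by (simp add: cscale_def flip: linear_add[OF lP])
  also have "\<dots> = (pc x, pc y)" unfolding P_cscale real by (simp add: cscale_def)
  finally show ?thesis .
qed

lemma bounded_linear_pc: "bounded_linear pc"
  unfolding pc_def
  by (intro bounded_linear_compose[OF bounded_linear_fst] bounded_linear_compose[OF bounded_linear_P]
      bounded_linear_Pair bounded_linear_ident bounded_linear_zero)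

lemma pc_commutes:
  assumes "bounded_linear B" "\<And>u. j (BZ u) = B (j u)" "\<And>u. L (BZ u) = B (L u)"
  shows "j (pc (B x)) = B (j (pc x))"
  using P_commutes[OF assms, of "(x, 0)"] assms(1)
  by (simp add: cmap_def P_pc)

lemma pc_fixes_kernel: "L u = 0 \<Longrightarrow> pc (j u) = u"
  using P_fixes_kernel[of "(u, u)"] by (simp add: cmap_def P_pc zero_prod_def)

lemma pc_L: "j (pc (L u)) = L (pc (j u))"
  using P_L[of "(u, u)"] by (simp add: cmap_def P_pc)

text \<open>
  The range of the complexified projector is the product of two copies of the real range, so its
  real dimension, which is four, is twice that of the real range.
\<close>

lemma range_pc_basis:
  assumes fin: "finite_alg_mult j L 0" and mult: "alg_mult j L 0 = 2"
  obtains e1 e2 where "e1 \<noteq> e2" "independent {e1, e2}" "range pc = span {e1, e2}"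
proof -
  have lpc: "linear pc" by (rule bounded_linear.linear[OF bounded_linear_pc])
  have V: "subspace (range pc)" by (rule linear_subspace_image[OF lpc subspace_UNIV])
  have rP: "range P = range pc \<times> range pc"
  proof
    show "range P \<subseteq> range pc \<times> range pc" using P_pc by auto
    show "range pc \<times> range pc \<subseteq> range P" by (auto simp flip: P_pc)
  qed
  obtain B where B: "B \<subseteq> range pc" "independent B" "range pc \<subseteq> span B" "card B = dim (range pc)"
    using basis_exists by blast
  let ?C = "(\<lambda>b. (b, 0)) ` B \<union> (\<lambda>b. (0, b)) ` B"
  have C: "independent ?C" by (rule independent_product_basis[OF B(2)])
  have CP: "?C \<subseteq> range P" unfolding rP using B(1) subspace_0[OF V] by auto
  obtain D where D: "finite D" "range P \<subseteq> span D"
    using fin by (auto simp: finite_alg_mult_def P_def)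
  have "finite ?C" using independent_span_bound[OF D(1) C] subset_trans[OF CP D(2)] by blast
  then have finB: "finite B" by (auto dest!: finite_imageD simp: inj_on_def)
  have "range P \<subseteq> span ?C"
  proof
    fix p assume "p \<in> range P"
    then obtain x y where p: "p = (x, 0) + (0, y)" "x \<in> span B" "y \<in> span B" unfolding rP using B(3) by auto
    have "(\<lambda>b. (b, 0)) ` span B = span ((\<lambda>b. (b, 0)) ` B)" "(\<lambda>b. (0, b)) ` span B = span ((\<lambda>b. (0, b)) ` B)"
      by (intro linear_span_image[symmetric] linearI; simp)+
    then have "(x, 0) \<in> span ?C" "(0, y) \<in> span ?C"
      using p span_mono[of "(\<lambda>b. (b, 0)) ` B" ?C] span_mono[of "(\<lambda>b. (0, b)) ` B" ?C] by auto
    then show "p \<in> span ?C" unfolding p by (rule span_add)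
  qed
  from dim_unique[OF CP this C refl] have "dim (range P) = card ?C" .
  also have "card ?C = card B + card B"
  proof (subst card_Un_disjoint)
    have "0 \<notin> B" using B(2) dependent_zero by blast
    then show "(\<lambda>b. (b, 0)) ` B \<inter> (\<lambda>b. (0, b)) ` B = {}" by auto
  qed (use finB in \<open>auto simp: card_image inj_on_def\<close>)
  finally have "card B = 2" using mult by (simp add: alg_mult_def P_def)
  then obtain e1 e2 where e: "B = {e1, e2}" "e1 \<noteq> e2" by (auto simp: card_2_iff)
  moreover have "range pc = span B" using B span_minimal[OF B(1) V] by auto
  ultimately show thesis using that B(2) by blast
qed

end

section \<open>Circle actions on the plane\<close>

lemma integral_periodic_shift:
  fixes g :: "real \<Rightarrow> real"
  assumes g: "continuous_on UNIV g" and per: "\<And>x. g (x + p) = g x" and p: "p \<ge> 0"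
  shows "integral {0..p} (\<lambda>x. g (x + a)) = integral {0..p} g"
proof -
  have int: "g integrable_on {u..v}" for u v
    by (rule integrable_continuous_interval) (rule continuous_on_subset[OF g], simp)
  have shift: "integral {u..v} (\<lambda>x. g (x + a)) = integral {u + a..v + a} g" for u v a
  proof -
    have "(g \<circ> (+) a has_integral integral {u + a..v + a} g) {u..v}"
      by (subst has_integral_shift_Icc_real) (rule integrable_integral[OF int])
    then show ?thesis by (simp add: o_def add.commute integral_unique)
  qed
  have window: "integral {u..u + p} g = integral {v..v + p} g" if "u \<le> v" for u v
  proof -
    have "integral {u..v} g + integral {v..v + p} g = integral {u..v + p} g"
      using that p int by (intro Henstock_Kurzweil_Integration.integral_combine) auto
    moreover have "integral {u..u + p} g + integral {u + p..v + p} g = integral {u..v + p} g"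
      using that p int by (intro Henstock_Kurzweil_Integration.integral_combine) auto
    moreover have "integral {u + p..v + p} g = integral {u..v} g"
      using shift[of u v p] per by simp
    ultimately show ?thesis by linarith
  qed
  have "integral {a..a + p} g = integral {0..p} g"
  proof (cases "a \<ge> 0")
    case True
    from window[OF this] show ?thesis by simp
  next
    case False
    then have "a \<le> 0" by simp
    from window[OF this] show ?thesis by simp
  qed
  then show ?thesis using shift[of 0 p a] by (simp add: add.commute)
qed

text \<open>
  The real parts of the values form an interval that contains \<open>1\<close> and, for a suitable power of a
  nontrivial value, a nonpositive number.  Since the values are closed under conjugation they
  contain the whole right half of the circle, and every point of the circle is the square of a point
  of that half.
\<close>

lemma circle_character_surj:
  fixes c :: "real \<Rightarrow> complex"
  assumes cont: "continuous_on UNIV c" and unit: "\<And>x. cmod (c x) = 1"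
    and add: "\<And>x y. c (x + y) = c x * c y" and nontriv: "c x0 \<noteq> 1"
    and e: "cmod e = 1"
  shows "\<exists>x. c x = e"
proof -
  have c0: "c 0 = 1"
    using add[of 0 0] unit[of 0] by auto
  have cneg: "c (- x) = cnj (c x)" for x
  proof -
    have "c (- x) * c x = 1" using add[of "-x" x] c0 by simp
    moreover have "cnj (c x) * c x = 1"
      using unit[of x] by (simp add: mult.commute complex_norm_square[symmetric])
    ultimately show ?thesis by (metis mult_right_cancel mult_zero_right zero_neq_one)
  qed
  have cn: "c (real n * x) = c x ^ n" for n x
    by (induction n) (auto simp: c0 add algebra_simps)
  have "\<exists>x. Re (c x) \<le> 0"
  proof -
    define a where "a = Arg (c x0)"
    have "rcis (cmod (c x0)) a = c x0" unfolding a_def by (rule rcis_cmod_Arg)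
    then have ca: "c x0 = cis a" unfolding unit rcis_def by simp
    have "\<bar>Arg (c x0)\<bar> \<le> pi" using Arg_bounded[of "c x0"] by (simp add: abs_le_iff)
    then have a: "\<bar>a\<bar> \<le> pi" "a \<noteq> 0"
      using ca nontriv unfolding a_def[symmetric] by auto
    \<comment> \<open>The first multiple of \<open>|a|\<close> beyond \<open>\<pi> / 2\<close> does not exceed \<open>3 \<pi> / 2\<close> because \<open>|a| \<le> \<pi>\<close>.\<close>
    define n where "n = nat \<lceil>pi / 2 / \<bar>a\<bar>\<rceil>"
    have n: "pi / 2 / \<bar>a\<bar> \<le> real n" "real n \<le> pi / 2 / \<bar>a\<bar> + 1"
    proof -
      have "pi / 2 / \<bar>a\<bar> \<ge> 0" by simp
      then have "0 \<le> \<lceil>pi / 2 / \<bar>a\<bar>\<rceil>" by (metis ceiling_mono ceiling_zero)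
      then have "real n = of_int \<lceil>pi / 2 / \<bar>a\<bar>\<rceil>" unfolding n_def by (rule of_nat_nat)
      then show "pi / 2 / \<bar>a\<bar> \<le> real n" "real n \<le> pi / 2 / \<bar>a\<bar> + 1"
        using le_of_int_ceiling[of "pi / 2 / \<bar>a\<bar>"] of_int_ceiling_le_add_one[of "pi / 2 / \<bar>a\<bar>"] by simp_all
    qed
    have "pi / 2 \<le> real n * \<bar>a\<bar>" using n(1) a by (simp add: field_simps)
    moreover have "real n * \<bar>a\<bar> \<le> (pi / 2 / \<bar>a\<bar> + 1) * \<bar>a\<bar>" using n(2) by (rule mult_right_mono) simp
    moreover have "(pi / 2 / \<bar>a\<bar> + 1) * \<bar>a\<bar> = pi / 2 + \<bar>a\<bar>" using a by (simp add: distrib_right)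
    ultimately have "real n * \<bar>a\<bar> - pi / 2 \<ge> 0" "real n * \<bar>a\<bar> - pi / 2 \<le> pi" using a by linarith+
    then have "sin (real n * \<bar>a\<bar> - pi / 2) \<ge> 0" by (intro sin_ge_zero) auto
    then have "cos (real n * \<bar>a\<bar>) \<le> 0" by (simp add: sin_diff)
    then have "cos (real n * a) \<le> 0" by (cases "a \<ge> 0") auto
    moreover have "Re (c (real n * x0)) = cos (real n * a)" unfolding cn ca Complex.DeMoivre by simp
    ultimately have "Re (c (real n * x0)) \<le> 0" by simp
    then show ?thesis ..
  qed
  then obtain x1 where x1: "Re (c x1) \<le> 0" ..
  have half: "\<exists>x. c x = f" if f: "cmod f = 1" "Re f \<ge> 0" for f
  proof -
    have "connected (range (\<lambda>x. Re (c x)))"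
      by (intro connected_continuous_image continuous_intros cont) simp
    moreover have "Re (c x1) \<in> range (\<lambda>x. Re (c x))" "1 \<in> range (\<lambda>x. Re (c x))"
      using c0 by (auto intro!: image_eqI[of _ _ 0])
    ultimately have "{Re (c x1)..1} \<subseteq> range (\<lambda>x. Re (c x))"
      by (rule connected_contains_Icc)
    moreover have "Re f \<in> {Re (c x1)..1}" using x1 f complex_Re_le_cmod[of f] by auto
    ultimately obtain x where x: "Re (c x) = Re f" by auto
    have "(Re (c x))\<^sup>2 + (Im (c x))\<^sup>2 = (Re f)\<^sup>2 + (Im f)\<^sup>2"
      using f unit[of x] by (simp flip: cmod_power2)
    then have "Im (c x) = Im f \<or> Im (c x) = - Im f" using x by (simp add: power2_eq_iff)
    then show ?thesis
    proof
      assume "Im (c x) = Im f" then show ?thesis using x complex_eqI by blast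
    next
      assume "Im (c x) = - Im f"
      then have "c (- x) = f" using x by (simp add: cneg complex_eq_iff)
      then show ?thesis ..
    qed
  qed
  have "cmod (csqrt e) = 1" using e by (simp add: norm_csqrt)
  then obtain x where "c x = csqrt e" using half[of "csqrt e"] Re_csqrt by blast
  then have "c (x + x) = e" using add[of x x] by (simp flip: power2_eq_square)
  then show ?thesis ..
qed

lemma real_linear_complex: "linear m \<Longrightarrow> m A = Re A *\<^sub>R m 1 + Im A *\<^sub>R m \<i>"
  for m :: "complex \<Rightarrow> 'a::real_vector"
proof -
  assume m: "linear m"
  have "A = Re A *\<^sub>R 1 + Im A *\<^sub>R \<i>" by (simp add: complex_eq_iff)
  then have "m A = m (Re A *\<^sub>R 1 + Im A *\<^sub>R \<i>)" by simp
  also have "\<dots> = Re A *\<^sub>R m 1 + Im A *\<^sub>R m \<i>" by (simp only: linear_add[OF m] linear_scale[OF m])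
  finally show ?thesis .
qed

text \<open>
  A linear isometry of the plane is a rotation or a reflection.  The square of a reflection is the
  identity, so in both cases the square is multiplication by a complex number.
\<close>

lemma isometry_square_complex:
  fixes m :: "complex \<Rightarrow> complex"
  assumes m: "linear m" and iso: "\<And>A. cmod (m A) = cmod A"
  shows "m (m A) = m (m 1) * A"
proof -
  have 1: "cmod (m 1) = 1" "cmod (m \<i>) = 1" "cmod (m 1 + m \<i>)^2 = 2"
    using iso[of 1] iso[of \<i>] iso[of "1 + \<i>"] linear_add[OF m, of 1 \<i>] by (auto simp: cmod_power2)
  obtain a b where ab: "m 1 = Complex a b" by (cases "m 1")
  obtain c d where cd: "m \<i> = Complex c d" by (cases "m \<i>")
  have e: "a^2 + b^2 = 1" "c^2 + d^2 = 1" "(a + c)^2 + (b + d)^2 = 2"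
    using 1 unfolding ab cd by (simp_all add: cmod_def)
  then have orth: "a * c + b * d = 0" by (simp add: power2_eq_square algebra_simps)
  have "(a * d - b * c)\<^sup>2 = (a\<^sup>2 + b\<^sup>2) * (c\<^sup>2 + d\<^sup>2) - (a * c + b * d)\<^sup>2"
    by (simp add: power2_eq_square algebra_simps)
  then have "a * d - b * c = 1 \<or> a * d - b * c = - 1"
    unfolding e orth by (simp add: power2_eq_1_iff)
  moreover have "(d - a)\<^sup>2 + (c + b)\<^sup>2 = (a\<^sup>2 + b\<^sup>2) + (c\<^sup>2 + d\<^sup>2) - 2 * (a * d - b * c)"
    "(d + a)\<^sup>2 + (c - b)\<^sup>2 = (a\<^sup>2 + b\<^sup>2) + (c\<^sup>2 + d\<^sup>2) + 2 * (a * d - b * c)"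
    by (simp_all add: power2_eq_square algebra_simps)
  ultimately have "(d - a)\<^sup>2 + (c + b)\<^sup>2 = 0 \<or> (d + a)\<^sup>2 + (c - b)\<^sup>2 = 0"
    unfolding e by auto
  then have "(c = - b \<and> d = a) \<or> (c = b \<and> d = - a)"
    unfolding sum_power2_eq_zero_iff by auto
  then have "m \<i> = \<i> * m 1 \<or> m \<i> = - \<i> * m 1" unfolding ab cd by (auto simp: complex_eq_iff)
  then show ?thesis
  proof
    assume i: "m \<i> = \<i> * m 1"
    have r: "m A = A * m 1" for A
      using real_linear_complex[OF m, of A] i by (simp add: complex_eq_iff algebra_simps)
    have "m (m A) = A * m 1 * m 1" by (simp only: r[of A] r[of "A * m 1"])
    moreover have "m (m 1) = m 1 * m 1" by (rule r)
    ultimately show ?thesis by simp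
  next
    assume i: "m \<i> = - \<i> * m 1"
    have r: "m A = cnj A * m 1" for A
      using real_linear_complex[OF m, of A] i by (simp add: complex_eq_iff algebra_simps)
    have "m (m A) = cnj (cnj A * m 1) * m 1" by (simp only: r[of A] r[of "cnj A * m 1"])
    moreover have "m (m 1) = cnj (m 1) * m 1" by (rule r)
    ultimately show ?thesis by simp
  qed
qed

text \<open>
  The scalar product averaged over a period is invariant, so in a basis that is orthonormal for it
  the maps \<open>t \<phi>\<close> are isometries; being squares of \<open>t (\<phi> / 2)\<close> they are rotations.  The involution \<open>s\<close>
  inverts them, hence is antilinear, and a rotation of the basis turns it into conjugation.
\<close>

lemma plane_circle_action:
  fixes t :: "real \<Rightarrow> complex \<Rightarrow> complex" and s :: "complex \<Rightarrow> complex"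
  assumes lin: "\<And>\<phi>. linear (t \<phi>)" and add: "\<And>\<phi> \<psi> A. t (\<phi> + \<psi>) A = t \<phi> (t \<psi> A)"
    and t0: "\<And>A. t 0 A = A" and per: "\<And>\<phi> A. t (\<phi> + p) A = t \<phi> A" and p: "p > 0"
    and cont: "\<And>A. continuous_on UNIV (\<lambda>\<phi>. t \<phi> A)" and nontriv: "t \<phi>0 A0 \<noteq> A0"
    and s: "linear s" and ss: "\<And>A. s (s A) = A" and st: "\<And>\<phi> A. s (t \<phi> A) = t (- \<phi>) (s A)"
  shows "\<exists>h :: complex \<Rightarrow> complex. linear h \<and> bij h \<and>
    (\<forall>c. cmod c = 1 \<longrightarrow> (\<exists>\<phi>. \<forall>A. t \<phi> (h A) = h (c * A))) \<and> (\<forall>A. s (h A) = h (cnj A))"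
proof -
  define b where "b u v = integral {0..p} (\<lambda>\<phi>. t \<phi> u \<bullet> t \<phi> v)" for u v
  have c1: "continuous_on S (\<lambda>\<phi>. t \<phi> u \<bullet> t \<phi> v)" for S u v
    by (intro continuous_intros continuous_on_subset[OF cont]) auto
  have int: "(\<lambda>\<phi>. t \<phi> u \<bullet> t \<phi> v) integrable_on {0..p}" for u v
    by (intro integrable_continuous_interval c1)
  have badd: "b (u + u') v = b u v + b u' v" for u u' v
    unfolding b_def by (simp add: linear_add[OF lin] inner_add_left integral_add[OF int int])
  have bscale: "b (r *\<^sub>R u) v = r * b u v" for r u v
    unfolding b_def by (simp add: linear_scale[OF lin])
  have bsym: "b u v = b v u" for u v
    unfolding b_def by (simp add: inner_commute)
  have bpos: "b u u > 0" if "u \<noteq> 0" for u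
  proof -
    have "b u u \<ge> 0" unfolding b_def by (intro integral_nonneg int) auto
    moreover have "b u u \<noteq> 0"
    proof
      assume "b u u = 0"
      then have "\<forall>\<phi>\<in>{0..p}. t \<phi> u \<bullet> t \<phi> u = 0"
        unfolding b_def using p by (subst (asm) integral_eq_0_iff[OF c1]) auto
      then have "t 0 u \<bullet> t 0 u = 0" using p by auto
      then show False using that t0 by simp
    qed
    ultimately show ?thesis by linarith
  qed
  have binv: "b (t \<psi> u) (t \<psi> v) = b u v" for \<psi> u v
    unfolding b_def using p per
    by (subst integral_periodic_shift[of "\<lambda>\<phi>. t \<phi> u \<bullet> t \<phi> v" p \<psi>, symmetric]) (auto simp: add c1)
  define f1 where "f1 = (1 / sqrt (b 1 1)) *\<^sub>R (1::complex)"
  \<comment> \<open>Gram-Schmidt orthonormalisation of \<open>1, \<i>\<close> with respect to \<open>b\<close>.\<close>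
  define w where "w = \<i> + (- b \<i> 1 / b 1 1) *\<^sub>R (1::complex)"
  define f2 where "f2 = (1 / sqrt (b w w)) *\<^sub>R w"
  have w0: "w \<noteq> 0" by (simp add: w_def complex_eq_iff)
  have pos: "b 1 1 > 0" "b w w > 0" using bpos w0 by auto
  have bscale': "b v (r *\<^sub>R u) = r * b v u" for r u v using bscale bsym by metis
  have "b w 1 = 0" unfolding w_def badd bscale using pos by simp
  then have on: "b f1 f1 = 1" "b f2 f2 = 1" "b f2 f1 = 0" "b f1 f2 = 0"
    unfolding f1_def f2_def bscale bscale' using pos bsym[of 1 w] by (auto simp: field_simps)
  define h0 where "h0 A = Re A *\<^sub>R f1 + Im A *\<^sub>R f2" for A
  have lh0: "linear h0" by (rule linearI) (auto simp: h0_def algebra_simps)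
  have badd': "b v (u + u') = b v u + b v u'" for u u' v using badd bsym by metis
  have bh0: "b (h0 A) (h0 A) = (cmod A)^2" for A
    unfolding h0_def badd badd' bscale bscale' on cmod_power2 by (simp add: power2_eq_square)
  have injh0: "inj h0"
    unfolding linear_injective_0[OF lh0]
  proof (intro allI impI)
    fix A assume "h0 A = 0"
    then have "b (0 *\<^sub>R h0 A) (h0 A) = (cmod A)^2" using bh0[of A] by simp
    then show "A = 0" unfolding bscale by simp
  qed
  have bijh0: "bij h0"
    using injh0 linear_injective_imp_surjective[OF lh0] by (simp add: bij_def)
  define g0 where "g0 = inv h0"
  have g0: "g0 (h0 A) = A" "h0 (g0 A) = A" for A
    using bijh0 by (auto simp: g0_def bij_is_inj bij_is_surj surj_f_inv_f)
  have lg0: "linear g0"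
    by (rule linearI) (metis g0 linear_add[OF lh0], metis g0 linear_scale[OF lh0])
  define t' where "t' \<phi> A = g0 (t \<phi> (h0 A))" for \<phi> A
  have lt': "linear (t' \<phi>)" for \<phi>
    unfolding t'_def using linear_compose[OF linear_compose[OF lh0 lin] lg0] by (simp add: o_def)
  have iso: "cmod (t' \<phi> A) = cmod A" for \<phi> A
  proof -
    have "(cmod (t' \<phi> A))^2 = (cmod A)^2"
      unfolding bh0[symmetric] t'_def g0 binv ..
    then show ?thesis by simp
  qed
  have t'add: "t' (\<phi> + \<psi>) A = t' \<phi> (t' \<psi> A)" for \<phi> \<psi> A by (simp add: t'_def g0 add)
  define c where "c \<phi> = t' \<phi> 1" for \<phi>
  have t'c: "t' \<phi> A = c \<phi> * A" for \<phi> A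
    using isometry_square_complex[OF lt' iso, of "\<phi>/2" A] t'add[of "\<phi>/2" "\<phi>/2"]
    by (simp add: c_def)
  have c_unit: "cmod (c \<phi>) = 1" for \<phi> using iso by (simp add: c_def)
  have c_add: "c (x + y) = c x * c y" for x y using t'add[of x y 1] by (simp add: t'c)
  have c_cont: "continuous_on UNIV c"
    unfolding c_def t'_def
    by (intro linear_continuous_on_compose[OF cont lg0])
  have c_nontriv: "c \<phi>0 \<noteq> 1"
  proof
    assume "c \<phi>0 = 1"
    then have "t' \<phi>0 (g0 A0) = g0 A0" by (simp add: t'c)
    then have "h0 (g0 (t \<phi>0 A0)) = h0 (g0 A0)" by (simp add: t'_def g0)
    then show False using nontriv g0 by simp
  qed
  have tc: "\<exists>\<phi>. \<forall>A. t \<phi> (h0 A) = h0 (e * A)" if e: "cmod e = 1" for e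
  proof -
    obtain \<phi> where "c \<phi> = e"
      using circle_character_surj[OF c_cont c_unit c_add c_nontriv e] by blast
    then have "h0 (t' \<phi> A) = h0 (e * A)" for A by (simp add: t'c)
    then show ?thesis unfolding t'_def g0 by blast
  qed
  define m where "m A = g0 (s (h0 A))" for A
  have lm: "linear m"
    unfolding m_def using linear_compose[OF linear_compose[OF lh0 s] lg0] by (simp add: o_def)
  have mm: "m (m A) = A" for A by (simp add: m_def g0 ss)
  have m_c: "m (c \<phi> * A) = c (- \<phi>) * m A" for \<phi> A
    unfolding t'c[symmetric] by (simp add: m_def t'_def g0 st)
  obtain \<phi> where phi: "c \<phi> = \<i>"
    using circle_character_surj[OF c_cont c_unit c_add c_nontriv, of \<i>] by auto
  have c0: "c 0 = 1" by (simp add: c_def t'_def t0 g0)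
  have "c (- \<phi>) * c \<phi> = 1" using c_add[of "- \<phi>" \<phi>] c0 by simp
  then have "c (- \<phi>) = - \<i>" using phi by (simp add: complex_eq_iff)
  then have mi: "m \<i> = - \<i> * m 1" using m_c[of \<phi> 1] phi by simp
  define q where "q = m 1"
  have mq: "m A = q * cnj A" for A
    using real_linear_complex[OF lm, of A] mi by (simp add: q_def complex_eq_iff algebra_simps)
  have "q * cnj q = 1" using mm[of 1] by (simp add: mq)
  then have "(cmod q)^2 = 1" by (metis complex_norm_square of_real_1 of_real_eq_iff)
  then have q: "cmod q = 1" using norm_ge_zero[of q] power2_eq_1_iff[of "cmod q"] by linarith
  \<comment> \<open>In the present coordinates \<open>s\<close> is \<open>A \<mapsto> q cnj A\<close>; the substitution \<open>A = \<kappa> A1\<close> removes \<open>q = \<kappa>\<^sup>2\<close>.\<close>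
  define \<kappa> where "\<kappa> = csqrt q"
  have k: "\<kappa> * \<kappa> = q" "cmod \<kappa> = 1" using q by (auto simp: \<kappa>_def norm_csqrt simp flip: power2_eq_square)
  have kk: "\<kappa> * cnj \<kappa> = 1" using k(2) by (simp flip: complex_norm_square)
  define h where "h A = h0 (\<kappa> * A)" for A
  have lh: "linear h"
    by (rule linearI) (auto simp: h_def algebra_simps linear_add[OF lh0] linear_scale[OF lh0])
  have bijh: "bij h"
  proof (rule bij_betw_byWitness[where f' = "\<lambda>y. cnj \<kappa> * g0 y"])
    have "cnj \<kappa> * (\<kappa> * a) = (\<kappa> * cnj \<kappa>) * a" "\<kappa> * (cnj \<kappa> * a) = (\<kappa> * cnj \<kappa>) * a" for a
      by (simp_all only: mult_ac)
    then have 1: "cnj \<kappa> * (\<kappa> * a) = a" "\<kappa> * (cnj \<kappa> * a) = a" for a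
      unfolding kk by simp_all
    show "\<forall>a\<in>UNIV. cnj \<kappa> * g0 (h a) = a" unfolding h_def g0 1 by simp
    show "\<forall>a\<in>UNIV. h (cnj \<kappa> * g0 a) = a" unfolding h_def 1 g0 by simp
  qed auto
  have "s (h A) = h (cnj A)" for A
  proof -
    have "s (h A) = h0 (m (\<kappa> * A))" by (simp add: h_def m_def g0)
    also have "m (\<kappa> * A) = (\<kappa> * \<kappa>) * (cnj \<kappa> * cnj A)" unfolding mq k(1) by simp
    also have "\<dots> = \<kappa> * (\<kappa> * cnj \<kappa>) * cnj A" by (simp only: mult_ac)
    finally show ?thesis unfolding kk by (simp add: h_def)
  qed
  moreover have "\<exists>\<phi>. \<forall>A. t \<phi> (h A) = h (e * A)" if e: "cmod e = 1" for e
  proof -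
    obtain \<phi> where "\<And>A. t \<phi> (h0 A) = h0 (e * A)" using tc[OF e] by blast
    then have "t \<phi> (h A) = h (e * A)" for A by (simp add: h_def mult.left_commute)
    then show ?thesis by blast
  qed
  ultimately show ?thesis using lh bijh by blast
qed

section \<open>Coordinates on the centre space\<close>

lemma inj_linear_complex_bounded_below:
  fixes f :: "complex \<Rightarrow> 'a::real_normed_vector"
  assumes f: "linear f" "inj f"
  obtains K where "K > 0" "\<And>A. cmod A \<le> K * norm (f A)"
proof -
  have cont: "continuous_on (sphere 0 1) (\<lambda>A. norm (f A))"
    using f(1) by (intro continuous_on_norm linear_continuous_on) (simp add: linear_conv_bounded_linear)
  have "(1::complex) \<in> sphere 0 1" by simp
  then obtain A0 where A0: "A0 \<in> sphere 0 1" "\<And>A. A \<in> sphere 0 1 \<Longrightarrow> norm (f A0) \<le> norm (f A)"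
    using continuous_attains_inf[OF compact_sphere _ cont] by blast
  have "A0 \<noteq> 0" using A0(1) by auto
  then have "f A0 \<noteq> 0" using f by (metis injD linear_0)
  then have pos: "norm (f A0) > 0" by simp
  show thesis
  proof (rule that)
    show "1 / norm (f A0) > 0" using pos by simp
    fix A :: complex
    show "cmod A \<le> 1 / norm (f A0) * norm (f A)"
    proof (cases "A = 0")
      case False
      have "norm (f A0) \<le> norm (f (A /\<^sub>R cmod A))" using False by (intro A0(2)) simp
      also have "\<dots> = norm (f A) / cmod A" by (simp add: linear_scale[OF f(1)] divide_inverse mult.commute)
      finally show ?thesis using pos False by (simp add: field_simps)
    qed (use pos in simp)
  qed
qed

context isolated_zero
begin

text \<open>
  The circle acts on the two-dimensional range of the projector, nontrivially and therefore without
  invariant lines.  The kernel of \<open>L\<close> is a nonzero invariant subspace of that range, so it is all of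
  it: the double eigenvalue \<open>0\<close> is semisimple.  Idempotence of the projector is a consequence,
  because the projector fixes the kernel of \<open>L\<close>.
\<close>

lemma circle_coordinates:
  fixes T :: "real \<Rightarrow> 'x \<Rightarrow> 'x" and S :: "'x \<Rightarrow> 'x"
  assumes injj: "inj j" and fin: "finite_alg_mult j L 0" and mult: "alg_mult j L 0 = 2"
    and eig: "eigenvalue j L 0"
    and l: "l \<noteq> 0"
    and T: "\<And>\<phi>. bounded_linear (T \<phi>)" and cont: "\<And>x. continuous_on UNIV (\<lambda>\<phi>. T \<phi> x)"
    and per: "\<And>\<phi>. T (\<phi> + 2 * l) = T \<phi>" and add: "\<And>\<phi> \<psi>. T \<phi> \<circ> T \<psi> = T (\<phi> + \<psi>)" and T0: "T 0 = id"
    and S: "bounded_linear S" and ST: "\<And>\<phi>. S \<circ> T \<phi> = T (- \<phi>) \<circ> S" and SS: "S \<circ> S = id"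
    and TZ: "\<And>\<phi> u. j (TZ \<phi> u) = T \<phi> (j u)" "\<And>\<phi> u. L (TZ \<phi> u) = T \<phi> (L u)"
    and SZ: "\<And>u. j (SZ u) = S (j u)" "\<And>u. L (SZ u) = S (L u)"
    and nontriv: "\<exists>\<phi>. \<exists>u\<in>range pc. T \<phi> (j u) \<noteq> j u"
  obtains E :: "complex \<Rightarrow> 'z" where "linear E" "inj E" "range E = range pc"
    "\<And>c. cmod c = 1 \<Longrightarrow> \<exists>\<phi>. \<forall>A. T \<phi> (j (E A)) = j (E (c * A))"
    "\<And>A. S (j (E A)) = j (E (cnj A))"
    "\<And>u. L u = 0 \<longleftrightarrow> u \<in> range pc"
proof -
  obtain e1 e2 where e: "e1 \<noteq> e2" "independent {e1, e2}" "range pc = span {e1, e2}"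
    using range_pc_basis[OF fin mult] .
  define e where "e A = Re A *\<^sub>R e1 + Im A *\<^sub>R e2" for A
  have le: "linear e" by (rule linearI) (auto simp: e_def algebra_simps)
  have inje: "inj e"
    unfolding linear_injective_0[OF le]
  proof (intro allI impI)
    fix A assume A: "e A = 0"
    have "Im A = 0"
    proof (rule ccontr)
      assume "Im A \<noteq> 0"
      then have "e2 = (1 / Im A) *\<^sub>R (Im A *\<^sub>R e2)" by simp
      also have "Im A *\<^sub>R e2 = - (Re A *\<^sub>R e1)"
        using A by (simp add: e_def eq_neg_iff_add_eq_0 add.commute)
      finally have "e2 = (- Re A / Im A) *\<^sub>R e1" by simp
      then have "e2 \<in> span {e1}" by (metis span_base span_scale singletonI)
      moreover have "{e1, e2} - {e2} = {e1}" using e(1) by auto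
      ultimately show False using e(2) by (metis dependent_def insertCI)
    qed
    moreover have "e1 \<noteq> 0" using e(2) dependent_zero by blast
    ultimately show "A = 0" using A by (simp add: e_def complex_eq_iff)
  qed
  have range_e: "range e = range pc"
  proof -
    have "x \<in> range e \<longleftrightarrow> x \<in> span {e1, e2}" for x
    proof
      have "e A \<in> span {e1, e2}" for A
        unfolding e_def by (intro span_add span_scale) (auto intro: span_base)
      moreover assume "x \<in> range e"
      ultimately show "x \<in> span {e1, e2}" by auto
    next
      assume "x \<in> span {e1, e2}"
      then obtain a where "x - a *\<^sub>R e1 \<in> span {e2}" by (auto simp: span_breakdown_eq)
      then obtain b where "x - a *\<^sub>R e1 = b *\<^sub>R e2" by (auto simp: span_singleton)
      then have "x = e (Complex a b)" by (simp add: e_def algebra_simps)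
      then show "x \<in> range e" by simp
    qed
    then show ?thesis using e(3) by auto
  qed
  define je where "je A = j (e A)" for A
  have lje: "linear je" unfolding je_def using linear_compose[OF le linear_j] by (simp add: o_def)
  have injje: "inj je" unfolding je_def using inje injj by (simp add: inj_def)
  have in_range: "B (je A) \<in> range je"
    if "bounded_linear B" "\<And>u. j (BZ u) = B (j u)" "\<And>u. L (BZ u) = B (L u)" for B BZ A
  proof -
    obtain x where x: "e A = pc x" using range_e by auto
    obtain A' where "e A' = pc (B x)" using range_e by (metis rangeI imageE)
    then have "B (je A) = je A'" using pc_commutes[OF that] by (simp add: je_def x)
    then show ?thesis by simp
  qed
  define g where "g = inv je"
  have g: "g (je A) = A" "y \<in> range je \<Longrightarrow> je (g y) = y" for A y
    using injje by (auto simp: g_def f_inv_into_f)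
  define t where "t \<phi> A = g (T \<phi> (je A))" for \<phi> A
  define s where "s A = g (S (je A))" for A
  have jt: "je (t \<phi> A) = T \<phi> (je A)" for \<phi> A
    unfolding t_def by (rule g(2)[OF in_range[OF T TZ]])
  have js: "je (s A) = S (je A)" for A
    unfolding s_def by (rule g(2)[OF in_range[OF S SZ]])
  note injje' = injD[OF injje]
  note lT = bounded_linear.linear[OF T] and lS = bounded_linear.linear[OF S]
  have "\<exists>h :: complex \<Rightarrow> complex. linear h \<and> bij h \<and>
    (\<forall>c. cmod c = 1 \<longrightarrow> (\<exists>\<phi>. \<forall>A. t \<phi> (h A) = h (c * A))) \<and> (\<forall>A. s (h A) = h (cnj A))"
  proof -
    obtain \<phi>0 u where u: "u \<in> range pc" "T \<phi>0 (j u) \<noteq> j u" using nontriv by blast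
    then obtain A0 where A0: "u = e A0" using range_e by (metis imageE)
    show ?thesis
    proof (rule plane_circle_action[where p = "2 * \<bar>l\<bar>" and ?\<phi>0.0 = \<phi>0 and ?A0.0 = A0])
      show "linear (t \<phi>)" for \<phi>
        by (rule linearI; rule injje')
          (simp_all add: jt linear_add[OF lje] linear_scale[OF lje] linear_add[OF lT] linear_scale[OF lT])
      show "t (\<phi> + \<psi>) A = t \<phi> (t \<psi> A)" for \<phi> \<psi> A
        by (rule injje') (simp add: jt flip: add)
      show "t 0 A = A" for A by (rule injje') (simp add: jt T0)
      have per': "T (\<phi> - 2 * l) = T \<phi>" for \<phi> using per[of "\<phi> - 2 * l"] by simp
      show "t (\<phi> + 2 * \<bar>l\<bar>) A = t \<phi> A" for \<phi> A
        by (rule injje') (use per per' in \<open>cases "l \<ge> 0"; simp add: jt\<close>)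
      show "2 * \<bar>l\<bar> > 0" using l by simp
      obtain K where K: "K > 0" "\<And>A. cmod A \<le> K * norm (je A)"
        by (rule inj_linear_complex_bounded_below[OF lje injje]) blast
      show "continuous_on UNIV (\<lambda>\<phi>. t \<phi> A)" for A
        unfolding continuous_on_def
      proof
        fix \<phi> :: real
        have "((\<lambda>\<psi>. T \<psi> (je A)) \<longlongrightarrow> T \<phi> (je A)) (at \<phi>)"
          using cont[of "je A"] by (simp add: continuous_on_def)
        then have "((\<lambda>\<psi>. norm (T \<psi> (je A) - T \<phi> (je A))) \<longlongrightarrow> 0) (at \<phi>)"
          by (intro tendsto_norm_zero) (simp add: LIM_zero_iff)
        then have lim: "((\<lambda>\<psi>. K * norm (T \<psi> (je A) - T \<phi> (je A))) \<longlongrightarrow> 0) (at \<phi>)"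
          by (rule tendsto_mult_right_zero)
        have "cmod (t \<psi> A - t \<phi> A) \<le> K * norm (T \<psi> (je A) - T \<phi> (je A))" for \<psi>
          using K(2)[of "t \<psi> A - t \<phi> A"] by (simp add: linear_diff[OF lje] jt)
        then have "((\<lambda>\<psi>. t \<psi> A - t \<phi> A) \<longlongrightarrow> 0) (at \<phi>)"
          by (intro Lim_null_comparison[OF _ lim]) simp
        then show "((\<lambda>\<psi>. t \<psi> A) \<longlongrightarrow> t \<phi> A) (at \<phi> within UNIV)" by (simp add: LIM_zero_iff)
      qed
      show "t \<phi>0 A0 \<noteq> A0"
      proof
        assume "t \<phi>0 A0 = A0"
        then have "T \<phi>0 (je A0) = je A0" using jt by metis
        then show False using u(2) by (simp add: je_def A0)
      qed
      show "linear s"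
        by (rule linearI; rule injje')
          (simp_all add: js linear_add[OF lje] linear_scale[OF lje] linear_add[OF lS] linear_scale[OF lS])
      show "s (s A) = A" for A
        by (rule injje') (simp add: js fun_cong[OF SS, unfolded o_def id_def])
      show "s (t \<phi> A) = t (- \<phi>) (s A)" for \<phi> A
        by (rule injje') (simp add: js jt fun_cong[OF ST, unfolded o_def])
    qed
  qed
  then obtain h :: "complex \<Rightarrow> complex" where h: "linear h" "bij h"
    "\<And>c. cmod c = 1 \<Longrightarrow> \<exists>\<phi>. \<forall>A. t \<phi> (h A) = h (c * A)" "\<And>A. s (h A) = h (cnj A)" by blast
  define E where "E = e \<circ> h"
  have lE: "linear E" unfolding E_def by (rule linear_compose[OF h(1) le])
  have injE: "inj E" unfolding E_def using inje h(2) by (simp add: inj_compose bij_is_inj)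
  have rangeE: "range E = range pc"
    unfolding E_def image_comp[symmetric] bij_is_surj[OF h(2)] by (rule range_e)
  have TE: "\<exists>\<phi>. \<forall>A. T \<phi> (j (E A)) = j (E (c * A))" if c: "cmod c = 1" for c
  proof -
    obtain \<phi> where "\<And>A. t \<phi> (h A) = h (c * A)" using h(3)[OF c] by blast
    then have "T \<phi> (je (h A)) = je (h (c * A))" for A by (metis jt)
    then show ?thesis by (auto simp: je_def E_def)
  qed
  have SE: "S (j (E A)) = j (E (cnj A))" for A
    using js[of "h A"] h(4)[of A] by (simp add: je_def E_def)
  have ker: "L u = 0 \<longleftrightarrow> u \<in> range pc" for u
  proof
    assume "L u = 0" then show "u \<in> range pc" using pc_fixes_kernel by (metis rangeI)
  next
    assume "u \<in> range pc"
    then obtain A where A: "u = E A" using rangeE by (metis imageE)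
    \<comment> \<open>Rotating and scaling one nonzero kernel element gives the whole centre space.\<close>
    obtain w where w: "w \<noteq> 0" "shifted j L 0 w = 0" using eig by (auto simp: eigenvalue_def)
    have "L (fst w) = 0" "L (snd w) = 0"
      using w(2) by (auto simp: shifted_def cscale_simps cmap_def prod_eq_iff)
    then obtain w0 where w0: "w0 \<noteq> 0" "L w0 = 0" using w(1) by (metis prod_eqI fst_zero snd_zero)
    then obtain A0 where A0: "w0 = E A0" using rangeE pc_fixes_kernel by (metis imageE rangeI)
    have "A0 \<noteq> 0" using w0 A0 linear_0[OF lE] by auto
    show "L u = 0"
    proof (cases "A = 0")
      case True
      then show ?thesis using A linear_0[OF lE] linear_0[OF linear_L] by simp
    next
      case False
      define c where "c = sgn (A / A0)"
      have c: "cmod c = 1" unfolding c_def norm_sgn using False \<open>A0 \<noteq> 0\<close> by simp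
      obtain \<phi> where "T \<phi> (j (E A0)) = j (E (c * A0))" using TE[OF c] by blast
      then have "TZ \<phi> w0 = E (c * A0)" using TZ(1)[of \<phi> w0] A0 injj by (simp add: inj_def)
      then have "L (E (c * A0)) = 0" using TZ(2)[of \<phi> w0] w0 by (simp add: linear_0[OF lT])
      moreover have "A = cmod (A / A0) *\<^sub>R (c * A0)"
        unfolding c_def sgn_div_norm using False \<open>A0 \<noteq> 0\<close>
        by (simp add: scaleR_conv_of_real norm_divide)
      then have "L u = cmod (A / A0) *\<^sub>R L (E (c * A0))"
        unfolding A by (metis linear_scale lE linear_L)
      ultimately show ?thesis by simp
    qed
  qed
  show thesis by (rule that[OF lE injE rangeE TE SE ker])
qed

end

section \<open>The Picard-Lindeloef theorem\<close>

lemma picard_lindeloef_global: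
  fixes h :: "'a::euclidean_space \<Rightarrow> 'a"
  assumes lip: "\<And>x y. norm (h x - h y) \<le> K * norm (x - y)" and bd: "\<And>x. norm (h x) \<le> M"
    and T: "T \<ge> 0" "K * T < 1" and K: "K \<ge> 0"
  shows "\<exists>y. y 0 = x0 \<and> continuous_on UNIV y \<and>
    (\<forall>t\<in>{0..T}. (y has_vector_derivative h (y t)) (at t within {0..T}))"
proof -
  have M: "M \<ge> 0" using bd[of 0] norm_ge_zero order_trans by blast
  have conth: "continuous_on UNIV h"
    by (rule lipschitz_on_continuous_on[of K])
      (rule lipschitz_onI, use lip K in \<open>auto simp: dist_norm\<close>)
  \<comment> \<open>Clamping the time to \<open>{0..T}\<close> makes the Picard operator act on bounded functions on the whole line.\<close>
  define c where "c t = max 0 (min T t)" for t :: real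
  have c: "c t \<in> {0..T}" for t using T by (auto simp: c_def)
  have contc: "continuous_on UNIV c" unfolding c_def by (intro continuous_intros)
  define G where "G u t = x0 + integral {0..c t} (\<lambda>s. h (u s))" for u :: "real \<Rightarrow>\<^sub>C 'a" and t
  have conthu: "continuous_on S (\<lambda>s. h (u s))" for u :: "real \<Rightarrow>\<^sub>C 'a" and S
    by (rule continuous_on_compose2[OF conth]) (auto intro: continuous_on_subset[OF continuous_on_apply_bcontfun])
  have inth: "(\<lambda>s. h (u s)) integrable_on {a..b}" for u :: "real \<Rightarrow>\<^sub>C 'a" and a b
    by (intro integrable_continuous_interval conthu)
  have contG: "continuous_on UNIV (G u)" for u
  proof -
    have "continuous_on {0..T} (\<lambda>t. integral {0..t} (\<lambda>s. h (u s)))"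
      by (rule indefinite_integral_continuous_1[OF inth])
    then have "continuous_on UNIV (\<lambda>t. integral {0..c t} (\<lambda>s. h (u s)))"
      by (rule continuous_on_compose2[OF _ contc]) (use c in auto)
    then show ?thesis unfolding G_def by (intro continuous_intros)
  qed
  have Gb: "G u \<in> bcontfun" for u
  proof (rule bcontfun_normI[OF contG])
    fix t
    have "norm (integral {0..c t} (\<lambda>s. h (u s))) \<le> M * (c t - 0)"
      using c[of t] bd by (intro integral_bound conthu) auto
    also have "\<dots> \<le> M * T" using c[of t] M by (intro mult_left_mono) auto
    finally show "norm (G u t) \<le> norm x0 + M * T"
      unfolding G_def by (rule order_trans[OF norm_triangle_ineq add_left_mono])
  qed
  define \<Phi> where "\<Phi> u = Bcontfun (G u)" for u
  have \<Phi>: "apply_bcontfun (\<Phi> u) = G u" for u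
    unfolding \<Phi>_def by (rule Bcontfun_inverse[OF Gb])
  have contraction: "dist (\<Phi> u) (\<Phi> w) \<le> (K * T) * dist u w" for u w
  proof (rule dist_bound)
    fix t
    have "dist (\<Phi> u t) (\<Phi> w t) = norm (integral {0..c t} (\<lambda>s. h (u s) - h (w s)))"
      by (simp add: \<Phi> G_def dist_norm Henstock_Kurzweil_Integration.integral_diff[OF inth inth])
    also have "\<dots> \<le> (K * dist u w) * (c t - 0)"
    proof (rule integral_bound)
      fix s
      have "norm (h (u s) - h (w s)) \<le> K * dist (u s) (w s)" using lip by (simp add: dist_norm)
      also have "\<dots> \<le> K * dist u w" using K by (intro mult_left_mono dist_bounded) auto
      finally show "norm (h (u s) - h (w s)) \<le> K * dist u w" .
    qed (use c[of t] in \<open>auto intro!: continuous_intros conthu\<close>)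
    also have "\<dots> \<le> (K * dist u w) * T" using c[of t] K by (intro mult_left_mono) auto
    finally show "dist (\<Phi> u t) (\<Phi> w t) \<le> K * T * dist u w" by (simp add: mult_ac)
  qed
  have "\<exists>!u. \<Phi> u = u"
    using T K contraction by (intro banach_fix_type[of "K * T"]) auto
  then obtain u where u: "\<Phi> u = u" by blast
  have "apply_bcontfun u = G u" using \<Phi>[of u] unfolding u .
  then have ut: "u t = x0 + integral {0..c t} (\<lambda>s. h (u s))" for t
    unfolding G_def by (rule fun_cong)
  show ?thesis
  proof (intro exI conjI ballI)
    show "u 0 = x0" using ut[of 0] T by (simp add: c_def)
    show "continuous_on UNIV u" by simp
    fix t assume t: "t \<in> {0..T}"
    have "((\<lambda>t. x0 + integral {0..t} (\<lambda>s. h (u s))) has_vector_derivative (0 + h (u t))) (at t within {0..T})"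
      by (intro has_vector_derivative_add has_vector_derivative_const
          integral_has_vector_derivative[OF conthu t])
    then have "((\<lambda>t. x0 + integral {0..t} (\<lambda>s. h (u s))) has_vector_derivative h (u t)) (at t within {0..T})"
      by simp
    then show "(u has_vector_derivative h (u t)) (at t within {0..T})"
      by (rule has_vector_derivative_transform[OF t, rotated]) (subst ut, simp add: c_def)
  qed
qed

lemma picard_lindeloef:
  fixes g :: "'a::euclidean_space \<Rightarrow> 'a"
  assumes r: "r > 0" and K: "K \<ge> 0"
    and lip: "\<And>x y. x \<in> cball x0 r \<Longrightarrow> y \<in> cball x0 r \<Longrightarrow> norm (g x - g y) \<le> K * norm (x - y)"
  obtains T y where "T > 0" "y 0 = x0" "\<And>t. t \<in> {0..T} \<Longrightarrow> y t \<in> cball x0 r"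
    "\<And>t. t \<in> {0..T} \<Longrightarrow> (y has_vector_derivative g (y t)) (at t within {0..T})"
proof -
  let ?B = "cball x0 r"
  \<comment> \<open>The nearest point retraction onto the ball extends \<open>g\<close> with the same Lipschitz constant.\<close>
  define h where "h x = g (closest_point ?B x)" for x
  have B: "closest_point ?B x \<in> ?B" for x using r by (intro closest_point_in_set) auto
  have hlip: "norm (h x - h y) \<le> K * norm (x - y)" for x y
  proof -
    have "norm (h x - h y) \<le> K * norm (closest_point ?B x - closest_point ?B y)"
      unfolding h_def by (intro lip B)
    also have "\<dots> \<le> K * norm (x - y)"
      using closest_point_lipschitz[of ?B x y] r K by (intro mult_left_mono) (auto simp: dist_norm)
    finally show ?thesis .
  qed
  have hbd: "norm (h x) \<le> norm (g x0) + K * r" for x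
  proof -
    have "norm (g (closest_point ?B x)) \<le> norm (g x0) + norm (g (closest_point ?B x) - g x0)"
      by (rule norm_triangle_sub)
    moreover have "norm (g (closest_point ?B x) - g x0) \<le> K * norm (closest_point ?B x - x0)"
      using r by (intro lip B) auto
    moreover have "K * norm (closest_point ?B x - x0) \<le> K * r"
      using B[of x] K by (intro mult_left_mono) (auto simp: dist_norm norm_minus_commute)
    ultimately show ?thesis unfolding h_def by linarith
  qed
  define T1 where "T1 = 1 / (K + 1) / 2"
  have T1: "T1 > 0" "K * T1 < 1" using K by (auto simp: T1_def field_simps)
  obtain y where y: "y 0 = x0" "continuous_on UNIV y"
    "\<And>t. t \<in> {0..T1} \<Longrightarrow> (y has_vector_derivative h (y t)) (at t within {0..T1})"
    using picard_lindeloef_global[OF hlip hbd _ T1(2) K] T1(1) by (metis less_imp_le)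
  have "\<exists>d>0. \<forall>t. dist t 0 < d \<longrightarrow> dist (y t) (y 0) < r"
    using y(2) r unfolding continuous_on_iff by (metis UNIV_I)
  then obtain d where d: "d > 0" "\<And>t. dist t 0 < d \<Longrightarrow> dist (y t) (y 0) < r" by blast
  define T where "T = min T1 (d / 2)"
  have T: "T > 0" "T \<le> T1" "T < d" using T1 d by (auto simp: T_def)
  have yB: "y t \<in> cball x0 r" if "t \<in> {0..T}" for t
    using d(2)[of t] that T y(1) by (auto simp: dist_norm norm_minus_commute)
  show thesis
  proof (rule that[of T y, OF T(1) y(1) yB])
    fix t assume t: "t \<in> {0..T}"
    have "(y has_vector_derivative h (y t)) (at t within {0..T})"
      by (rule has_vector_derivative_within_subset[OF y(3)]) (use t T in auto)
    moreover have "h (y t) = g (y t)"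
      unfolding h_def by (subst closest_point_self) (use yB[OF t] in auto)
    ultimately show "(y has_vector_derivative g (y t)) (at t within {0..T})" by simp
  qed
qed

section \<open>Maps of class \<open>C\<^sup>k\<close>: Taylor expansion\<close>

lemma prod_list_norm_nonneg [simp]: "0 \<le> (\<Prod>h\<leftarrow>hs. norm h)"
  by (induction hs) auto

text \<open>
  This moves the reduction function, which lives on a subspace, to a full space of coordinates.
  Injectivity keeps punctured neighbourhoods punctured.
\<close>

lemma Ck_on_linear_pullback:
  assumes f: "Ck_on k E U f" and e: "bounded_linear e" "inj e" and range: "range e \<subseteq> E"
  shows "Ck_on k UNIV (e -` U) (f \<circ> e)"
proof -
  interpret e: bounded_linear e by (rule e(1))
  obtain K where K: "K > 0" "\<And>x. norm (e x) \<le> norm x * K" using e.pos_bounded by auto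
  obtain D where D: "\<forall>x\<in>U. D 0 x [] = f x"
     "\<forall>j\<le>k. \<forall>x\<in>U. bounded_multilinear_on E j (D j x)"
     "\<forall>j<k. \<forall>x\<in>U. \<forall>e>0. \<forall>\<^sub>F y in at x within U. \<forall>hs\<in>lists E. length hs = j \<longrightarrow>
        norm (D j y hs - D j x hs - D (Suc j) x ((y - x) # hs)) \<le> e * norm (y - x) * (\<Prod>h\<leftarrow>hs. norm h)"
     "\<forall>j\<le>k. \<forall>x\<in>U. \<forall>e>0. \<forall>\<^sub>F y in at x within U. \<forall>hs\<in>lists E. length hs = j \<longrightarrow>
        norm (D j y hs - D j x hs) \<le> e * (\<Prod>h\<leftarrow>hs. norm h)"
    using f unfolding Ck_on_def by (elim exE conjE) (rule that; assumption)
  note D0 = D(1)[THEN bspec]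
    and ml = D(2)[THEN spec, THEN mp, THEN bspec]
    and dif = D(3)[THEN spec, THEN mp, THEN bspec, THEN spec, THEN mp]
    and ct = D(4)[THEN spec, THEN mp, THEN bspec, THEN spec, THEN mp]
  have maps: "map e hs \<in> lists E" for hs using range by (auto simp: image_subset_iff)
  have prod: "(\<Prod>h\<leftarrow>map e hs. norm h) \<le> K ^ length hs * (\<Prod>h\<leftarrow>hs. norm h)" for hs
  proof (induction hs)
    case (Cons h hs)
    have "norm (e h) * (\<Prod>h\<leftarrow>map e hs. norm h) \<le> (norm h * K) * (K ^ length hs * (\<Prod>h\<leftarrow>hs. norm h))"
      using K Cons prod_list_norm_nonneg[of "map e hs"] by (intro mult_mono) simp_all
    then show ?case by (simp add: mult_ac)
  qed simp
  have flim: "filterlim e (at (e x) within U) (at x within (e -` U))" for x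
    unfolding filterlim_at
  proof
    show "\<forall>\<^sub>F y in at x within e -` U. e y \<in> U \<and> e y \<noteq> e x"
      using e(2) by (auto simp: eventually_at_filter inj_eq)
    show "(e \<longlongrightarrow> e x) (at x within e -` U)" by (rule e.tendsto[OF tendsto_ident_at])
  qed
  define D' where "D' j x hs = D j (e x) (map e hs)" for j x hs
  show ?thesis
    unfolding Ck_on_def
  proof (intro exI[of _ D'] conjI allI impI ballI)
    show "D' 0 x [] = (f \<circ> e) x" if "x \<in> e -` U" for x using D0 that by (simp add: D'_def)
    show "bounded_multilinear_on UNIV j (D' j x)" if j: "j \<le> k" and x: "x \<in> e -` U" for j x
      unfolding bounded_multilinear_on_def
    proof (intro conjI ballI allI impI)
      have B: "bounded_multilinear_on E j (D j (e x))" using ml j x by auto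
      fix hs :: "'c list" and i v w a b assume "length hs = j" "i < j"
      then show "D' j x (hs[i := a *\<^sub>R v + b *\<^sub>R w]) = a *\<^sub>R D' j x (hs[i := v]) + b *\<^sub>R D' j x (hs[i := w])"
        using B maps[of hs] range unfolding bounded_multilinear_on_def D'_def
        by (simp add: map_update e.add e.scaleR image_subset_iff)
    next
      have B: "bounded_multilinear_on E j (D j (e x))" using ml j x by auto
      then obtain C where C: "\<And>hs. hs \<in> lists E \<Longrightarrow> length hs = j \<Longrightarrow> norm (D j (e x) hs) \<le> C * (\<Prod>h\<leftarrow>hs. norm h)"
        unfolding bounded_multilinear_on_def by blast
      show "\<exists>C. \<forall>hs\<in>lists UNIV. length hs = j \<longrightarrow> norm (D' j x hs) \<le> C * (\<Prod>h\<leftarrow>hs. norm h)"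
      proof (intro exI ballI impI)
        fix hs :: "'c list" assume l: "length hs = j"
        have "norm (D' j x hs) \<le> C * (\<Prod>h\<leftarrow>map e hs. norm h)" unfolding D'_def using l by (intro C maps) auto
        also have "\<dots> \<le> \<bar>C\<bar> * (K ^ length hs * (\<Prod>h\<leftarrow>hs. norm h))"
          by (intro mult_mono prod prod_list_norm_nonneg) auto
        finally show "norm (D' j x hs) \<le> (\<bar>C\<bar> * K ^ j) * (\<Prod>h\<leftarrow>hs. norm h)" by (simp add: l mult_ac)
      qed
    qed
    show "\<forall>\<^sub>F y in at x within e -` U. \<forall>hs\<in>lists UNIV. length hs = j \<longrightarrow>
        norm (D' j y hs - D' j x hs - D' (Suc j) x ((y - x) # hs)) \<le> \<epsilon> * norm (y - x) * (\<Prod>h\<leftarrow>hs. norm h)"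
      if j: "j < k" and x: "x \<in> e -` U" and eps: "\<epsilon> > 0" for j x \<epsilon>
    proof -
      define \<epsilon>' where "\<epsilon>' = \<epsilon> / K ^ Suc j"
      have e': "\<epsilon>' > 0" using eps K by (simp add: \<epsilon>'_def)
      from dif[OF j _ e', of "e x"] x have "\<forall>\<^sub>F y in at (e x) within U. \<forall>hs\<in>lists E. length hs = j \<longrightarrow>
        norm (D j y hs - D j (e x) hs - D (Suc j) (e x) ((y - e x) # hs)) \<le> \<epsilon>' * norm (y - e x) * (\<Prod>h\<leftarrow>hs. norm h)" by auto
      from eventually_compose_filterlim[OF this flim]
      show ?thesis
      proof (rule eventually_mono, intro ballI impI)
        fix y and hs :: "'c list"
        assume H: "\<forall>hs\<in>lists E. length hs = j \<longrightarrow>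
          norm (D j (e y) hs - D j (e x) hs - D (Suc j) (e x) ((e y - e x) # hs)) \<le> \<epsilon>' * norm (e y - e x) * (\<Prod>h\<leftarrow>hs. norm h)"
          and l: "length hs = j"
        have "norm (D' j y hs - D' j x hs - D' (Suc j) x ((y - x) # hs)) \<le> \<epsilon>' * norm (e (y - x)) * (\<Prod>h\<leftarrow>map e hs. norm h)"
          using H[rule_format, OF maps, of hs] l by (simp add: D'_def e.diff)
        also have "\<dots> \<le> \<epsilon>' * (norm (y - x) * K) * (K ^ length hs * (\<Prod>h\<leftarrow>hs. norm h))"
          using e' K by (intro mult_mono prod mult_left_mono K(2) prod_list_norm_nonneg) auto
        also have "\<dots> = \<epsilon> * norm (y - x) * (\<Prod>h\<leftarrow>hs. norm h)"
          using K by (simp add: l \<epsilon>'_def)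
        finally show "norm (D' j y hs - D' j x hs - D' (Suc j) x ((y - x) # hs)) \<le> \<epsilon> * norm (y - x) * (\<Prod>h\<leftarrow>hs. norm h)" .
      qed
    qed
    show "\<forall>\<^sub>F y in at x within e -` U. \<forall>hs\<in>lists UNIV. length hs = j \<longrightarrow>
        norm (D' j y hs - D' j x hs) \<le> \<epsilon> * (\<Prod>h\<leftarrow>hs. norm h)"
      if j: "j \<le> k" and x: "x \<in> e -` U" and eps: "\<epsilon> > 0" for j x \<epsilon>
    proof -
      define \<epsilon>' where "\<epsilon>' = \<epsilon> / K ^ j"
      have e': "\<epsilon>' > 0" using eps K by (simp add: \<epsilon>'_def)
      from ct[OF j _ e', of "e x"] x have "\<forall>\<^sub>F y in at (e x) within U. \<forall>hs\<in>lists E. length hs = j \<longrightarrow>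
        norm (D j y hs - D j (e x) hs) \<le> \<epsilon>' * (\<Prod>h\<leftarrow>hs. norm h)" by auto
      from eventually_compose_filterlim[OF this flim]
      show ?thesis
      proof (rule eventually_mono, intro ballI impI)
        fix y and hs :: "'c list"
        assume H: "\<forall>hs\<in>lists E. length hs = j \<longrightarrow> norm (D j (e y) hs - D j (e x) hs) \<le> \<epsilon>' * (\<Prod>h\<leftarrow>hs. norm h)"
          and l: "length hs = j"
        have "norm (D' j y hs - D' j x hs) \<le> \<epsilon>' * (\<Prod>h\<leftarrow>map e hs. norm h)"
          using H[rule_format, OF maps, of hs] l by (simp add: D'_def)
        also have "\<dots> \<le> \<epsilon>' * (K ^ length hs * (\<Prod>h\<leftarrow>hs. norm h))"
          using e' by (intro mult_left_mono prod) auto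
        also have "\<dots> = \<epsilon> * (\<Prod>h\<leftarrow>hs. norm h)"
          using K by (simp add: l \<epsilon>'_def)
        finally show "norm (D' j y hs - D' j x hs) \<le> \<epsilon> * (\<Prod>h\<leftarrow>hs. norm h)" .
      qed
    qed
  qed
qed

locale derivative_tower =
  fixes k :: nat and U :: "'a::real_normed_vector set" and f :: "'a \<Rightarrow> 'b::real_normed_vector"
    and D :: "nat \<Rightarrow> 'a \<Rightarrow> 'a list \<Rightarrow> 'b"
  assumes U: "open U" "0 \<in> U"
    and D0: "\<And>x. x \<in> U \<Longrightarrow> D 0 x [] = f x"
    and ml: "\<And>j x. j \<le> k \<Longrightarrow> x \<in> U \<Longrightarrow> bounded_multilinear_on UNIV j (D j x)"
    and dif: "\<And>j x \<epsilon>. j < k \<Longrightarrow> x \<in> U \<Longrightarrow> \<epsilon> > 0 \<Longrightarrow> \<forall>\<^sub>F y in at x. \<forall>hs. length hs = j \<longrightarrow>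
        norm (D j y hs - D j x hs - D (Suc j) x ((y - x) # hs)) \<le> \<epsilon> * norm (y - x) * (\<Prod>h\<leftarrow>hs. norm h)"
    and ct: "\<And>j x \<epsilon>. j \<le> k \<Longrightarrow> x \<in> U \<Longrightarrow> \<epsilon> > 0 \<Longrightarrow> \<forall>\<^sub>F y in at x. \<forall>hs. length hs = j \<longrightarrow>
        norm (D j y hs - D j x hs) \<le> \<epsilon> * (\<Prod>h\<leftarrow>hs. norm h)"

lemma Ck_on_derivative_tower:
  assumes "Ck_on k UNIV U f" "open U" "0 \<in> U"
  shows "\<exists>D. derivative_tower k U f D"
proof -
  obtain D where D: "\<forall>x\<in>U. D 0 x [] = f x"
     "\<forall>j\<le>k. \<forall>x\<in>U. bounded_multilinear_on UNIV j (D j x)"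
     "\<forall>j<k. \<forall>x\<in>U. \<forall>e>0. \<forall>\<^sub>F y in at x within U. \<forall>hs\<in>lists UNIV. length hs = j \<longrightarrow>
        norm (D j y hs - D j x hs - D (Suc j) x ((y - x) # hs)) \<le> e * norm (y - x) * (\<Prod>h\<leftarrow>hs. norm h)"
     "\<forall>j\<le>k. \<forall>x\<in>U. \<forall>e>0. \<forall>\<^sub>F y in at x within U. \<forall>hs\<in>lists UNIV. length hs = j \<longrightarrow>
        norm (D j y hs - D j x hs) \<le> e * (\<Prod>h\<leftarrow>hs. norm h)"
    using assms(1) unfolding Ck_on_def by (elim exE conjE) (rule that; assumption)
  have w: "at x within U = at x" if "x \<in> U" for x by (rule at_within_open[OF that assms(2)])
  have "derivative_tower k U f D"
  proof (rule derivative_tower.intro)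
    show "open U" "0 \<in> U" by fact+
  next
    fix x assume "x \<in> U" then show "D 0 x [] = f x" by (rule D(1)[THEN bspec])
  next
    fix j x assume "j \<le> k" "x \<in> U"
    then show "bounded_multilinear_on UNIV j (D j x)" by (rule D(2)[THEN spec, THEN mp, THEN bspec])
  next
    fix j x and \<epsilon> :: real assume H: "j < k" "x \<in> U" "\<epsilon> > 0"
    show "\<forall>\<^sub>F y in at x. \<forall>hs. length hs = j \<longrightarrow>
        norm (D j y hs - D j x hs - D (Suc j) x ((y - x) # hs)) \<le> \<epsilon> * norm (y - x) * (\<Prod>h\<leftarrow>hs. norm h)"
      using D(3)[THEN spec, THEN mp, THEN bspec, THEN spec, THEN mp, OF H] unfolding w[OF H(2)] by simp
  next
    fix j x and \<epsilon> :: real assume H: "j \<le> k" "x \<in> U" "\<epsilon> > 0"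
    show "\<forall>\<^sub>F y in at x. \<forall>hs. length hs = j \<longrightarrow> norm (D j y hs - D j x hs) \<le> \<epsilon> * (\<Prod>h\<leftarrow>hs. norm h)"
      using D(4)[THEN spec, THEN mp, THEN bspec, THEN spec, THEN mp, OF H] unfolding w[OF H(2)] by simp
  qed
  then show ?thesis by (rule exI[of "derivative_tower k U f"])
qed

context derivative_tower
begin

lemma slot:
  assumes "j \<le> k" "x \<in> U" "length pre + Suc (length post) = j"
  shows "D j x (pre @ (a *\<^sub>R v + b *\<^sub>R w) # post) = a *\<^sub>R D j x (pre @ v # post) + b *\<^sub>R D j x (pre @ w # post)"
proof -
  have "D j x ((pre @ v # post)[length pre := a *\<^sub>R v + b *\<^sub>R w])
      = a *\<^sub>R D j x ((pre @ v # post)[length pre := v]) + b *\<^sub>R D j x ((pre @ v # post)[length pre := w])"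
    by (rule ml[OF assms(1,2), unfolded bounded_multilinear_on_def, THEN conjunct1, rule_format])
      (use assms(3) in auto)
  then show ?thesis by simp
qed

lemma slot_scale:
  assumes "j \<le> k" "x \<in> U" "length pre + Suc (length post) = j"
  shows "D j x (pre @ (a *\<^sub>R v) # post) = a *\<^sub>R D j x (pre @ v # post)"
  using slot[OF assms, of a v 0 0] by simp

lemma slot_add:
  assumes "j \<le> k" "x \<in> U" "length pre + Suc (length post) = j"
  shows "D j x (pre @ (v + w) # post) = D j x (pre @ v # post) + D j x (pre @ w # post)"
  using slot[OF assms, of 1 v 1 w] by simp

lemma slot_diff:
  assumes "j \<le> k" "x \<in> U" "length pre + Suc (length post) = j"
  shows "D j x (pre @ (v - w) # post) = D j x (pre @ v # post) - D j x (pre @ w # post)"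
  using slot[OF assms, of 1 v "-1" w] by simp

lemma D_bound:
  assumes "j \<le> k" "x \<in> U"
  obtains C where "C \<ge> 0" "\<And>hs. length hs = j \<Longrightarrow> norm (D j x hs) \<le> C * (\<Prod>h\<leftarrow>hs. norm h)"
proof -
  obtain C where C: "\<And>hs. length hs = j \<Longrightarrow> norm (D j x hs) \<le> C * (\<Prod>h\<leftarrow>hs. norm h)"
    using ml[OF assms] unfolding bounded_multilinear_on_def by auto
  show thesis
  proof (rule that[of "\<bar>C\<bar>"])
    fix hs :: "'a list" assume "length hs = j"
    from C[OF this] show "norm (D j x hs) \<le> \<bar>C\<bar> * (\<Prod>h\<leftarrow>hs. norm h)"
      by (rule order_trans) (intro mult_right_mono, auto)
  qed simp
qed

lemma D_replicate_scale:
  assumes "j \<le> k" "x \<in> U" "length pre + i + length post = j"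
  shows "D j x (pre @ replicate i (a *\<^sub>R v) @ post) = a ^ i *\<^sub>R D j x (pre @ replicate i v @ post)"
  using assms(3)
proof (induction i arbitrary: pre)
  case (Suc i)
  have "D j x (pre @ replicate (Suc i) (a *\<^sub>R v) @ post) = a *\<^sub>R D j x (pre @ v # replicate i (a *\<^sub>R v) @ post)"
    using slot_scale[OF assms(1,2), of pre "replicate i (a *\<^sub>R v) @ post" a v] Suc.prems by simp
  also have "D j x (pre @ v # replicate i (a *\<^sub>R v) @ post) = a ^ i *\<^sub>R D j x (pre @ v # replicate i v @ post)"
    using Suc.IH[of "pre @ [v]"] Suc.prems by simp
  finally show ?case by simp
qed simp

lemma D_has_derivative:
  assumes j: "j < k" and z: "z \<in> U" and hs: "length hs = j"
  shows "((\<lambda>y. D j y hs) has_derivative (\<lambda>h. D (Suc j) z (h # hs))) (at z)"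
  unfolding has_derivative_within_alt
proof (intro conjI allI impI)
  obtain C where C: "C \<ge> 0" "\<And>hs. length hs = Suc j \<Longrightarrow> norm (D (Suc j) z hs) \<le> C * (\<Prod>h\<leftarrow>hs. norm h)"
    using D_bound[of "Suc j" z] j z by (metis Suc_leI)
  show "bounded_linear (\<lambda>h. D (Suc j) z (h # hs))"
  proof (rule bounded_linear_intro)
    show "D (Suc j) z ((v + w) # hs) = D (Suc j) z (v # hs) + D (Suc j) z (w # hs)" for v w
      using slot_add[of "Suc j" z "[]" hs] j z hs by simp
    show "D (Suc j) z ((a *\<^sub>R v) # hs) = a *\<^sub>R D (Suc j) z (v # hs)" for a v
      using slot_scale[of "Suc j" z "[]" hs] j z hs by simp
    show "norm (D (Suc j) z (h # hs)) \<le> norm h * (C * (\<Prod>h\<leftarrow>hs. norm h))" for h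
      using C(2)[of "h # hs"] hs by (simp add: mult_ac)
  qed
  fix e :: real assume e: "e > 0"
  define p where "p = (\<Prod>h\<leftarrow>hs. norm h)"
  have p: "p \<ge> 0" by (simp add: p_def)
  have "\<forall>\<^sub>F y in at z. norm (D j y hs - D j z hs - D (Suc j) z ((y - z) # hs)) \<le> (e / (p + 1)) * norm (y - z) * p"
  proof -
    have ep: "e / (p + 1) > 0" using e p by simp
    show ?thesis unfolding p_def[symmetric]
      by (rule eventually_mono[OF dif[OF j z ep]], drule spec[of _ hs]) (simp add: hs p_def)
  qed
  then obtain d where d: "d > 0" "\<And>y. y \<noteq> z \<Longrightarrow> dist y z < d \<Longrightarrow>
      norm (D j y hs - D j z hs - D (Suc j) z ((y - z) # hs)) \<le> (e / (p + 1)) * norm (y - z) * p"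
    unfolding eventually_at by auto
  show "\<exists>d>0. \<forall>y\<in>UNIV. norm (y - z) < d \<longrightarrow> norm (D j y hs - D j z hs - D (Suc j) z ((y - z) # hs)) \<le> e * norm (y - z)"
  proof (intro exI conjI ballI impI)
    fix y assume y: "norm (y - z) < d"
    show "norm (D j y hs - D j z hs - D (Suc j) z ((y - z) # hs)) \<le> e * norm (y - z)"
    proof (cases "y = z")
      case True
      have "D (Suc j) z ((0 *\<^sub>R 0) # hs) = 0 *\<^sub>R D (Suc j) z (0 # hs)"
        using slot_scale[of "Suc j" z "[]" hs 0 0] j z hs by simp
      then show ?thesis using True by simp
    next
      case False
      have "(e / (p + 1)) * norm (y - z) * p = e * norm (y - z) * (p / (p + 1))" by simp
      also have "\<dots> \<le> e * norm (y - z) * 1" using e p by (intro mult_left_mono) (auto simp: divide_le_eq_1)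
      finally show ?thesis using d(2)[OF False] y by (simp add: dist_norm)
    qed
  qed (rule d(1))
qed

end

lemma unit_interval_mean_value:
  fixes \<phi> :: "real \<Rightarrow> 'b::real_normed_vector"
  assumes "\<And>t. t \<in> {0..1} \<Longrightarrow> (\<phi> has_vector_derivative \<phi>' t) (at t within {0..1})"
    and "\<And>t. t \<in> {0..1} \<Longrightarrow> norm (\<phi>' t) \<le> B"
  shows "norm (\<phi> 1 - \<phi> 0) \<le> B"
proof -
  have "norm (\<phi> 1 - \<phi> 0) \<le> B * norm (1 - 0 :: real)"
  proof (rule differentiable_bound[of "{0..1}" \<phi> "\<lambda>t h. h *\<^sub>R \<phi>' t"])
    fix t :: real assume t: "t \<in> {0..1}"
    show "(\<phi> has_derivative (\<lambda>h. h *\<^sub>R \<phi>' t)) (at t within {0..1})"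
      using assms(1)[OF t] by (simp add: has_vector_derivative_def)
    show "onorm (\<lambda>h. h *\<^sub>R \<phi>' t) \<le> B"
    proof (rule onorm_bound)
      show "0 \<le> B" using assms(2)[OF t] norm_ge_zero order_trans by blast
      show "norm (h *\<^sub>R \<phi>' t) \<le> B * norm h" for h
        using mult_right_mono[OF assms(2)[OF t], of "\<bar>h\<bar>"] by (simp add: mult.commute)
    qed
  qed auto
  then show ?thesis by simp
qed

context derivative_tower
begin

lemma ball_in_U: obtains d where "d > 0" "ball 0 d \<subseteq> U"
  using U by (meson openE)

text \<open>
  Peano's form of the remainder, for all derivatives at once and by downward induction on the order:
  the top derivative is continuous, and the remainder of the derivative of order \<open>j\<close> vanishes at \<open>0\<close>
  while its derivative along the ray through \<open>x\<close> is the remainder of the derivative of order \<open>j + 1\<close>.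
\<close>

lemma taylor_bound_ball:
  assumes "m \<le> k" "\<epsilon> > 0"
  shows "\<exists>\<delta>>0. ball 0 \<delta> \<subseteq> U \<and> (\<forall>x\<in>ball 0 \<delta>. \<forall>hs. length hs = k - m \<longrightarrow>
    norm (D (k - m) x hs - (\<Sum>i\<le>m. (1 / fact i) *\<^sub>R D (k - m + i) 0 (replicate i x @ hs)))
      \<le> \<epsilon> * norm x ^ m * (\<Prod>h\<leftarrow>hs. norm h))"
  using assms(1)
proof (induction m)
  case 0
  obtain d where d: "d > 0" "ball 0 d \<subseteq> U" by (rule ball_in_U)
  from ct[OF _ U(2) assms(2), of k] obtain d' where d': "d' > 0"
    "\<And>y hs. y \<noteq> 0 \<Longrightarrow> dist y 0 < d' \<Longrightarrow> length hs = k \<Longrightarrow> norm (D k y hs - D k 0 hs) \<le> \<epsilon> * (\<Prod>h\<leftarrow>hs. norm h)"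
    unfolding eventually_at by auto
  show ?case
  proof (intro exI[of _ "min d d'"] conjI ballI allI impI)
    fix x :: 'a and hs :: "'a list" assume x: "x \<in> ball 0 (min d d')" and l: "length hs = k - 0"
    show "norm (D (k - 0) x hs - (\<Sum>i\<le>0. (1 / fact i) *\<^sub>R D (k - 0 + i) 0 (replicate i x @ hs)))
      \<le> \<epsilon> * norm x ^ 0 * (\<Prod>h\<leftarrow>hs. norm h)"
      using d'(2)[of x hs] x l assms(2) by (cases "x = 0") (auto simp: dist_norm)
  qed (use d d' in auto)
next
  case (Suc m)
  then have m: "m \<le> k" by simp
  define j where "j = k - Suc m"
  have j: "k - m = Suc j" "j < k" using Suc.prems by (auto simp: j_def)
  from Suc.IH[OF m] obtain \<delta> where \<delta>: "\<delta> > 0" "ball 0 \<delta> \<subseteq> U"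
    and IH: "\<And>x hs. x \<in> ball 0 \<delta> \<Longrightarrow> length hs = Suc j \<Longrightarrow>
      norm (D (Suc j) x hs - (\<Sum>i\<le>m. (1 / fact i) *\<^sub>R D (Suc j + i) 0 (replicate i x @ hs)))
      \<le> \<epsilon> * norm x ^ m * (\<Prod>h\<leftarrow>hs. norm h)"
    unfolding j by blast
  have "norm (D j x hs - (\<Sum>i\<le>Suc m. (1 / fact i) *\<^sub>R D (j + i) 0 (replicate i x @ hs)))
      \<le> \<epsilon> * norm x ^ Suc m * (\<Prod>h\<leftarrow>hs. norm h)"
    if x: "x \<in> ball 0 \<delta>" and l: "length hs = j" for x hs
  proof -
    define p where "p = (\<Prod>h\<leftarrow>hs. norm h)"
    have p: "p \<ge> 0" by (simp add: p_def)
    have len: "j + i \<le> k" if "i \<le> Suc m" for i using that Suc.prems by (simp add: j_def)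
    define c where "c i = D (j + i) 0 (replicate i x @ hs)" for i
    define \<phi> where "\<phi> t = D j (t *\<^sub>R x) hs - (\<Sum>i\<le>Suc m. (t ^ i / fact i) *\<^sub>R c i)" for t :: real
    define \<phi>' where "\<phi>' t = D (Suc j) (t *\<^sub>R x) (x # hs) - (\<Sum>i\<le>m. (t ^ i / fact i) *\<^sub>R c (Suc i))" for t :: real
    have tx: "t *\<^sub>R x \<in> ball 0 \<delta>" if "t \<in> {0..1}" for t
    proof -
      have "norm (t *\<^sub>R x) \<le> 1 * norm x" using that by (simp add: mult_left_le_one_le)
      then show ?thesis using x by simp
    qed
    have "norm (\<phi> 1 - \<phi> 0) \<le> \<epsilon> * norm x ^ Suc m * p"
    proof (rule unit_interval_mean_value)
      fix t :: real assume t: "t \<in> {0..1}"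
      have zU: "t *\<^sub>R x \<in> U" using tx[OF t] \<delta> by auto
      have 1: "((\<lambda>t. D j (t *\<^sub>R x) hs) has_vector_derivative D (Suc j) (t *\<^sub>R x) (x # hs)) (at t within {0..1})"
      proof -
        have "((\<lambda>t. t *\<^sub>R x) has_derivative (\<lambda>h. h *\<^sub>R x)) (at t within {0..1})"
          by (intro derivative_intros)
        from has_derivative_compose[OF this D_has_derivative[OF j(2) zU l]]
        have "((\<lambda>t. D j (t *\<^sub>R x) hs) has_derivative (\<lambda>h. D (Suc j) (t *\<^sub>R x) ((h *\<^sub>R x) # hs))) (at t within {0..1})" .
        moreover have "D (Suc j) (t *\<^sub>R x) ((h *\<^sub>R x) # hs) = h *\<^sub>R D (Suc j) (t *\<^sub>R x) (x # hs)" for h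
          using slot_scale[of "Suc j" "t *\<^sub>R x" "[]" hs h x] j zU l by simp
        ultimately show ?thesis by (simp add: has_vector_derivative_def)
      qed
      have 2: "((\<lambda>t. \<Sum>i\<le>Suc m. (t ^ i / fact i) *\<^sub>R c i) has_vector_derivative (\<Sum>i\<le>m. (t ^ i / fact i) *\<^sub>R c (Suc i))) (at t within {0..1})"
      proof -
        have "((\<lambda>t. (t ^ i / fact i) *\<^sub>R c i) has_vector_derivative (real i * t ^ (i - 1) / fact i) *\<^sub>R c i) (at t within {0..1})" for i
          unfolding has_vector_derivative_def
          by (auto intro!: derivative_eq_intros simp: algebra_simps)
        then have "((\<lambda>t. \<Sum>i\<le>Suc m. (t ^ i / fact i) *\<^sub>R c i) has_vector_derivative
            (\<Sum>i\<le>Suc m. (real i * t ^ (i - 1) / fact i) *\<^sub>R c i)) (at t within {0..1})"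
          by (intro has_vector_derivative_sum)
        moreover have "(\<Sum>i\<le>Suc m. (real i * t ^ (i - 1) / fact i) *\<^sub>R c i) = (\<Sum>i\<le>m. (t ^ i / fact i) *\<^sub>R c (Suc i))"
        proof -
          have "real (Suc i) * t ^ i / fact (Suc i) = t ^ i / fact i" for i
            by (simp add: fact_Suc del: of_nat_Suc)
          then show ?thesis
            by (subst sum.atMost_Suc_shift) (simp del: fact_Suc of_nat_Suc)
        qed
        ultimately show ?thesis by simp
      qed
      show "(\<phi> has_vector_derivative \<phi>' t) (at t within {0..1})"
        unfolding \<phi>_def \<phi>'_def by (rule has_vector_derivative_diff[OF 1 2])
      have c: "(t ^ i / fact i) *\<^sub>R c (Suc i) = (1 / fact i) *\<^sub>R D (Suc j + i) 0 (replicate i (t *\<^sub>R x) @ x # hs)" if "i \<le> m" for i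
      proof -
        have "D (Suc j + i) 0 ([] @ replicate i (t *\<^sub>R x) @ x # hs) = t ^ i *\<^sub>R D (Suc j + i) 0 ([] @ replicate i x @ x # hs)"
          using len[of "Suc i"] that l by (intro D_replicate_scale U) auto
        moreover have "replicate (Suc i) x @ hs = replicate i x @ x # hs"
          by (simp add: replicate_app_Cons_same)
        ultimately show ?thesis by (simp add: c_def)
      qed
      have "\<phi>' t = D (Suc j) (t *\<^sub>R x) (x # hs) - (\<Sum>i\<le>m. (1 / fact i) *\<^sub>R D (Suc j + i) 0 (replicate i (t *\<^sub>R x) @ x # hs))"
        unfolding \<phi>'_def by (intro arg_cong2[where f = minus] sum.cong refl c) simp
      also have "norm \<dots> \<le> \<epsilon> * norm (t *\<^sub>R x) ^ m * (\<Prod>h\<leftarrow>x # hs. norm h)"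
        by (rule IH[OF tx[OF t]]) (simp add: l)
      also have "\<dots> \<le> \<epsilon> * norm x ^ m * (\<Prod>h\<leftarrow>x # hs. norm h)"
        using t assms(2) by (intro mult_right_mono mult_left_mono power_mono) (auto simp: mult_left_le_one_le)
      finally show "norm (\<phi>' t) \<le> \<epsilon> * norm x ^ Suc m * p" by (simp add: p_def mult_ac)
    qed
    moreover have "\<phi> 0 = 0"
    proof -
      have "(\<Sum>i\<le>Suc m. (0 ^ i / fact i :: real) *\<^sub>R c i) = (\<Sum>i\<le>Suc m. if i = 0 then c 0 else 0)"
        by (rule sum.cong) auto
      also have "\<dots> = c 0" by (subst sum.delta) auto
      finally show ?thesis unfolding \<phi>_def by (simp add: c_def)
    qed
    ultimately show ?thesis by (simp add: \<phi>_def c_def p_def)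
  qed
  then show ?case using \<delta> unfolding j_def[symmetric] by blast
qed

lemma taylor:
  assumes "\<epsilon> > 0"
  shows "\<forall>\<^sub>F x in nhds 0. norm (f x - (\<Sum>i\<le>k. (1 / fact i) *\<^sub>R D i 0 (replicate i x))) \<le> \<epsilon> * norm x ^ k"
proof -
  obtain \<delta> where \<delta>: "\<delta> > 0" "ball 0 \<delta> \<subseteq> U"
    "\<And>x. x \<in> ball 0 \<delta> \<Longrightarrow> norm (D 0 x [] - (\<Sum>i\<le>k. (1 / fact i) *\<^sub>R D i 0 (replicate i x))) \<le> \<epsilon> * norm x ^ k"
    using taylor_bound_ball[of k \<epsilon>] assms by auto
  show ?thesis
    unfolding eventually_nhds_metric
  proof (intro exI[of _ \<delta>] conjI allI impI)
    fix x :: 'a assume "dist x 0 < \<delta>"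
    then have x: "x \<in> ball 0 \<delta>" by simp
    then have "D 0 x [] = f x" using \<delta>(2) by (intro D0) auto
    then show "norm (f x - (\<Sum>i\<le>k. (1 / fact i) *\<^sub>R D i 0 (replicate i x))) \<le> \<epsilon> * norm x ^ k"
      using \<delta>(3)[OF x] by simp
  qed (rule \<delta>(1))
qed

end

text \<open>
  The Taylor expansion up to order three, in the form in which it is composed with other maps: the
  quadratic part as a bilinear map, the cubic part by homogeneity and a Lipschitz estimate only.
  For \<open>k = 2\<close> there is no cubic part, and for \<open>k \<ge> 4\<close> the terms of order four and more are in the first
  error term.
\<close>

definition cubic_jet :: "nat \<Rightarrow> ('a::real_normed_vector \<Rightarrow> 'b::real_normed_vector) \<Rightarrow> ('a \<Rightarrow> 'b)
    \<Rightarrow> ('a \<Rightarrow> 'a \<Rightarrow> 'b) \<Rightarrow> ('a \<Rightarrow> 'b) \<Rightarrow> bool" where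
  "cubic_jet k f r1 r2 r3 \<longleftrightarrow> bounded_linear r1 \<and> bounded_bilinear r2 \<and>
     (\<forall>s x. r3 (s *\<^sub>R x) = s ^ 3 *\<^sub>R r3 x) \<and>
     (\<exists>C\<ge>0. \<forall>x y. norm (r3 x - r3 y) \<le> C * norm (x - y) * (norm x + norm y)\<^sup>2) \<and>
     (k < 3 \<longrightarrow> r3 = (\<lambda>_. 0)) \<and>
     (\<exists>C\<ge>0. \<forall>e>0. \<forall>\<^sub>F x in nhds 0.
        norm (f x - f 0 - r1 x - r2 x x - r3 x) \<le> C * norm x ^ 4 + e * norm x ^ k)"

lemma Ck_on_cubic_jet:
  fixes f :: "'a::real_normed_vector \<Rightarrow> 'b::real_normed_vector"
  assumes f: "Ck_on k UNIV U f" and U: "open U" "0 \<in> U" and k: "k \<ge> 2"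
  obtains f' r2 r3 where "cubic_jet k f (f' 0) r2 r3"
    "\<And>x. x \<in> U \<Longrightarrow> (f has_derivative f' x) (at x)"
    "\<And>e. e > 0 \<Longrightarrow> \<forall>\<^sub>F x in nhds 0. \<forall>h. norm (f' x h - f' 0 h) \<le> e * norm h"
proof -
  obtain D where "derivative_tower k U f D" using Ck_on_derivative_tower[OF f U] ..
  then interpret derivative_tower k U f D .
  define f' where "f' x h = D 1 x [h]" for x h
  have f': "(f has_derivative f' x) (at x)" if x: "x \<in> U" for x
  proof -
    have "((\<lambda>y. D 0 y []) has_derivative (\<lambda>h. D (Suc 0) x [h])) (at x)"
      using D_has_derivative[of 0 x "[]"] k x by simp
    then have "((\<lambda>y. D 0 y []) has_derivative f' x) (at x)" by (simp add: f'_def[abs_def])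
    then show ?thesis
      by (rule has_derivative_transform_within_open[OF _ U(1) x]) (rule D0)
  qed
  have cont: "\<forall>\<^sub>F x in nhds 0. \<forall>h. norm (f' x h - f' 0 h) \<le> e * norm h" if e: "e > 0" for e
  proof -
    have "\<forall>\<^sub>F x in at 0. \<forall>h. norm (f' x h - f' 0 h) \<le> e * norm h"
    proof (rule eventually_mono[OF ct[OF _ U(2) e, of 1]])
      fix y assume H: "\<forall>hs. length hs = 1 \<longrightarrow> norm (D 1 y hs - D 1 0 hs) \<le> e * (\<Prod>h\<leftarrow>hs. norm h)"
      show "\<forall>h. norm (f' y h - f' 0 h) \<le> e * norm h"
      proof
        fix h show "norm (f' y h - f' 0 h) \<le> e * norm h"
          using H[rule_format, of "[h]"] by (simp add: f'_def)
      qed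
    qed (use k in simp)
    then show ?thesis using e by (simp add: eventually_nhds_conv_at)
  qed
  define r2 where "r2 x y = (1/2) *\<^sub>R D 2 0 [x, y]" for x y
  define r3 where "r3 x = (if k < 3 then 0 else (1/6) *\<^sub>R D 3 0 [x, x, x])" for x
  have bl1: "bounded_linear (f' 0)" by (rule has_derivative_bounded_linear[OF f'[OF U(2)]])
  have bl2: "bounded_bilinear r2"
  proof
    show "r2 (a + a') b = r2 a b + r2 a' b" for a a' b
      using slot_add[of 2 0 "[]" "[b]" a a'] k U by (simp add: r2_def scaleR_add_right)
    show "r2 a (b + b') = r2 a b + r2 a b'" for a b b'
      using slot_add[of 2 0 "[a]" "[]" b b'] k U by (simp add: r2_def scaleR_add_right)
    show "r2 (r *\<^sub>R a) b = r *\<^sub>R r2 a b" for r a b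
      using slot_scale[of 2 0 "[]" "[b]" r a] k U by (simp add: r2_def)
    show "r2 a (r *\<^sub>R b) = r *\<^sub>R r2 a b" for r a b
      using slot_scale[of 2 0 "[a]" "[]" r b] k U by (simp add: r2_def)
    obtain C where C: "C \<ge> 0" "\<And>hs. length hs = 2 \<Longrightarrow> norm (D 2 0 hs) \<le> C * (\<Prod>h\<leftarrow>hs. norm h)"
      using D_bound[of 2 0] k U by metis
    have "norm (r2 a b) \<le> norm a * norm b * C" for a b
    proof -
      have "norm (r2 a b) \<le> norm (D 2 0 [a, b])" by (simp add: r2_def)
      also have "\<dots> \<le> norm a * norm b * C" using C(2)[of "[a, b]"] by (simp add: mult_ac)
      finally show ?thesis .
    qed
    then show "\<exists>K. \<forall>a b. norm (r2 a b) \<le> norm a * norm b * K" by blast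
  qed
  have r3s: "r3 (s *\<^sub>R x) = s ^ 3 *\<^sub>R r3 x" for s x
    using D_replicate_scale[of 3 0 "[]" 3 "[]" s x] U by (simp add: r3_def numeral_3_eq_3)
  have r3l: "\<exists>C\<ge>0. \<forall>x y. norm (r3 x - r3 y) \<le> C * norm (x - y) * (norm x + norm y)\<^sup>2"
  proof (cases "k < 3")
    case False
    then have k3: "3 \<le> k" by simp
    obtain C where C: "C \<ge> 0" "\<And>hs. length hs = 3 \<Longrightarrow> norm (D 3 0 hs) \<le> C * (\<Prod>h\<leftarrow>hs. norm h)"
      using D_bound[of 3 0] k3 U by metis
    show ?thesis
    proof (intro exI[of _ C] conjI allI C(1))
      fix x y
      have "D 3 0 [x, x, x] - D 3 0 [y, y, y] = D 3 0 [x - y, x, x] + D 3 0 [y, x - y, x] + D 3 0 [y, y, x - y]"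
        using slot_diff[of 3 0 "[]" "[x, x]" x y] slot_diff[of 3 0 "[y]" "[x]" x y] slot_diff[of 3 0 "[y, y]" "[]" x y] k3 U
        by simp
      also have "norm \<dots> \<le> norm (D 3 0 [x - y, x, x]) + norm (D 3 0 [y, x - y, x]) + norm (D 3 0 [y, y, x - y])"
        by (rule order_trans[OF norm_triangle_ineq add_right_mono[OF norm_triangle_ineq]])
      also have "\<dots> \<le> C * (norm (x - y) * (norm x * norm x)) + C * (norm y * (norm (x - y) * norm x)) + C * (norm y * (norm y * norm (x - y)))"
        using C(2)[of "[x - y, x, x]"] C(2)[of "[y, x - y, x]"] C(2)[of "[y, y, x - y]"] by simp
      also have "\<dots> = C * norm (x - y) * ((norm x)\<^sup>2 + norm x * norm y + (norm y)\<^sup>2)"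
        by (simp add: power2_eq_square algebra_simps)
      also have "\<dots> \<le> C * norm (x - y) * (norm x + norm y)\<^sup>2"
        using C(1) by (intro mult_left_mono) (auto simp: power2_eq_square algebra_simps)
      finally have "norm (D 3 0 [x, x, x] - D 3 0 [y, y, y]) \<le> C * norm (x - y) * (norm x + norm y)\<^sup>2" .
      moreover have "norm (r3 x - r3 y) \<le> norm (D 3 0 [x, x, x] - D 3 0 [y, y, y])"
        using False by (simp add: r3_def flip: scaleR_diff_right)
      ultimately show "norm (r3 x - r3 y) \<le> C * norm (x - y) * (norm x + norm y)\<^sup>2" by simp
    qed
  qed (auto simp: r3_def)
  have rem: "\<exists>C\<ge>0. \<forall>e>0. \<forall>\<^sub>F x in nhds 0.
        norm (f x - f 0 - f' 0 x - r2 x x - r3 x) \<le> C * norm x ^ 4 + e * norm x ^ k"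
  proof -
    have "\<exists>C\<ge>0. \<forall>hs. length hs = i \<longrightarrow> norm (D i 0 hs) \<le> C * (\<Prod>h\<leftarrow>hs. norm h)" if "i \<le> k" for i
      using D_bound[OF that U(2)] by metis
    then obtain C where C: "\<And>i. i \<le> k \<Longrightarrow> C i \<ge> 0"
      "\<And>i hs. i \<le> k \<Longrightarrow> length hs = i \<Longrightarrow> norm (D i 0 hs) \<le> C i * (\<Prod>h\<leftarrow>hs. norm h)" by metis
    have prodrep: "(\<Prod>h\<leftarrow>replicate i x. norm h) = norm x ^ i" for i and x :: 'a by (induction i) auto
    have split: "(\<Sum>i\<le>k. (1 / fact i) *\<^sub>R D i 0 (replicate i x)) =
        f 0 + f' 0 x + r2 x x + r3 x + (\<Sum>i\<in>{4..k}. (1 / fact i) *\<^sub>R D i 0 (replicate i x))" for x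
    proof -
      have "{..k} = {..2} \<union> {3..k}" using k by auto
      then have "(\<Sum>i\<le>k. (1 / fact i) *\<^sub>R D i 0 (replicate i x)) =
        (\<Sum>i\<le>2. (1 / fact i) *\<^sub>R D i 0 (replicate i x)) + (\<Sum>i\<in>{3..k}. (1 / fact i) *\<^sub>R D i 0 (replicate i x))"
        by (simp add: sum.union_disjoint)
      also have "(\<Sum>i\<le>2. (1 / fact i) *\<^sub>R D i 0 (replicate i x)) = f 0 + f' 0 x + r2 x x"
        by (simp add: numeral_2_eq_2 D0[OF U(2)] f'_def r2_def)
      also have "(\<Sum>i\<in>{3..k}. (1 / fact i) *\<^sub>R D i 0 (replicate i x)) = r3 x + (\<Sum>i\<in>{4..k}. (1 / fact i) *\<^sub>R D i 0 (replicate i x))"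
      proof (cases "k < 3")
        case False
        then show ?thesis by (subst sum.atLeast_Suc_atMost) (auto simp: r3_def fact_numeral numeral_3_eq_3 eval_nat_numeral)
      qed (auto simp: r3_def)
      finally show ?thesis by (simp add: add.assoc)
    qed
    define C' where "C' = (\<Sum>i\<in>{4..k}. C i)"
    have C': "C' \<ge> 0" using C(1) by (auto simp: C'_def intro!: sum_nonneg)
    have high: "norm (\<Sum>i\<in>{4..k}. (1 / fact i) *\<^sub>R D i 0 (replicate i x)) \<le> C' * norm x ^ 4" if x: "norm x \<le> 1" for x
    proof -
      have "norm (\<Sum>i\<in>{4..k}. (1 / fact i) *\<^sub>R D i 0 (replicate i x)) \<le> (\<Sum>i\<in>{4..k}. C i * norm x ^ 4)"
      proof (rule sum_norm_le)
        fix i assume i: "i \<in> {4..k}"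
        have "norm ((1 / fact i) *\<^sub>R D i 0 (replicate i x)) \<le> 1 * norm (D i 0 (replicate i x))"
          unfolding norm_scaleR by (intro mult_right_mono) (auto simp: divide_le_eq_1 fact_ge_1)
        also have "\<dots> \<le> 1 * (C i * norm x ^ i)"
          using C(2)[of i "replicate i x"] i unfolding prodrep by simp
        also have "\<dots> \<le> C i * norm x ^ 4"
          using C(1)[of i] i x by (auto intro!: mult_left_mono power_decreasing)
        finally show "norm ((1 / fact i) *\<^sub>R D i 0 (replicate i x)) \<le> C i * norm x ^ 4" .
      qed
      then show ?thesis by (simp add: C'_def sum_distrib_right)
    qed
    have small: "\<forall>\<^sub>F x in nhds (0::'a). norm x \<le> 1"
      unfolding eventually_nhds_metric by (intro exI[of _ 1]) (auto simp: dist_norm)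
    show ?thesis
    proof (intro exI[of _ C'] conjI allI impI C')
      fix e :: real assume "e > 0"
      from taylor[OF this] small
      show "\<forall>\<^sub>F x in nhds 0. norm (f x - f 0 - f' 0 x - r2 x x - r3 x) \<le> C' * norm x ^ 4 + e * norm x ^ k"
      proof eventually_elim
        case (elim x)
        have "f x - f 0 - f' 0 x - r2 x x - r3 x =
          (f x - (\<Sum>i\<le>k. (1 / fact i) *\<^sub>R D i 0 (replicate i x))) + (\<Sum>i\<in>{4..k}. (1 / fact i) *\<^sub>R D i 0 (replicate i x))"
          unfolding split by (simp add: algebra_simps)
        also have "norm \<dots> \<le> e * norm x ^ k + C' * norm x ^ 4"
          by (rule order_trans[OF norm_triangle_ineq add_mono[OF elim(1) high[OF elim(2)]]])
        finally show ?case by simp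
      qed
    qed
  qed
  show thesis
    by (rule that[of f' r2 r3, OF _ f' cont]) (use bl1 bl2 r3s r3l rem in \<open>auto simp: cubic_jet_def r3_def fun_eq_iff\<close>)
qed

section \<open>Jets along curves\<close>

text \<open>
  Composing a map with a curve \<open>s \<xi>(s)\<close> and dividing by a power of \<open>s\<close> isolates one coefficient of its
  jet.  Identities between maps become identities between coefficients by uniqueness of these limits.
\<close>

lemma at_right_scale_cong:
  assumes "(f \<longlongrightarrow> l) (at_right (0::real))" "\<And>s. s > 0 \<Longrightarrow> f s = g s"
  shows "(g \<longlongrightarrow> l) (at_right 0)"
  by (rule Lim_transform_eventually[OF assms(1)])
    (use assms(2) in \<open>auto simp: eventually_at_filter\<close>)

lemma at_right_ident_tendsto: "((\<lambda>s::real. s) \<longlongrightarrow> 0) (at_right 0)"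
  by (rule tendsto_ident_at)

context
  fixes k :: nat and f :: "'a::real_normed_vector \<Rightarrow> 'b::real_normed_vector" and r1 r2 r3
  assumes jet: "cubic_jet k f r1 r2 r3" and k: "k \<ge> 2" and f0: "f 0 = 0"
begin

lemma jet_linear: "bounded_linear r1" and jet_bilinear: "bounded_bilinear r2"
  and jet_cubic: "r3 (s *\<^sub>R x) = s ^ 3 *\<^sub>R r3 x"
  using jet by (auto simp: cubic_jet_def)

lemma jet_cubic_tendsto:
  assumes "(\<xi> \<longlongrightarrow> x) F" shows "((\<lambda>s. r3 (\<xi> s)) \<longlongrightarrow> r3 x) F"
proof -
  obtain C where C: "\<And>x y. norm (r3 x - r3 y) \<le> C * norm (x - y) * (norm x + norm y)\<^sup>2"
    using jet unfolding cubic_jet_def by blast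
  have "((\<lambda>s. C * norm (\<xi> s - x) * (norm (\<xi> s) + norm x)\<^sup>2) \<longlongrightarrow> C * norm (x - x) * (norm x + norm x)\<^sup>2) F"
    by (intro tendsto_intros assms)
  then have "((\<lambda>s. C * norm (\<xi> s - x) * (norm (\<xi> s) + norm x)\<^sup>2) \<longlongrightarrow> 0) F" by simp
  from Lim_null_comparison[OF _ this, of "\<lambda>s. r3 (\<xi> s) - r3 x"] C
  show ?thesis by (simp add: Lim_null[symmetric])
qed

lemma jet_remainder_tendsto:
  fixes \<xi> :: "real \<Rightarrow> 'a"
  assumes \<xi>: "(\<xi> \<longlongrightarrow> x) (at_right 0)" and i: "i \<le> k" "i \<le> 3"
  shows "((\<lambda>s. (f (s *\<^sub>R \<xi> s) - r1 (s *\<^sub>R \<xi> s) - r2 (s *\<^sub>R \<xi> s) (s *\<^sub>R \<xi> s) - r3 (s *\<^sub>R \<xi> s)) /\<^sub>R s ^ i) \<longlongrightarrow> 0) (at_right 0)"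
proof -
  obtain C where C: "C \<ge> 0" "\<And>e. e > 0 \<Longrightarrow> \<forall>\<^sub>F y in nhds 0.
        norm (f y - r1 y - r2 y y - r3 y) \<le> C * norm y ^ 4 + e * norm y ^ k"
    using jet f0 unfolding cubic_jet_def by auto
  define M where "M = norm x + 1"
  have M: "M > 0" by (simp add: M_def add_nonneg_pos)
  have "((\<lambda>s. norm (\<xi> s)) \<longlongrightarrow> norm x) (at_right 0)" by (intro tendsto_intros \<xi>)
  then have evM: "\<forall>\<^sub>F s in at_right 0. norm (\<xi> s) < M" by (rule order_tendstoD) (simp add: M_def)
  have ev1: "\<forall>\<^sub>F s::real in at_right 0. 0 < s \<and> s < 1"
    using eventually_at_right_real[of 0 1] by simp
  have X: "((\<lambda>s. s *\<^sub>R \<xi> s) \<longlongrightarrow> 0) (at_right 0)"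
    using tendsto_scaleR[OF at_right_ident_tendsto \<xi>] by simp
  show ?thesis
  proof (rule tendstoI)
    fix \<epsilon> :: real assume eps: "\<epsilon> > 0"
    define e where "e = \<epsilon> / 2 / M ^ k"
    have e: "e > 0" using eps M by (simp add: e_def)
    have "((\<lambda>s. C * M ^ 4 * s) \<longlongrightarrow> C * M ^ 4 * 0) (at_right 0)"
      by (intro tendsto_intros)
    then have evC: "\<forall>\<^sub>F s in at_right 0. C * M ^ 4 * s < \<epsilon> / 2"
      by (rule order_tendstoD) (use eps in simp)
    from eventually_compose_filterlim[OF C(2)[OF e] X] evM ev1 evC
    show "\<forall>\<^sub>F s in at_right 0. dist ((f (s *\<^sub>R \<xi> s) - r1 (s *\<^sub>R \<xi> s) - r2 (s *\<^sub>R \<xi> s) (s *\<^sub>R \<xi> s) - r3 (s *\<^sub>R \<xi> s)) /\<^sub>R s ^ i) 0 < \<epsilon>"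
    proof eventually_elim
      case (elim s)
      then have s: "0 < s" "s < 1" by auto
      have 1: "norm (s *\<^sub>R \<xi> s) \<le> s * M" using elim s by simp
      have "norm (f (s *\<^sub>R \<xi> s) - r1 (s *\<^sub>R \<xi> s) - r2 (s *\<^sub>R \<xi> s) (s *\<^sub>R \<xi> s) - r3 (s *\<^sub>R \<xi> s))
          \<le> C * (s * M) ^ 4 + e * (s * M) ^ k"
        using C(1) e 1 by (intro order_trans[OF elim(1)] add_mono mult_left_mono power_mono) auto
      also have "\<dots> \<le> (C * M ^ 4 * s) * s ^ i + (\<epsilon> / 2) * s ^ i"
      proof (rule add_mono)
        have "s ^ 4 = s * s ^ 3" by (simp add: eval_nat_numeral)
        also have "s ^ 3 \<le> s ^ i" using s i by (intro power_decreasing) auto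
        then have "s * s ^ 3 \<le> s * s ^ i" using s by (intro mult_left_mono) auto
        finally have "s ^ 4 \<le> s * s ^ i" .
        then have "C * M ^ 4 * s ^ 4 \<le> C * M ^ 4 * (s * s ^ i)" using C(1) M by (intro mult_left_mono) auto
        then show "C * (s * M) ^ 4 \<le> (C * M ^ 4 * s) * s ^ i" by (simp add: power_mult_distrib mult_ac)
        have "s ^ k \<le> s ^ i" using s i by (intro power_decreasing) auto
        then have "(\<epsilon> / 2) * s ^ k \<le> (\<epsilon> / 2) * s ^ i" using eps by (intro mult_left_mono) auto
        then show "e * (s * M) ^ k \<le> (\<epsilon> / 2) * s ^ i" using M by (simp add: e_def power_mult_distrib)
      qed
      also have "\<dots> < \<epsilon> * s ^ i"
        using mult_strict_right_mono[OF elim(4), of "s ^ i"] s by (simp add: field_simps)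
      finally show ?case using s by (simp add: divide_simps mult.commute)
    qed
  qed
qed

lemma jet_curve_1:
  assumes \<xi>: "(\<xi> \<longlongrightarrow> x) (at_right 0)"
  shows "((\<lambda>s. f (s *\<^sub>R \<xi> s) /\<^sub>R s) \<longlongrightarrow> r1 x) (at_right 0)"
proof -
  interpret r1: bounded_linear r1 by (rule jet_linear)
  interpret r2: bounded_bilinear r2 by (rule jet_bilinear)
  let ?rem = "\<lambda>s. (f (s *\<^sub>R \<xi> s) - r1 (s *\<^sub>R \<xi> s) - r2 (s *\<^sub>R \<xi> s) (s *\<^sub>R \<xi> s) - r3 (s *\<^sub>R \<xi> s)) /\<^sub>R s ^ 1"
  have "((\<lambda>s. ?rem s + r1 (\<xi> s) + s *\<^sub>R r2 (\<xi> s) (\<xi> s) + (s^2) *\<^sub>R r3 (\<xi> s)) \<longlongrightarrow> 0 + r1 x + 0 *\<^sub>R r2 x x + (0^2) *\<^sub>R r3 x) (at_right 0)"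
    using k by (intro tendsto_add jet_remainder_tendsto[OF \<xi>] tendsto_scaleR r1.tendsto r2.tendsto jet_cubic_tendsto \<xi>
      tendsto_power at_right_ident_tendsto) auto
  then have "((\<lambda>s. ?rem s + r1 (\<xi> s) + s *\<^sub>R r2 (\<xi> s) (\<xi> s) + (s^2) *\<^sub>R r3 (\<xi> s)) \<longlongrightarrow> r1 x) (at_right 0)" by simp
  then show ?thesis
  proof (rule at_right_scale_cong)
    fix s :: real assume s: "s > 0"
    show "?rem s + r1 (\<xi> s) + s *\<^sub>R r2 (\<xi> s) (\<xi> s) + (s^2) *\<^sub>R r3 (\<xi> s) = f (s *\<^sub>R \<xi> s) /\<^sub>R s"
    proof -
      have i: "inverse s * (s * s) = s" "inverse s * (s * s * s) = s * s"
        "inverse s * inverse s * (s * s) = 1" "inverse s * inverse s * (s * s * s) = s"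
        using s by (simp_all add: field_simps)
      show ?thesis
        using s by (simp add: i jet_cubic r1.scaleR r2.scaleR_left r2.scaleR_right scaleR_diff_right power2_eq_square power3_eq_cube)
    qed
  qed
qed

lemma jet_curve_2:
  assumes \<xi>: "(\<xi> \<longlongrightarrow> x) (at_right 0)"
  shows "((\<lambda>s. (f (s *\<^sub>R \<xi> s) - r1 (s *\<^sub>R \<xi> s)) /\<^sub>R s\<^sup>2) \<longlongrightarrow> r2 x x) (at_right 0)"
proof -
  interpret r1: bounded_linear r1 by (rule jet_linear)
  interpret r2: bounded_bilinear r2 by (rule jet_bilinear)
  let ?rem = "\<lambda>s. (f (s *\<^sub>R \<xi> s) - r1 (s *\<^sub>R \<xi> s) - r2 (s *\<^sub>R \<xi> s) (s *\<^sub>R \<xi> s) - r3 (s *\<^sub>R \<xi> s)) /\<^sub>R s ^ 2"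
  have "((\<lambda>s. ?rem s + r2 (\<xi> s) (\<xi> s) + s *\<^sub>R r3 (\<xi> s)) \<longlongrightarrow> 0 + r2 x x + 0 *\<^sub>R r3 x) (at_right 0)"
    using k by (intro tendsto_add jet_remainder_tendsto[OF \<xi>] tendsto_scaleR r2.tendsto jet_cubic_tendsto \<xi>
      at_right_ident_tendsto) auto
  then have "((\<lambda>s. ?rem s + r2 (\<xi> s) (\<xi> s) + s *\<^sub>R r3 (\<xi> s)) \<longlongrightarrow> r2 x x) (at_right 0)" by simp
  then show ?thesis
  proof (rule at_right_scale_cong)
    fix s :: real assume s: "s > 0"
    show "?rem s + r2 (\<xi> s) (\<xi> s) + s *\<^sub>R r3 (\<xi> s) = (f (s *\<^sub>R \<xi> s) - r1 (s *\<^sub>R \<xi> s)) /\<^sub>R s\<^sup>2"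
    proof -
      have i: "inverse s * (s * s) = s" "inverse s * (s * s * s) = s * s"
        "inverse s * inverse s * (s * s) = 1" "inverse s * inverse s * (s * s * s) = s"
        using s by (simp_all add: field_simps)
      show ?thesis
        using s by (simp add: i jet_cubic r2.scaleR_left r2.scaleR_right scaleR_diff_right power2_eq_square power3_eq_cube)
    qed
  qed
qed

lemma jet_curve_3:
  assumes k3: "k \<ge> 3"
  shows "((\<lambda>s. (f (s *\<^sub>R x + s\<^sup>2 *\<^sub>R y) - r1 (s *\<^sub>R x + s\<^sup>2 *\<^sub>R y) - s\<^sup>2 *\<^sub>R r2 x x) /\<^sub>R s ^ 3) \<longlongrightarrow> r2 x y + r2 y x + r3 x) (at_right 0)"
proof -
  interpret r1: bounded_linear r1 by (rule jet_linear)
  interpret r2: bounded_bilinear r2 by (rule jet_bilinear)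
  define \<xi> where "\<xi> s = x + s *\<^sub>R y" for s :: real
  have "(\<xi> \<longlongrightarrow> x + 0 *\<^sub>R y) (at_right 0)" unfolding \<xi>_def by (intro tendsto_intros)
  then have \<xi>: "(\<xi> \<longlongrightarrow> x) (at_right 0)" by simp
  let ?rem = "\<lambda>s. (f (s *\<^sub>R \<xi> s) - r1 (s *\<^sub>R \<xi> s) - r2 (s *\<^sub>R \<xi> s) (s *\<^sub>R \<xi> s) - r3 (s *\<^sub>R \<xi> s)) /\<^sub>R s ^ 3"
  have "((\<lambda>s. ?rem s + (r2 x y + r2 y x + s *\<^sub>R r2 y y) + r3 (\<xi> s)) \<longlongrightarrow> 0 + (r2 x y + r2 y x + 0 *\<^sub>R r2 y y) + r3 x) (at_right 0)"
    using k3 by (intro tendsto_add jet_remainder_tendsto[OF \<xi>] tendsto_scaleR jet_cubic_tendsto \<xi>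
      at_right_ident_tendsto tendsto_const) auto
  then have "((\<lambda>s. ?rem s + (r2 x y + r2 y x + s *\<^sub>R r2 y y) + r3 (\<xi> s)) \<longlongrightarrow> r2 x y + r2 y x + r3 x) (at_right 0)" by simp
  then show ?thesis
  proof (rule at_right_scale_cong)
    fix s :: real assume s: "s > 0"
    have X: "s *\<^sub>R x + s\<^sup>2 *\<^sub>R y = s *\<^sub>R \<xi> s" by (simp add: \<xi>_def scaleR_add_right power2_eq_square)
    have q: "r2 (s *\<^sub>R \<xi> s) (s *\<^sub>R \<xi> s) = s\<^sup>2 *\<^sub>R r2 x x + s ^ 3 *\<^sub>R (r2 x y + r2 y x + s *\<^sub>R r2 y y)"
      by (simp add: \<xi>_def r2.scaleR_left r2.scaleR_right r2.add_left r2.add_right scaleR_add_right power2_eq_square power3_eq_cube add_ac mult.assoc)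
    show "?rem s + (r2 x y + r2 y x + s *\<^sub>R r2 y y) + r3 (\<xi> s) =
      (f (s *\<^sub>R x + s\<^sup>2 *\<^sub>R y) - r1 (s *\<^sub>R x + s\<^sup>2 *\<^sub>R y) - s\<^sup>2 *\<^sub>R r2 x x) /\<^sub>R s ^ 3"
    proof -
      define v where "v = r2 x y + r2 y x + s *\<^sub>R r2 y y"
      have "?rem s = (f (s *\<^sub>R \<xi> s) - r1 (s *\<^sub>R \<xi> s) - s\<^sup>2 *\<^sub>R r2 x x - s ^ 3 *\<^sub>R (v + r3 (\<xi> s))) /\<^sub>R s ^ 3"
        unfolding q v_def[symmetric] jet_cubic by (simp add: algebra_simps)
      also have "\<dots> = (f (s *\<^sub>R \<xi> s) - r1 (s *\<^sub>R \<xi> s) - s\<^sup>2 *\<^sub>R r2 x x) /\<^sub>R s ^ 3 - (v + r3 (\<xi> s))"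
        unfolding scaleR_diff_right[of _ _ "s ^ 3 *\<^sub>R _"] using s by simp
      finally show ?thesis unfolding X v_def[symmetric] by simp
    qed
  qed
qed

end

lemma cubic_jet_compose_linear:
  assumes "cubic_jet k f r1 r2 r3" "bounded_linear B"
  shows "cubic_jet k (\<lambda>x. B (f x)) (\<lambda>x. B (r1 x)) (\<lambda>x y. B (r2 x y)) (\<lambda>x. B (r3 x))"
proof -
  interpret B: bounded_linear B by (rule assms(2))
  obtain K where K: "K > 0" "\<And>x. norm (B x) \<le> norm x * K" using B.pos_bounded by auto
  from assms(1) have r: "bounded_linear r1" "bounded_bilinear r2" "\<And>s x. r3 (s *\<^sub>R x) = s ^ 3 *\<^sub>R r3 x"
    "k < 3 \<Longrightarrow> r3 = (\<lambda>_. 0)" by (auto simp: cubic_jet_def)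
  obtain C where C: "C \<ge> 0" "\<And>x y. norm (r3 x - r3 y) \<le> C * norm (x - y) * (norm x + norm y)\<^sup>2"
    using assms(1) unfolding cubic_jet_def by blast
  obtain C' where C': "C' \<ge> 0" "\<And>e. e > 0 \<Longrightarrow> \<forall>\<^sub>F x in nhds 0.
        norm (f x - f 0 - r1 x - r2 x x - r3 x) \<le> C' * norm x ^ 4 + e * norm x ^ k"
    using assms(1) unfolding cubic_jet_def by blast
  have "bounded_linear (\<lambda>x. B (r1 x))" by (rule bounded_linear_compose[OF assms(2) r(1)])
  moreover have "bounded_bilinear (\<lambda>x y. B (r2 x y))"
  proof -
    interpret r2: bounded_bilinear r2 by (rule r(2))
    obtain K2 where K2: "K2 > 0" "\<And>x y. norm (r2 x y) \<le> norm x * norm y * K2" using r2.pos_bounded by auto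
    show ?thesis
    proof
      have "norm (B (r2 x y)) \<le> norm x * norm y * (K2 * K)" for x y
        using order_trans[OF K(2) mult_right_mono[OF K2(2)[of x y], of K]] K by (simp add: mult_ac)
      then show "\<exists>M. \<forall>x y. norm (B (r2 x y)) \<le> norm x * norm y * M" by blast
    qed (simp_all add: r2.add_left r2.add_right r2.scaleR_left r2.scaleR_right B.add B.scaleR)
  qed
  moreover have "norm (B (r3 x) - B (r3 y)) \<le> (C * K) * norm (x - y) * (norm x + norm y)\<^sup>2" for x y
  proof -
    have "norm (B (r3 x) - B (r3 y)) \<le> norm (r3 x - r3 y) * K" using K(2) by (simp flip: B.diff)
    also have "\<dots> \<le> (C * norm (x - y) * (norm x + norm y)\<^sup>2) * K" using K C(2) by (intro mult_right_mono) auto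
    finally show ?thesis by (simp add: mult_ac)
  qed
  moreover have "\<forall>\<^sub>F x in nhds 0. norm (B (f x) - B (f 0) - B (r1 x) - B (r2 x x) - B (r3 x))
      \<le> (C' * K) * norm x ^ 4 + e * norm x ^ k" if e: "e > 0" for e
  proof -
    have "e / K > 0" using e K by simp
    from C'(2)[OF this] show ?thesis
    proof eventually_elim
      case (elim x)
      have "norm (B (f x) - B (f 0) - B (r1 x) - B (r2 x x) - B (r3 x)) \<le> norm (f x - f 0 - r1 x - r2 x x - r3 x) * K"
        using K(2) by (simp flip: B.diff)
      also have "\<dots> \<le> (C' * norm x ^ 4 + e / K * norm x ^ k) * K" using K elim by (intro mult_right_mono) auto
      also have "\<dots> = (C' * K) * norm x ^ 4 + e * norm x ^ k" using K by (simp add: algebra_simps)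
      finally show ?case .
    qed
  qed
  moreover have "C * K \<ge> 0" "C' * K \<ge> 0" using C C' K by auto
  ultimately show ?thesis
    unfolding cubic_jet_def using r(3,4) by (auto simp: B.scaleR B.zero)
qed

text \<open>
  The rotation that moves \<open>|A|\<close> to \<open>A\<close> reduces the values to those on the positive real axis, where
  homogeneity applies.  The value at \<open>1\<close> is real because conjugation fixes \<open>1\<close>.
\<close>

lemma circle_equivariant_homogeneous:
  fixes g :: "complex \<Rightarrow> complex"
  assumes rot: "\<And>c A. cmod c = 1 \<Longrightarrow> g (c * A) = c * g A" and refl: "\<And>A. g (cnj A) = cnj (g A)"
    and hom: "\<And>r A. g (r *\<^sub>R A) = r ^ Suc q *\<^sub>R g A"
  shows "g A = of_real (Re (g 1)) * A * of_real (cmod A ^ q)"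
proof -
  have re: "g 1 = of_real (Re (g 1))" using refl[of 1] by (simp add: complex_eq_iff)
  show ?thesis
  proof (cases "A = 0")
    case True
    then show ?thesis using hom[of 0 1] by simp
  next
    case False
    have A: "A = sgn A * (cmod A *\<^sub>R 1)" using False by (simp add: sgn_eq scaleR_conv_of_real)
    have "g A = g (sgn A * (cmod A *\<^sub>R 1))" using A by simp
    also have "\<dots> = sgn A * (cmod A ^ Suc q *\<^sub>R g 1)"
      using False by (simp only: rot hom norm_sgn if_False)
    also have "\<dots> = g 1 * (sgn A * of_real (cmod A)) * of_real (cmod A ^ q)"
      by (simp add: scaleR_conv_of_real mult_ac)
    also have "sgn A * of_real (cmod A) = A" using False by (simp add: sgn_eq)
    finally show ?thesis using re by simp
  qed
qed

section \<open>Coefficients of the reduced field\<close>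

text \<open>
  \<open>B\<close> is a symmetry of the field \<open>L + N\<close> that acts on the domain by \<open>BZ\<close> and on the coordinate \<open>A\<close> of
  the centre space by \<open>\<sigma>\<close>.
\<close>

definition field_symmetry ::
  "('z::real_normed_vector \<Rightarrow> 'x::real_normed_vector) \<Rightarrow> ('z \<Rightarrow> 'x) \<Rightarrow> (complex \<Rightarrow> 'z) \<Rightarrow> ('x \<Rightarrow> complex)
    \<Rightarrow> ('z \<times> 'w \<Rightarrow> 'x) \<Rightarrow> ('x \<Rightarrow> 'x) \<Rightarrow> ('z \<Rightarrow> 'z) \<Rightarrow> (complex \<Rightarrow> complex) \<Rightarrow> bool" where
  "field_symmetry j L E crd N B BZ \<sigma> \<longleftrightarrow> bounded_linear B \<and> linear \<sigma> \<and> linear BZ \<and>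
     (\<forall>u. j (BZ u) = B (j u)) \<and> (\<forall>u. L (BZ u) = B (L u)) \<and> (\<forall>u w. N (BZ u, w) = B (N (u, w))) \<and>
     (\<forall>A. BZ (E A) = E (\<sigma> A)) \<and> (\<forall>x. crd (B x) = \<sigma> (crd x))"

text \<open>
  \<open>E\<close> parametrises the centre space, which is the kernel of \<open>L\<close>, and \<open>crd\<close> is the coordinate of the
  projection to it.  \<open>w\<close> collects the slow variable and the parameters, \<open>\<psi>\<close> is the reduction function
  in coordinates, and \<open>drift\<close> is the velocity of \<open>w\<close> on the centre manifold, with linear part \<open>drift0\<close>.
  The velocity is proportional to \<open>\<epsilon>\<close> and \<open>\<epsilon>\<close> does not move; this is why \<open>drift0\<close> squares to \<open>0\<close>.
\<close>

locale equivariant_reduction =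
  fixes k :: nat and j :: "'z::real_normed_vector \<Rightarrow> 'x::real_normed_vector" and L :: "'z \<Rightarrow> 'x"
    and E :: "complex \<Rightarrow> 'z" and crd :: "'x \<Rightarrow> complex"
    and N :: "'z \<times> 'w::real_normed_vector \<Rightarrow> 'x" and n1 n2 n3
    and \<psi> :: "complex \<times> 'w \<Rightarrow> 'z" and d\<psi> :: "complex \<times> 'w \<Rightarrow> complex \<times> 'w \<Rightarrow> 'z" and p2 p3
    and drift :: "complex \<times> 'w \<Rightarrow> 'w" and drift0 :: "'w \<Rightarrow> 'w"
  assumes k: "k \<ge> 2"
    and j: "bounded_linear j" and L: "bounded_linear L" and E: "bounded_linear E" and crd: "bounded_linear crd"
    and LE: "\<And>A. L (E A) = 0" and ker: "\<And>u. L u = 0 \<Longrightarrow> u \<in> range E"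
    and crdE: "\<And>A. crd (j (E A)) = A" and crdL: "\<And>u. crd (L u) = 0"
    and Njet: "cubic_jet k N n1 n2 n3" and N0: "N 0 = 0" and n1u: "\<And>u. n1 (u, 0) = 0"
    and \<psi>jet: "cubic_jet k \<psi> (d\<psi> 0) p2 p3" and \<psi>0: "\<psi> 0 = 0" and d\<psi>A: "\<And>A. d\<psi> 0 (A, 0) = 0"
    and d\<psi>_lin: "\<And>x. linear (d\<psi> x)"
    and d\<psi>_cont: "\<And>e. e > 0 \<Longrightarrow> \<forall>\<^sub>F x in nhds 0. \<forall>h. norm (d\<psi> x h - d\<psi> 0 h) \<le> e * norm h"
    and crd\<psi>: "\<And>x. crd (j (\<psi> x)) = 0"
    and driftA: "\<And>A. drift (A, 0) = 0" and drift00: "\<And>w. drift0 (drift0 w) = 0"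
    and drift_lim: "\<And>w. ((\<lambda>s. drift (0, s *\<^sub>R w) /\<^sub>R s) \<longlongrightarrow> drift0 w) (at_right 0)"
    and invariance: "\<forall>\<^sub>F x in nhds 0. L (\<psi> x) + N (E (fst x) + \<psi> x, snd x) =
       j (E (crd (N (E (fst x) + \<psi> x, snd x)))) + j (d\<psi> x (crd (N (E (fst x) + \<psi> x, snd x)), drift x))"
    and rotation: "\<And>c. cmod c = 1 \<Longrightarrow> \<exists>B BZ. field_symmetry j L E crd N B BZ ((*) c)"
    and reflection: "\<exists>B BZ. field_symmetry j L E crd N B BZ cnj"
begin

sublocale j: bounded_linear j by (rule j)
sublocale L: bounded_linear L by (rule L)
sublocale E: bounded_linear E by (rule E)
sublocale crd: bounded_linear crd by (rule crd)
sublocale n1: bounded_linear n1 by (rule jet_linear[OF Njet k N0])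
sublocale n2: bounded_bilinear n2 by (rule jet_bilinear[OF Njet k N0])
sublocale d\<psi>0: bounded_linear "d\<psi> 0" by (rule jet_linear[OF \<psi>jet k \<psi>0])
sublocale p2: bounded_bilinear p2 by (rule jet_bilinear[OF \<psi>jet k \<psi>0])

lemma n1_eq: "n1 (u, w) = n1 (0, w)"
  using n1.add[of "(u, 0)" "(0, w)"] n1u by simp

definition "\<psi>1 w = d\<psi> 0 (0, w)"
definition "Q A = p2 (A, 0) (A, 0)"

lemma d\<psi>0_eq: "d\<psi> 0 (A, w) = \<psi>1 w"
  using d\<psi>0.add[of "(A, 0)" "(0, w)"] d\<psi>A by (simp add: \<psi>1_def)

lemma \<psi>1_scale: "\<psi>1 (s *\<^sub>R w) = s *\<^sub>R \<psi>1 w"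
  using d\<psi>0.scaleR[of s "(0, w)"] by (simp add: \<psi>1_def)

lemma \<psi>1_add: "\<psi>1 (v + w) = \<psi>1 v + \<psi>1 w"
  using d\<psi>0.add[of "(0, v)" "(0, w)"] by (simp add: \<psi>1_def)

lemma nontrivial_at_right: "at_right (0::real) \<noteq> bot" by simp

lemma kernel_unique: "L u = 0 \<Longrightarrow> crd (j u) = 0 \<Longrightarrow> u = 0"
  using ker crdE E.zero by (metis imageE)

lemma crd_d\<psi>0: "crd (j (d\<psi> 0 x)) = 0"
proof -
  have "((\<lambda>s. crd (j (\<psi> (s *\<^sub>R x) /\<^sub>R s))) \<longlongrightarrow> crd (j (d\<psi> 0 x))) (at_right 0)"
    by (intro crd.tendsto j.tendsto jet_curve_1[OF \<psi>jet k \<psi>0] tendsto_const)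
  then have "((\<lambda>s::real. 0) \<longlongrightarrow> crd (j (d\<psi> 0 x))) (at_right 0)"
    by (simp add: j.scaleR crd.scaleR crd\<psi>)
  then show ?thesis using tendsto_unique[OF nontrivial_at_right] tendsto_const by metis
qed

lemma crd_\<psi>1: "crd (j (\<psi>1 w)) = 0"
  by (simp add: \<psi>1_def crd_d\<psi>0)

lemma crd_Q: "crd (j (Q A)) = 0"
proof -
  have "((\<lambda>s. crd (j ((\<psi> (s *\<^sub>R (A, 0)) - d\<psi> 0 (s *\<^sub>R (A, 0))) /\<^sub>R s\<^sup>2))) \<longlongrightarrow> crd (j (Q A))) (at_right 0)"
    unfolding Q_def by (intro crd.tendsto j.tendsto jet_curve_2[OF \<psi>jet k \<psi>0] tendsto_const)
  then have "((\<lambda>s::real. 0) \<longlongrightarrow> crd (j (Q A))) (at_right 0)"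
    by (simp only: j.scaleR crd.scaleR j.diff crd.diff crd\<psi> crd_d\<psi>0) simp
  then show ?thesis using tendsto_unique[OF nontrivial_at_right] tendsto_const by metis
qed

context
  fixes B BZ \<sigma>
  assumes sym: "field_symmetry j L E crd N B BZ \<sigma>"
begin

lemma sym_simps: "j (BZ u) = B (j u)" "L (BZ u) = B (L u)" "N (BZ u, w) = B (N (u, w))"
    "BZ (E A) = E (\<sigma> A)" "crd (B x) = \<sigma> (crd x)"
  and blB: "bounded_linear B" and lin\<sigma>: "linear \<sigma>" and linBZ: "linear BZ"
  using sym by (auto simp: field_symmetry_def)

lemma bl\<sigma>: "bounded_linear \<sigma>" using lin\<sigma> by (simp add: linear_conv_bounded_linear)

interpretation B: bounded_linear B by (rule blB)
interpretation \<sigma>: bounded_linear \<sigma> by (rule bl\<sigma>)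

text \<open>
  The origin is fixed by the symmetry, hence so is the field at \<open>(0, w)\<close>.
\<close>

lemma n1_fixed: "B (n1 (0, w)) = n1 (0, w)"
proof -
  have l: "((\<lambda>s. N (s *\<^sub>R (0, w)) /\<^sub>R s) \<longlongrightarrow> n1 (0, w)) (at_right 0)"
    by (intro jet_curve_1[OF Njet k N0] tendsto_const)
  have "N (s *\<^sub>R (0, w)) = B (N (s *\<^sub>R (0, w)))" for s
    using sym_simps(3)[of 0 "s *\<^sub>R w"] linear_0[OF linBZ] by simp
  then have "B (N (s *\<^sub>R (0, w)) /\<^sub>R s) = N (s *\<^sub>R (0, w)) /\<^sub>R s" for s by (simp add: B.scaleR)
  with B.tendsto[OF l] have "((\<lambda>s. N (s *\<^sub>R (0, w)) /\<^sub>R s) \<longlongrightarrow> B (n1 (0, w))) (at_right 0)" by simp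
  from tendsto_unique[OF nontrivial_at_right this l] show ?thesis .
qed

lemma n2_equivariant: "n2 (E (\<sigma> A), 0) (E (\<sigma> A), 0) = B (n2 (E A, 0) (E A, 0))"
proof -
  have l: "((\<lambda>s. N (s *\<^sub>R (E A, 0)) /\<^sub>R s\<^sup>2) \<longlongrightarrow> n2 (E A, 0) (E A, 0)) (at_right 0)" for A
    using jet_curve_2[OF Njet k N0 tendsto_const, of "(E A, 0)"] by (simp add: n1u)
  have "N (s *\<^sub>R (E (\<sigma> A), 0)) = B (N (s *\<^sub>R (E A, 0)))" for s
    using sym_simps(3)[of "s *\<^sub>R E A" 0] by (simp add: linear_scale[OF linBZ] sym_simps)
  then have "B (N (s *\<^sub>R (E A, 0)) /\<^sub>R s\<^sup>2) = N (s *\<^sub>R (E (\<sigma> A), 0)) /\<^sub>R s\<^sup>2" for s by (simp add: B.scaleR)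
  with B.tendsto[OF l[of A]] have "((\<lambda>s. N (s *\<^sub>R (E (\<sigma> A), 0)) /\<^sub>R s\<^sup>2) \<longlongrightarrow> B (n2 (E A, 0) (E A, 0))) (at_right 0)" by simp
  from tendsto_unique[OF nontrivial_at_right l this] show ?thesis .
qed

end

text \<open>
  The half turn acts on the coordinate as \<open>- 1\<close>, so its invariants have coordinate \<open>0\<close>.
\<close>

lemma half_turn_zero:
  obtains B BZ where "field_symmetry j L E crd N B BZ ((*) (- 1))"
    "\<And>x. B x = x \<Longrightarrow> crd x = 0"
proof -
  obtain B BZ where s: "field_symmetry j L E crd N B BZ ((*) (- 1))" using rotation[of "-1"] by auto
  have "crd x = 0" if "B x = x" for x
    using sym_simps(5)[OF s, of x] that by (simp add: complex_eq_iff)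
  then show thesis using that s by blast
qed

lemma crd_n1: "crd (n1 x) = 0"
proof (cases x)
  case (Pair u w)
  obtain B BZ where s: "field_symmetry j L E crd N B BZ ((*) (- 1))" "\<And>x. B x = x \<Longrightarrow> crd x = 0"
    by (rule half_turn_zero) blast
  show ?thesis unfolding Pair n1_eq[of u w] by (rule s(2)[OF n1_fixed[OF s(1)]])
qed

text \<open>
  A quadratic form is even, but the half turn makes its coordinate odd.
\<close>

lemma crd_n2_EE: "crd (n2 (E A, 0) (E A, 0)) = 0"
proof -
  obtain B BZ where s: "field_symmetry j L E crd N B BZ ((*) (- 1))" "\<And>x. B x = x \<Longrightarrow> crd x = 0"
    by (rule half_turn_zero) blast
  have "(E (- 1 * A), 0 :: 'w) = - (E A, 0)" by (simp add: E.neg)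
  then have "n2 (E A, 0) (E A, 0) = B (n2 (E A, 0) (E A, 0))"
    using n2_equivariant[OF s(1), of A] by (simp only: n2.minus_left n2.minus_right minus_minus)
  then show ?thesis using s(2) by metis
qed

definition "reduced_field x = crd (N (E (fst x) + \<psi> x, snd x))"

lemma d\<psi>_tendsto:
  assumes "(X \<longlongrightarrow> 0) (at_right (0::real))" "(h \<longlongrightarrow> h0) (at_right 0)"
  shows "((\<lambda>s. d\<psi> (X s) (h s)) \<longlongrightarrow> d\<psi> 0 h0) (at_right 0)"
proof -
  have "((\<lambda>s. d\<psi> (X s) (h s) - d\<psi> 0 (h s)) \<longlongrightarrow> 0) (at_right 0)"
  proof (rule tendstoI)
    fix e :: real assume e: "e > 0"
    define e' where "e' = e / (norm h0 + 1)"
    have h0: "norm h0 + 1 > 0" by (simp add: add_nonneg_pos)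
    have e': "e' > 0" using e h0 by (simp add: e'_def)
    have "((\<lambda>s. norm (h s)) \<longlongrightarrow> norm h0) (at_right 0)" by (intro tendsto_intros assms)
    then have "\<forall>\<^sub>F s in at_right 0. norm (h s) < norm h0 + 1" by (rule order_tendstoD) simp
    with eventually_compose_filterlim[OF d\<psi>_cont[OF e'] assms(1)]
    show "\<forall>\<^sub>F s in at_right 0. dist (d\<psi> (X s) (h s) - d\<psi> 0 (h s)) 0 < e"
    proof eventually_elim
      case (elim s)
      then have "norm (d\<psi> (X s) (h s) - d\<psi> 0 (h s)) \<le> e' * norm (h s)" by blast
      also have "\<dots> < e' * (norm h0 + 1)" using elim e' by (intro mult_strict_left_mono) auto
      also have "\<dots> = e" using h0 by (simp add: e'_def)
      finally show ?case by simp
    qed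
  qed
  from tendsto_add[OF this d\<psi>0.tendsto[OF assms(2)]] show ?thesis by simp
qed

text \<open>
  The part of the invariance equation that is of first order in \<open>w\<close>.
\<close>

lemma invariance_linear: "L (\<psi>1 w) + n1 (0, w) = j (\<psi>1 (drift0 w))"
proof -
  have X: "((\<lambda>s. s *\<^sub>R (0::complex, w)) \<longlongrightarrow> 0) (at_right 0)"
    using tendsto_scaleR[OF at_right_ident_tendsto tendsto_const, of "(0, w)"] by (simp add: zero_prod_def)
  have \<psi>l: "((\<lambda>s. \<psi> (s *\<^sub>R (0, w)) /\<^sub>R s) \<longlongrightarrow> \<psi>1 w) (at_right 0)"
    unfolding \<psi>1_def by (intro jet_curve_1[OF \<psi>jet k \<psi>0] tendsto_const)
  define \<xi> where "\<xi> s = (\<psi> (s *\<^sub>R (0, w)) /\<^sub>R s, w)" for s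
  have \<xi>: "(\<xi> \<longlongrightarrow> (\<psi>1 w, w)) (at_right 0)" unfolding \<xi>_def by (intro tendsto_intros \<psi>l)
  have Nl: "((\<lambda>s. N (s *\<^sub>R \<xi> s) /\<^sub>R s) \<longlongrightarrow> n1 (0, w)) (at_right 0)"
    using jet_curve_1[OF Njet k N0 \<xi>] by (simp add: n1_eq[of "\<psi>1 w"])
  define F where "F s = crd (N (s *\<^sub>R \<xi> s))" for s
  have Fl: "((\<lambda>s. F s /\<^sub>R s) \<longlongrightarrow> 0) (at_right 0)"
    using crd.tendsto[OF Nl] by (simp add: F_def crd.scaleR crd_n1)
  have lhs: "((\<lambda>s. L (\<psi> (s *\<^sub>R (0, w)) /\<^sub>R s) + N (s *\<^sub>R \<xi> s) /\<^sub>R s) \<longlongrightarrow> L (\<psi>1 w) + n1 (0, w)) (at_right 0)"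
    by (intro tendsto_intros L.tendsto \<psi>l Nl)
  have "((\<lambda>s. j (E (F s /\<^sub>R s)) + j (d\<psi> (s *\<^sub>R (0, w)) (F s /\<^sub>R s, drift (0, s *\<^sub>R w) /\<^sub>R s)))
      \<longlongrightarrow> j (E 0) + j (d\<psi> 0 (0, drift0 w))) (at_right 0)"
    by (intro tendsto_add j.tendsto E.tendsto Fl d\<psi>_tendsto X tendsto_Pair drift_lim)
  then have rhs: "((\<lambda>s. j (E (F s /\<^sub>R s)) + j (d\<psi> (s *\<^sub>R (0, w)) (F s /\<^sub>R s, drift (0, s *\<^sub>R w) /\<^sub>R s)))
      \<longlongrightarrow> j (\<psi>1 (drift0 w))) (at_right 0)"
    by (simp add: E.zero j.zero \<psi>1_def)
  have pos: "\<forall>\<^sub>F s::real in at_right 0. s > 0" by (simp add: eventually_at_right_less)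
  have "\<forall>\<^sub>F s in at_right 0. L (\<psi> (s *\<^sub>R (0, w)) /\<^sub>R s) + N (s *\<^sub>R \<xi> s) /\<^sub>R s =
      j (E (F s /\<^sub>R s)) + j (d\<psi> (s *\<^sub>R (0, w)) (F s /\<^sub>R s, drift (0, s *\<^sub>R w) /\<^sub>R s))"
    using eventually_compose_filterlim[OF invariance X] pos
  proof eventually_elim
    case (elim s)
    have \<xi>s: "s *\<^sub>R \<xi> s = (E (fst (s *\<^sub>R (0, w))) + \<psi> (s *\<^sub>R (0, w)), snd (s *\<^sub>R (0::complex, w)))"
      using elim(2) by (simp add: \<xi>_def E.zero)
    have "L (\<psi> (s *\<^sub>R (0, w))) + N (s *\<^sub>R \<xi> s) = j (E (F s)) + j (d\<psi> (s *\<^sub>R (0, w)) (F s, drift (0, s *\<^sub>R w)))"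
      using elim(1) unfolding F_def \<xi>s by simp
    then have "(L (\<psi> (s *\<^sub>R (0, w))) + N (s *\<^sub>R \<xi> s)) /\<^sub>R s = (j (E (F s)) + j (d\<psi> (s *\<^sub>R (0, w)) (F s, drift (0, s *\<^sub>R w)))) /\<^sub>R s"
      by simp
    moreover have "d\<psi> (s *\<^sub>R (0, w)) (F s /\<^sub>R s, drift (0, s *\<^sub>R w) /\<^sub>R s) = d\<psi> (s *\<^sub>R (0, w)) (F s, drift (0, s *\<^sub>R w)) /\<^sub>R s"
      using linear_scale[OF d\<psi>_lin, of "s *\<^sub>R (0, w)" "inverse s" "(F s, drift (0, s *\<^sub>R w))"] by simp
    ultimately show ?case by (simp only: L.scaleR E.scaleR j.scaleR scaleR_add_right)
  qed
  from tendsto_cong[THEN iffD1, OF this lhs] have "((\<lambda>s. j (E (F s /\<^sub>R s)) + j (d\<psi> (s *\<^sub>R (0, w)) (F s /\<^sub>R s, drift (0, s *\<^sub>R w) /\<^sub>R s)))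
      \<longlongrightarrow> L (\<psi>1 w) + n1 (0, w)) (at_right 0)" .
  from tendsto_unique[OF nontrivial_at_right this rhs] show ?thesis .
qed

text \<open>
  The part of the invariance equation at \<open>w = 0\<close> that is of second order in \<open>A\<close>.  The reduced field is
  itself of higher order there, so the terms with the velocity drop out.
\<close>

lemma invariance_quadratic: "L (Q A) + n2 (E A, 0) (E A, 0) = 0"
proof -
  have X: "((\<lambda>s. s *\<^sub>R (A, 0 :: 'w)) \<longlongrightarrow> 0) (at_right 0)"
    using tendsto_scaleR[OF at_right_ident_tendsto tendsto_const, of "(A, 0 :: 'w)"] by (simp add: zero_prod_def)
  have \<psi>l: "((\<lambda>s. \<psi> (s *\<^sub>R (A, 0)) /\<^sub>R s\<^sup>2) \<longlongrightarrow> Q A) (at_right 0)"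
    using jet_curve_2[OF \<psi>jet k \<psi>0 tendsto_const, of "(A, 0)"] by (simp add: Q_def d\<psi>A)
  define \<xi> where "\<xi> s = (E A + s *\<^sub>R (\<psi> (s *\<^sub>R (A, 0)) /\<^sub>R s\<^sup>2), 0 :: 'w)" for s :: real
  have "(\<xi> \<longlongrightarrow> (E A + 0 *\<^sub>R Q A, 0)) (at_right 0)" unfolding \<xi>_def by (intro tendsto_intros \<psi>l)
  then have \<xi>: "(\<xi> \<longlongrightarrow> (E A, 0)) (at_right 0)" by simp
  have n1\<xi>: "n1 (s *\<^sub>R \<xi> s) = 0" for s by (simp add: \<xi>_def n1u)
  have Nl: "((\<lambda>s. N (s *\<^sub>R \<xi> s) /\<^sub>R s\<^sup>2) \<longlongrightarrow> n2 (E A, 0) (E A, 0)) (at_right 0)"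
    using jet_curve_2[OF Njet k N0 \<xi>] unfolding n1\<xi> by simp
  define F where "F s = crd (N (s *\<^sub>R \<xi> s))" for s
  have Fl: "((\<lambda>s. F s /\<^sub>R s\<^sup>2) \<longlongrightarrow> 0) (at_right 0)"
    using crd.tendsto[OF Nl] by (simp add: F_def crd.scaleR crd_n2_EE)
  have lhs: "((\<lambda>s. L (\<psi> (s *\<^sub>R (A, 0)) /\<^sub>R s\<^sup>2) + N (s *\<^sub>R \<xi> s) /\<^sub>R s\<^sup>2) \<longlongrightarrow> L (Q A) + n2 (E A, 0) (E A, 0)) (at_right 0)"
    by (intro tendsto_intros L.tendsto \<psi>l Nl)
  have "((\<lambda>s. j (E (F s /\<^sub>R s\<^sup>2)) + j (d\<psi> (s *\<^sub>R (A, 0)) (F s /\<^sub>R s\<^sup>2, 0)))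
      \<longlongrightarrow> j (E 0) + j (d\<psi> 0 (0, 0))) (at_right 0)"
    by (intro tendsto_add j.tendsto E.tendsto Fl d\<psi>_tendsto X tendsto_Pair tendsto_const)
  then have rhs: "((\<lambda>s. j (E (F s /\<^sub>R s\<^sup>2)) + j (d\<psi> (s *\<^sub>R (A, 0)) (F s /\<^sub>R s\<^sup>2, 0))) \<longlongrightarrow> 0) (at_right 0)"
    by (simp add: E.zero j.zero d\<psi>A)
  have pos: "\<forall>\<^sub>F s::real in at_right 0. s > 0" by (simp add: eventually_at_right_less)
  have "\<forall>\<^sub>F s in at_right 0. L (\<psi> (s *\<^sub>R (A, 0)) /\<^sub>R s\<^sup>2) + N (s *\<^sub>R \<xi> s) /\<^sub>R s\<^sup>2 =
      j (E (F s /\<^sub>R s\<^sup>2)) + j (d\<psi> (s *\<^sub>R (A, 0)) (F s /\<^sub>R s\<^sup>2, 0))"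
    using eventually_compose_filterlim[OF invariance X] pos
  proof eventually_elim
    case (elim s)
    have "s *\<^sub>R s *\<^sub>R (\<psi> (s *\<^sub>R (A, 0)) /\<^sub>R s\<^sup>2) = \<psi> (s *\<^sub>R (A, 0))"
    proof -
      have "s * (s * (inverse s * inverse s)) = 1" using elim(2) by (simp add: field_simps)
      then show ?thesis by (simp add: power2_eq_square)
    qed
    then have \<xi>s: "s *\<^sub>R \<xi> s = (E (fst (s *\<^sub>R (A, 0 :: 'w))) + \<psi> (s *\<^sub>R (A, 0)), snd (s *\<^sub>R (A, 0 :: 'w)))"
      by (simp add: \<xi>_def E.scaleR scaleR_add_right)
    have dr: "drift (s *\<^sub>R (A, 0)) = 0" by (simp add: driftA)
    have "L (\<psi> (s *\<^sub>R (A, 0))) + N (s *\<^sub>R \<xi> s) = j (E (F s)) + j (d\<psi> (s *\<^sub>R (A, 0)) (F s, 0))"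
      using elim(1) unfolding F_def \<xi>s dr .
    then have "(L (\<psi> (s *\<^sub>R (A, 0))) + N (s *\<^sub>R \<xi> s)) /\<^sub>R s\<^sup>2 = (j (E (F s)) + j (d\<psi> (s *\<^sub>R (A, 0)) (F s, 0))) /\<^sub>R s\<^sup>2"
      by simp
    moreover have "d\<psi> (s *\<^sub>R (A, 0)) (F s /\<^sub>R s\<^sup>2, 0) = d\<psi> (s *\<^sub>R (A, 0)) (F s, 0) /\<^sub>R s\<^sup>2"
      using linear_scale[OF d\<psi>_lin, of "s *\<^sub>R (A, 0)" "inverse (s\<^sup>2)" "(F s, 0)"] by simp
    ultimately show ?case by (simp only: L.scaleR E.scaleR j.scaleR scaleR_add_right)
  qed
  from tendsto_cong[THEN iffD1, OF this lhs]
  have "((\<lambda>s. j (E (F s /\<^sub>R s\<^sup>2)) + j (d\<psi> (s *\<^sub>R (A, 0)) (F s /\<^sub>R s\<^sup>2, 0)))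
      \<longlongrightarrow> L (Q A) + n2 (E A, 0) (E A, 0)) (at_right 0)" .
  from tendsto_unique[OF nontrivial_at_right this rhs] show ?thesis .
qed

context
  fixes B BZ \<sigma>
  assumes sym: "field_symmetry j L E crd N B BZ \<sigma>"
begin

interpretation B: bounded_linear B by (rule blB[OF sym])
interpretation \<sigma>: bounded_linear \<sigma> by (rule bl\<sigma>[OF sym])

text \<open>
  \<open>L\<close> is injective on the complement of the centre space, so \<open>\<psi>1 w\<close> is determined by its image and
  inherits the symmetry of the right-hand side of the linear invariance equation.  That side contains
  \<open>\<psi>1 (drift0 w)\<close>, for which the equation has no such term.
\<close>

lemma \<psi>1_fixed: "BZ (\<psi>1 w) = \<psi>1 w"
proof -
  note s = sym_simps[OF sym]
  have step: "BZ (\<psi>1 w) = \<psi>1 w" if "B (j (\<psi>1 (drift0 w))) = j (\<psi>1 (drift0 w))" for w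
  proof -
    have e: "L (\<psi>1 w) = j (\<psi>1 (drift0 w)) - n1 (0, w)" using invariance_linear[of w] by (simp add: algebra_simps)
    have "L (BZ (\<psi>1 w) - \<psi>1 w) = 0"
      unfolding L.diff s e B.diff that n1_fixed[OF sym] by simp
    moreover have "crd (j (BZ (\<psi>1 w) - \<psi>1 w)) = 0"
      by (simp add: j.diff crd.diff s crd_\<psi>1 \<sigma>.zero)
    ultimately show ?thesis using kernel_unique by fastforce
  qed
  have "\<psi>1 0 = 0" using \<psi>1_scale[of 0 0] by simp
  then have "BZ (\<psi>1 (drift0 w)) = \<psi>1 (drift0 w)"
    by (intro step) (simp add: drift00 j.zero B.zero)
  then show ?thesis by (intro step) (simp flip: s)
qed

text \<open>
  The quadratic invariance equation determines \<open>Q\<close> by equivariant data.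
\<close>

lemma Q_equivariant: "BZ (Q A) = Q (\<sigma> A)"
proof -
  note s = sym_simps[OF sym]
  have e: "L (Q A) = - n2 (E A, 0) (E A, 0)" for A using invariance_quadratic[of A] by (simp add: eq_neg_iff_add_eq_0)
  have "L (BZ (Q A) - Q (\<sigma> A)) = 0"
    unfolding L.diff s e n2_equivariant[OF sym] B.neg by simp
  moreover have "crd (j (BZ (Q A) - Q (\<sigma> A))) = 0"
    by (simp add: j.diff crd.diff s crd_Q \<sigma>.zero)
  ultimately show ?thesis using kernel_unique by fastforce
qed

end

text \<open>
  The coefficients of the reduced field that are linear in \<open>A\<close> and \<open>w\<close>, and cubic in \<open>A\<close>.  The
  reduction function enters them only through \<open>\<psi>1\<close> and \<open>Q\<close>.
\<close>

definition "mixed A w = crd (n2 (E A, 0) (\<psi>1 w, w) + n2 (\<psi>1 w, w) (E A, 0))"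
definition "cubic A = crd (n2 (E A, 0) (Q A, 0) + n2 (Q A, 0) (E A, 0) + n3 (E A, 0))"

lemma crd_N_jet: "cubic_jet k (\<lambda>x. crd (N x)) (\<lambda>x. crd (n1 x)) (\<lambda>x y. crd (n2 x y)) (\<lambda>x. crd (n3 x))"
  by (rule cubic_jet_compose_linear[OF Njet crd])

lemma crd_N0: "crd (N 0) = 0" by (simp add: N0 crd.zero)

text \<open>
  Along the ray through \<open>(E A + \<psi>1 w, w)\<close> the field is exactly equivariant.  Of the second order
  coefficient, the part quadratic in \<open>A\<close> vanishes and the part quadratic in \<open>w\<close> is the value at \<open>A = 0\<close>.
\<close>

lemma mixed_equivariant:
  assumes sym: "field_symmetry j L E crd N B BZ \<sigma>"
  shows "mixed (\<sigma> A) w = \<sigma> (mixed A w)"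
proof -
  interpret \<sigma>: bounded_linear \<sigma> by (rule bl\<sigma>[OF sym])
  note s = sym_simps[OF sym] and lBZ = linBZ[OF sym]
  define \<xi> where "\<xi> A = (E A + \<psi>1 w, w)" for A
  have l: "((\<lambda>s. crd (N (s *\<^sub>R \<xi> A)) /\<^sub>R s\<^sup>2) \<longlongrightarrow> crd (n2 (\<xi> A) (\<xi> A))) (at_right 0)" for A
    using jet_curve_2[OF crd_N_jet k crd_N0 tendsto_const, of "\<xi> A"] by (simp add: crd_n1)
  have "crd (N (r *\<^sub>R \<xi> (\<sigma> A))) = \<sigma> (crd (N (r *\<^sub>R \<xi> A)))" for r A
    using s(3)[of "r *\<^sub>R (E A + \<psi>1 w)" "r *\<^sub>R w"]
    by (simp add: \<xi>_def linear_scale[OF lBZ] linear_add[OF lBZ] s \<psi>1_fixed[OF sym])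
  then have "\<sigma> (crd (N (r *\<^sub>R \<xi> A)) /\<^sub>R r\<^sup>2) = crd (N (r *\<^sub>R \<xi> (\<sigma> A))) /\<^sub>R r\<^sup>2" for r A
    by (simp only: \<sigma>.scaleR)
  with \<sigma>.tendsto[OF l] have "((\<lambda>s. crd (N (s *\<^sub>R \<xi> (\<sigma> A))) /\<^sub>R s\<^sup>2) \<longlongrightarrow> \<sigma> (crd (n2 (\<xi> A) (\<xi> A)))) (at_right 0)" for A
    by simp
  from tendsto_unique[OF nontrivial_at_right l this]
  have 1: "crd (n2 (\<xi> (\<sigma> A)) (\<xi> (\<sigma> A))) = \<sigma> (crd (n2 (\<xi> A) (\<xi> A)))" for A .
  have 2: "crd (n2 (\<xi> A) (\<xi> A)) = mixed A w + crd (n2 (\<psi>1 w, w) (\<psi>1 w, w))" for A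
  proof -
    have "\<xi> A = (E A, 0) + (\<psi>1 w, w)" by (simp add: \<xi>_def)
    then show ?thesis
      using crd_n2_EE[of A] by (simp add: mixed_def n2.add_left n2.add_right crd.add del: add_Pair)
  qed
  have "mixed 0 w = 0" by (simp add: mixed_def E.zero n2.zero_left n2.zero_right crd.zero flip: zero_prod_def)
  then have 3: "crd (n2 (\<psi>1 w, w) (\<psi>1 w, w)) = \<sigma> (crd (n2 (\<psi>1 w, w) (\<psi>1 w, w)))"
    using 1[of 0] 2[of 0] by (simp add: \<sigma>.zero)
  show ?thesis using 1[of A] 3 unfolding 2 \<sigma>.add by simp
qed

text \<open>
  Along the parabola \<open>s E A + s\<^sup>2 Q A\<close> the field is exactly equivariant and its coordinate starts with
  the third order coefficient.
\<close>

lemma cubic_equivariant: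
  assumes sym: "field_symmetry j L E crd N B BZ \<sigma>" and k3: "k \<ge> 3"
  shows "cubic (\<sigma> A) = \<sigma> (cubic A)"
proof -
  interpret \<sigma>: bounded_linear \<sigma> by (rule bl\<sigma>[OF sym])
  note s = sym_simps[OF sym] and lBZ = linBZ[OF sym]
  define \<xi> where "\<xi> A r = r *\<^sub>R (E A, 0 :: 'w) + r\<^sup>2 *\<^sub>R (Q A, 0)" for A and r :: real
  have l: "((\<lambda>r. crd (N (\<xi> A r)) /\<^sub>R r ^ 3) \<longlongrightarrow> cubic A) (at_right 0)" for A
    using jet_curve_3[OF crd_N_jet k crd_N0 k3, of "(E A, 0)" "(Q A, 0)"]
    by (simp add: crd_n1 crd_n2_EE \<xi>_def cubic_def crd.add)
  have "crd (N (\<xi> (\<sigma> A) r)) = \<sigma> (crd (N (\<xi> A r)))" for r A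
    using s(3)[of "r *\<^sub>R E A + r\<^sup>2 *\<^sub>R Q A" 0]
    by (simp add: \<xi>_def linear_scale[OF lBZ] linear_add[OF lBZ] s Q_equivariant[OF sym])
  then have "\<sigma> (crd (N (\<xi> A r)) /\<^sub>R r ^ 3) = crd (N (\<xi> (\<sigma> A) r)) /\<^sub>R r ^ 3" for r A
    by (simp only: \<sigma>.scaleR)
  with \<sigma>.tendsto[OF l] have "((\<lambda>r. crd (N (\<xi> (\<sigma> A) r)) /\<^sub>R r ^ 3) \<longlongrightarrow> \<sigma> (cubic A)) (at_right 0)" for A
    by simp
  from tendsto_unique[OF nontrivial_at_right l this] show ?thesis .
qed

lemma mixed_normal_form: "mixed A w = of_real (Re (mixed 1 w)) * A"
proof -
  have "mixed A w = of_real (Re (mixed 1 w)) * A * of_real (cmod A ^ 0)"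
  proof (rule circle_equivariant_homogeneous)
    show "mixed (c * A) w = c * mixed A w" if "cmod c = 1" for c A
      using rotation[OF that] mixed_equivariant by blast
    show "mixed (cnj A) w = cnj (mixed A w)" for A
      using reflection mixed_equivariant by blast
    show "mixed (r *\<^sub>R A) w = r ^ Suc 0 *\<^sub>R mixed A w" for r A
    proof -
      have "(E (r *\<^sub>R A), 0 :: 'w) = r *\<^sub>R (E A, 0)" by (simp add: E.scaleR)
      then show ?thesis
        unfolding mixed_def by (simp only: n2.scaleR_left n2.scaleR_right crd.scaleR power_one_right scaleR_add_right One_nat_def[symmetric] flip: scaleR_add_right)
    qed
  qed
  then show ?thesis by simp
qed

lemma mixed_linear: "linear (\<lambda>w. Re (mixed 1 w))"
proof (rule linearI)
  have "(\<psi>1 (v + w), v + w) = (\<psi>1 v, v) + (\<psi>1 w, w)" for v w by (simp add: \<psi>1_add)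
  then show "Re (mixed 1 (v + w)) = Re (mixed 1 v) + Re (mixed 1 w)" for v w
    unfolding mixed_def by (simp only: n2.add_left n2.add_right crd.add) simp
  have "(\<psi>1 (r *\<^sub>R w), r *\<^sub>R w) = r *\<^sub>R (\<psi>1 w, w)" for r w by (simp add: \<psi>1_scale)
  then show "Re (mixed 1 (r *\<^sub>R w)) = r *\<^sub>R Re (mixed 1 w)" for r w
    unfolding mixed_def by (simp only: n2.scaleR_left n2.scaleR_right crd.scaleR crd.add) (simp add: algebra_simps)
qed

lemma Q_scale: "Q (r *\<^sub>R A) = r\<^sup>2 *\<^sub>R Q A"
  using p2.scaleR_left[of r "(A, 0)" "r *\<^sub>R (A, 0)"] p2.scaleR_right[of "(A, 0)" r "(A, 0)"]
  by (simp add: Q_def power2_eq_square)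

lemma cubic_normal_form:
  assumes "k \<ge> 3"
  shows "cubic A = of_real (Re (cubic 1)) * A * of_real ((cmod A)\<^sup>2)"
proof (rule circle_equivariant_homogeneous)
  show "cubic (c * A) = c * cubic A" if "cmod c = 1" for c A
    using rotation[OF that] cubic_equivariant assms by blast
  show "cubic (cnj A) = cnj (cubic A)" for A
    using reflection cubic_equivariant assms by blast
  show "cubic (r *\<^sub>R A) = r ^ Suc 2 *\<^sub>R cubic A" for r A
  proof -
    have 1: "(E (r *\<^sub>R A), 0 :: 'w) = r *\<^sub>R (E A, 0)" "(Q (r *\<^sub>R A), 0 :: 'w) = r\<^sup>2 *\<^sub>R (Q A, 0)"
      by (simp_all add: E.scaleR Q_scale)
    show ?thesis
      unfolding cubic_def 1 n2.scaleR_left n2.scaleR_right jet_cubic[OF Njet k N0]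
      by (simp add: crd.add crd.scaleR scaleR_add_right power2_eq_square power3_eq_cube numeral_2_eq_2 mult_ac)
  qed
qed

end

context equivariant_reduction
begin

section \<open>The reduced field up to terms of weight four\<close>

lemma cubic_bound: "\<exists>c\<ge>0. \<forall>A. cmod (cubic A) \<le> c * cmod A ^ 3"
proof -
  obtain C where C: "C \<ge> 0" "\<And>x y. norm (n3 x - n3 y) \<le> C * norm (x - y) * (norm x + norm y)\<^sup>2"
    using Njet unfolding cubic_jet_def by blast
  obtain K where K: "K > 0" "\<And>x y. norm (n2 x y) \<le> norm x * norm y * K" using n2.pos_bounded by auto
  obtain Kp where Kp: "Kp > 0" "\<And>x y. norm (p2 x y) \<le> norm x * norm y * Kp" using p2.pos_bounded by auto
  obtain KE where KE: "KE > 0" "\<And>A. norm (E A) \<le> norm A * KE" using E.pos_bounded by auto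
  obtain Kc where Kc: "Kc > 0" "\<And>x. norm (crd x) \<le> norm x * Kc" using crd.pos_bounded by auto
  let ?c = "(2 * (KE * Kp * K) + C * KE ^ 3) * Kc"
  show ?thesis
  proof (intro exI[of _ ?c] conjI allI)
    show "0 \<le> ?c" using K Kp KE Kc C by simp
    fix A
    have EA: "norm (E A, 0 :: 'w) \<le> cmod A * KE" using KE(2) by simp
    have QA: "norm (Q A, 0 :: 'w) \<le> (cmod A)\<^sup>2 * Kp" using Kp(2)[of "(A, 0)" "(A, 0)"] by (simp add: Q_def power2_eq_square)
    have 1: "norm (n2 (E A, 0) (Q A, 0)) \<le> (cmod A * KE) * ((cmod A)\<^sup>2 * Kp) * K"
      using K KE by (intro order_trans[OF K(2)] mult_right_mono mult_mono EA QA) auto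
    have 2: "norm (n2 (Q A, 0) (E A, 0)) \<le> ((cmod A)\<^sup>2 * Kp) * (cmod A * KE) * K"
      using K Kp by (intro order_trans[OF K(2)] mult_right_mono mult_mono EA QA) auto
    have "n3 0 = 0" using jet_cubic[OF Njet k N0, of 0 0] by simp
    then have "norm (n3 (E A, 0)) \<le> C * norm (E A, 0 :: 'w) * (norm (E A, 0 :: 'w))\<^sup>2"
      using C(2)[of "(E A, 0)" 0] by simp
    also have "\<dots> = C * norm (E A, 0 :: 'w) ^ 3" by (simp add: power3_eq_cube power2_eq_square)
    also have "\<dots> \<le> C * (cmod A * KE) ^ 3" using C(1) EA by (intro mult_left_mono power_mono) auto
    finally have 3: "norm (n3 (E A, 0)) \<le> C * (cmod A * KE) ^ 3" .
    have "norm (n2 (E A, 0) (Q A, 0) + n2 (Q A, 0) (E A, 0) + n3 (E A, 0))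
        \<le> norm (n2 (E A, 0) (Q A, 0)) + norm (n2 (Q A, 0) (E A, 0)) + norm (n3 (E A, 0))"
      by (rule order_trans[OF norm_triangle_ineq add_right_mono[OF norm_triangle_ineq]])
    also have "\<dots> \<le> (2 * (KE * Kp * K) + C * KE ^ 3) * cmod A ^ 3"
      using 1 2 3 by (simp add: power_mult_distrib power3_eq_cube power2_eq_square algebra_simps)
    finally have "norm (n2 (E A, 0) (Q A, 0) + n2 (Q A, 0) (E A, 0) + n3 (E A, 0)) * Kc
      \<le> (2 * (KE * Kp * K) + C * KE ^ 3) * cmod A ^ 3 * Kc" using Kc by (intro mult_right_mono) auto
    from order_trans[OF Kc(2) this] show "cmod (cubic A) \<le> ?c * cmod A ^ 3"
      unfolding cubic_def by (simp add: mult_ac)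
  qed
qed

text \<open>
  For \<open>k = 2\<close> terms of third order belong to the error; any number would serve as \<open>\<beta>\<close>.
\<close>

definition "\<alpha> w = Re (mixed 1 w)"
definition "\<beta> = (if k \<ge> 3 then Re (cubic 1) else 0)"

lemma cubic_negligible:
  assumes e: "e > 0"
  shows "\<forall>\<^sub>F x in nhds 0. cmod (cubic (fst x) - of_real \<beta> * fst x * of_real ((cmod (fst x))\<^sup>2)) \<le> e * norm (x :: complex \<times> 'w) ^ k"
proof (cases "k \<ge> 3")
  case True
  have "cubic A - of_real \<beta> * A * of_real ((cmod A)\<^sup>2) = 0" for A
    by (subst cubic_normal_form[OF True]) (simp add: \<beta>_def True)
  then show ?thesis using e by simp
next
  case False
  then have k2: "k = 2" using k by simp
  obtain c where c: "c \<ge> 0" "\<And>A. cmod (cubic A) \<le> c * cmod A ^ 3" using cubic_bound by blast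
  have d: "e / (c + 1) > 0" using e c by simp
  show ?thesis
    unfolding eventually_nhds_metric
  proof (intro exI[of _ "e / (c + 1)"] conjI allI impI d)
    fix x :: "complex \<times> 'w" assume "dist x 0 < e / (c + 1)"
    then have x: "norm x * (c + 1) \<le> e" using c by (simp add: field_simps)
    have fx: "cmod (fst x) \<le> norm x" by (metis norm_fst_le prod.collapse)
    have "cmod (cubic (fst x)) \<le> c * norm x ^ 3"
      using c fx by (intro order_trans[OF c(2)] mult_left_mono power_mono) auto
    also have "\<dots> = (c * norm x) * norm x ^ 2" by (simp add: power3_eq_cube power2_eq_square)
    also have "\<dots> \<le> e * norm x ^ 2"
    proof (rule mult_right_mono)
      have "norm x * (c + 1) = c * norm x + norm x" by (simp add: algebra_simps)
      then show "c * norm x \<le> e" using x norm_ge_zero[of x] by linarith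
    qed simp
    finally have "cmod (cubic (fst x)) \<le> e * norm x ^ k" unfolding k2 .
    moreover have "\<beta> = 0" using False by (simp add: \<beta>_def)
    ultimately show "cmod (cubic (fst x) - of_real \<beta> * fst x * of_real ((cmod (fst x))\<^sup>2)) \<le> e * norm x ^ k"
      by simp
  qed
qed

text \<open>
  \<open>\<psi>1 + Q\<close> contains all terms of weight at most two if \<open>A\<close> has weight one and \<open>w\<close> has weight two.
\<close>

lemma \<psi>_expansion:
  "\<exists>c\<ge>0. \<forall>e>0. \<forall>\<^sub>F x in nhds 0. norm (\<psi> x - \<psi>1 (snd x) - Q (fst x))
     \<le> c * (norm (snd x) * norm x + norm x ^ 3) + e * norm x ^ k"
proof -
  obtain Kp where Kp: "Kp > 0" "\<And>x y. norm (p2 x y) \<le> norm x * norm y * Kp" using p2.pos_bounded by auto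
  obtain C where C: "C \<ge> 0" "\<And>x y. norm (p3 x - p3 y) \<le> C * norm (x - y) * (norm x + norm y)\<^sup>2"
    using \<psi>jet unfolding cubic_jet_def by blast
  obtain C' where C': "C' \<ge> 0" "\<And>e. e > 0 \<Longrightarrow> \<forall>\<^sub>F x in nhds 0.
        norm (\<psi> x - d\<psi> 0 x - p2 x x - p3 x) \<le> C' * norm x ^ 4 + e * norm x ^ k"
    using \<psi>jet \<psi>0 unfolding cubic_jet_def by auto
  have "p3 0 = 0" using jet_cubic[OF \<psi>jet k \<psi>0, of 0 0] by simp
  then have p3: "norm (p3 x) \<le> C * norm x ^ 3" for x
    using C(2)[of x 0] by (simp add: power3_eq_cube power2_eq_square mult.assoc)
  have small: "\<forall>\<^sub>F x in nhds (0 :: complex \<times> 'w). norm x \<le> 1"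
    unfolding eventually_nhds_metric by (intro exI[of _ 1]) auto
  show ?thesis
  proof (intro exI[of _ "2 * Kp + C + C'"] conjI allI impI)
    show "0 \<le> 2 * Kp + C + C'" using Kp C C' by simp
    fix e :: real assume "e > 0"
    from C'(2)[OF this] small
    show "\<forall>\<^sub>F x in nhds 0. norm (\<psi> x - \<psi>1 (snd x) - Q (fst x))
       \<le> (2 * Kp + C + C') * (norm (snd x) * norm x + norm x ^ 3) + e * norm x ^ k"
    proof eventually_elim
      case (elim x)
      obtain A w where x: "x = (A, w)" by (cases x)
      have nA: "norm (A, 0 :: 'w) \<le> norm x" and nw: "norm (0 :: complex, w) = norm w"
        unfolding x using norm_fst_le[of A w] by simp_all
      have split: "p2 x x - Q A = p2 (A, 0) (0, w) + p2 (0, w) x"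
      proof -
        have "x = (A, 0) + (0, w)" by (simp add: x)
        then have "p2 x x = p2 (A, 0) (A, 0) + p2 (A, 0) (0, w) + p2 (0, w) x"
          by (metis p2.add_left p2.add_right)
        then show ?thesis by (simp add: Q_def)
      qed
      have "norm (p2 x x - Q A) \<le> norm (p2 (A, 0) (0, w)) + norm (p2 (0, w) x)"
        unfolding split by (rule norm_triangle_ineq)
      also have "\<dots> \<le> norm x * norm w * Kp + norm w * norm x * Kp"
      proof (rule add_mono)
        show "norm (p2 (A, 0) (0, w)) \<le> norm x * norm w * Kp"
          using Kp(1) nA by (intro order_trans[OF Kp(2)] mult_right_mono) (auto simp: nw intro: mult_right_mono)
        show "norm (p2 (0, w) x) \<le> norm w * norm x * Kp" using Kp(2)[of "(0, w)" x] by (simp add: nw)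
      qed
      finally have 1: "norm (p2 x x - Q A) \<le> 2 * Kp * (norm w * norm x)" by (simp add: mult_ac)
      have n4: "norm x ^ 4 \<le> norm x ^ 3" using elim(2) by (intro power_decreasing) auto
      have "\<psi> x - \<psi>1 w - Q A = (\<psi> x - d\<psi> 0 x - p2 x x - p3 x) + (p2 x x - Q A) + p3 x"
        by (simp add: x d\<psi>0_eq)
      also have "norm \<dots> \<le> norm (\<psi> x - d\<psi> 0 x - p2 x x - p3 x) + norm (p2 x x - Q A) + norm (p3 x)"
        by (rule order_trans[OF norm_triangle_ineq add_right_mono[OF norm_triangle_ineq]])
      also have "\<dots> \<le> (C' * norm x ^ 3 + e * norm x ^ k) + 2 * Kp * (norm w * norm x) + C * norm x ^ 3"
        using elim(1) mult_left_mono[OF n4 C'(1)] 1 p3[of x] by linarith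
      also have "\<dots> \<le> (2 * Kp + C + C') * (norm w * norm x + norm x ^ 3) + e * norm x ^ k"
      proof -
        have "0 \<le> (C + C') * (norm w * norm x)" "0 \<le> 2 * Kp * norm x ^ 3" using Kp C C' by auto
        then show ?thesis by (simp add: algebra_simps)
      qed
      finally show ?case by (simp add: x)
    qed
  qed
qed

text \<open>
  The argument of the field is \<open>V + Z\<close> with \<open>V = (E A, 0)\<close> of weight one and \<open>Z\<close> of weight two.  Terms that
  are quadratic in \<open>Z\<close>, or contain \<open>Z\<close> and two more factors, are bounded by the square of
  \<open>W = |w| + |A|\<^sup>2\<close>; so is \<open>|x|\<^sup>4\<close>, since \<open>|x|\<^sup>2 \<le> W\<close> for small \<open>x\<close>.  What remains are the coefficients
  computed above and the Peano remainders.
\<close>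

lemma reduced_field_expansion:
  "\<exists>C\<ge>0. \<forall>e>0. \<forall>\<^sub>F x in nhds 0.
     cmod (reduced_field x - of_real (\<alpha> (snd x)) * fst x - of_real \<beta> * fst x * of_real ((cmod (fst x))\<^sup>2))
       \<le> C * (norm (snd x) + (cmod (fst x))\<^sup>2)\<^sup>2 + e * norm x ^ k"
proof -
  let ?m2 = "\<lambda>x y. crd (n2 x y)" and ?m3 = "\<lambda>x. crd (n3 x)"
  note mjet = crd_N_jet
  interpret m2: bounded_bilinear ?m2 by (rule jet_bilinear[OF mjet k crd_N0])
  obtain K2 where K2: "K2 > 0" "\<And>x y. norm (?m2 x y) \<le> norm x * norm y * K2" using m2.pos_bounded by auto
  obtain Kp where Kp: "Kp > 0" "\<And>x y. norm (p2 x y) \<le> norm x * norm y * Kp" using p2.pos_bounded by auto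
  obtain KE where KE: "KE > 0" "\<And>A. norm (E A) \<le> norm A * KE" using E.pos_bounded by auto
  obtain K1 where K1: "K1 > 0" "\<And>x. norm (d\<psi> 0 x) \<le> norm x * K1" using d\<psi>0.pos_bounded by auto
  obtain C3 where C3: "C3 \<ge> 0" "\<And>x y. norm (?m3 x - ?m3 y) \<le> C3 * norm (x - y) * (norm x + norm y)\<^sup>2"
    using mjet unfolding cubic_jet_def by blast
  obtain Cr where Cr: "Cr \<ge> 0" "\<And>e. e > 0 \<Longrightarrow> \<forall>\<^sub>F X in nhds 0.
      norm (crd (N X) - ?m2 X X - ?m3 X) \<le> Cr * norm X ^ 4 + e * norm X ^ k"
    using mjet unfolding cubic_jet_def crd_N0 crd_n1 by auto
  obtain c4 where c4: "c4 \<ge> 0" "\<And>e. e > 0 \<Longrightarrow> \<forall>\<^sub>F x in nhds 0. norm (\<psi> x - \<psi>1 (snd x) - Q (fst x))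
     \<le> c4 * (norm (snd x) * norm x + norm x ^ 3) + e * norm x ^ k" using \<psi>_expansion by blast
  define cz where "cz = K1 + 2 + 2 * c4 + Kp"
  define cX where "cX = KE + 2 * cz"
  have cz: "cz > 0" using K1 c4 Kp by (simp add: cz_def)
  have cX: "cX > 0" using KE cz by (simp add: cX_def)
  define C where "C = 4 * K2 * KE * c4 + K2 * cz\<^sup>2 + C3 * cz * (cX + KE)\<^sup>2 + Cr * cX ^ 4"
  have C: "C \<ge> 0" using K2 KE c4 cz C3 Cr by (simp add: C_def)
  show ?thesis
  proof (intro exI[of _ C] conjI allI impI C)
    fix e :: real assume e: "e > 0"
    \<comment> \<open>Three Peano remainders share the error \<open>e\<close>: that of \<open>\<psi>\<close>, that of the field, and the cubic term for \<open>k = 2\<close>.\<close>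
    define e1 where "e1 = min 1 (e / 3 / (2 * K2 * KE))"
    define e2 where "e2 = e / 3 / cX ^ k"
    have e1: "e1 > 0" "e1 \<le> 1" "2 * K2 * KE * e1 \<le> e / 3"
    proof -
      show "e1 > 0" "e1 \<le> 1" using e K2 KE by (auto simp: e1_def)
      have "e1 \<le> e / 3 / (2 * K2 * KE)" by (simp add: e1_def)
      then show "2 * K2 * KE * e1 \<le> e / 3" using K2 KE by (simp add: field_simps)
    qed
    have e2: "e2 > 0" "e2 * cX ^ k = e / 3" using e cX by (auto simp: e2_def)
    obtain \<delta> where \<delta>: "\<delta> > 0" "\<And>X. norm X < \<delta> \<Longrightarrow>
        norm (crd (N X) - ?m2 X X - ?m3 X) \<le> Cr * norm X ^ 4 + e2 * norm X ^ k"
      using Cr(2)[OF e2(1)] unfolding eventually_nhds_metric by auto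
    have small: "\<forall>\<^sub>F x in nhds (0 :: complex \<times> 'w). norm x \<le> 1 \<and> cX * norm x < \<delta>"
      unfolding eventually_nhds_metric
      using \<delta> cX by (intro exI[of _ "min 1 (\<delta> / cX)"]) (auto simp: field_simps)
    have e3: "e / 3 > 0" using e by simp
    from c4(2)[OF e1(1)] small cubic_negligible[OF e3]
    show "\<forall>\<^sub>F x in nhds 0. cmod (reduced_field x - of_real (\<alpha> (snd x)) * fst x - of_real \<beta> * fst x * of_real ((cmod (fst x))\<^sup>2))
       \<le> C * (norm (snd x) + (cmod (fst x))\<^sup>2)\<^sup>2 + e * norm x ^ k"
    proof eventually_elim
      case (elim x)
      obtain A w where x: "x = (A, w)" by (cases x)
      define n where "n = norm x"
      define a where "a = cmod A"
      define b where "b = norm w"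
      define W where "W = b + a\<^sup>2"
      have pos: "n \<ge> 0" "a \<ge> 0" "b \<ge> 0" "W \<ge> 0" by (simp_all add: n_def a_def b_def W_def)
      have an: "a \<le> n" unfolding a_def n_def x by (rule norm_fst_le)
      have bn: "b \<le> n" unfolding b_def n_def x by (rule norm_snd_le)
      have n1': "n \<le> 1" using elim(2) by (simp add: n_def)
      have nsq: "n\<^sup>2 = a\<^sup>2 + b\<^sup>2" by (simp add: n_def a_def b_def x norm_Pair)
      have bb: "b\<^sup>2 \<le> b" using pos bn n1' by (simp add: power2_eq_square mult_left_le)
      have nW: "n\<^sup>2 \<le> W" using nsq bb by (simp add: W_def)
      have n2n: "n\<^sup>2 \<le> n" using pos n1' by (simp add: power2_eq_square mult_left_le)
      have Wn: "W \<le> 2 * n" using nsq n2n bn pos by (simp add: W_def) (smt (verit) zero_le_power2)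
      have n3n: "n ^ 3 \<le> n\<^sup>2" using pos n1' by (intro power_decreasing) auto
      have nk: "n ^ k \<le> n\<^sup>2" using pos n1' k by (intro power_decreasing) auto
      have n4W: "n ^ 4 \<le> W\<^sup>2" using power_mono[OF nW, of 2] pos by (simp flip: power_mult)
      \<comment> \<open>\<open>Y4\<close> is the part of \<open>\<psi>\<close> of weight three and more.\<close>
      define Y4 where "Y4 = \<psi> x - \<psi>1 w - Q A"
      have Y4: "norm Y4 \<le> c4 * (b * n + n ^ 3) + e1 * n ^ k"
        using elim(1) by (simp add: Y4_def x n_def b_def)
      define V where "V = (E A, 0 :: 'w)"
      define Z where "Z = (\<psi>1 w, w) + (Q A, 0) + (Y4, 0)"
      define X where "X = (E A + \<psi> x, w)"
      have XVZ: "X = V + Z" by (simp add: X_def V_def Z_def Y4_def)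
      have nV: "norm V \<le> KE * a" using KE(2)[of A] by (simp add: V_def a_def mult.commute)
      have nZ: "norm Z \<le> cz * W"
      proof -
        have "norm Z \<le> norm (\<psi>1 w, w) + norm (Q A, 0 :: 'w) + norm (Y4, 0 :: 'w)"
          unfolding Z_def by (rule order_trans[OF norm_triangle_ineq add_right_mono[OF norm_triangle_ineq]])
        also have "norm (\<psi>1 w, w) \<le> norm (\<psi>1 w) + norm w" by (rule norm_Pair_le)
        also have "norm (\<psi>1 w) \<le> K1 * b" using K1(2)[of "(0, w)"] by (simp add: \<psi>1_def b_def mult.commute)
        also have "norm (Q A, 0 :: 'w) \<le> Kp * a\<^sup>2"
          using Kp(2)[of "(A, 0)" "(A, 0)"] by (simp add: Q_def a_def power2_eq_square mult_ac)
        also have "norm (Y4, 0 :: 'w) \<le> c4 * (b * n + n ^ 3) + e1 * n ^ k" using Y4 by simp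
        also have "c4 * (b * n + n ^ 3) + e1 * n ^ k \<le> c4 * (W + W) + 1 * W"
        proof (intro add_mono mult_left_mono mult_mono)
          have "b * n \<le> b" using pos n1' by (simp add: mult_left_le)
          then show "b * n \<le> W" by (simp add: W_def add_increasing2)
          show "n ^ 3 \<le> W" using n3n nW by simp
          show "n ^ k \<le> W" using nk nW by simp
        qed (use pos c4 e1 in auto)
        also have "K1 * b + norm w + Kp * a\<^sup>2 + (c4 * (W + W) + 1 * W) \<le> cz * W"
        proof -
          have "0 \<le> Kp * b" "0 \<le> K1 * a\<^sup>2" "norm w = b" using Kp K1 pos by (auto simp: b_def)
          then show ?thesis unfolding cz_def by (simp add: algebra_simps) (simp add: W_def algebra_simps)
        qed
        finally show ?thesis by (simp add: add_mono)
      qed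
      have nX: "norm X \<le> cX * n"
      proof -
        have "norm X \<le> norm V + norm Z" unfolding XVZ by (rule norm_triangle_ineq)
        also have "\<dots> \<le> KE * n + cz * (2 * n)"
          using order_trans[OF nV mult_left_mono[OF an, of KE]] order_trans[OF nZ mult_left_mono[OF Wn, of cz]] KE cz by simp
        finally show ?thesis by (simp add: cX_def algebra_simps)
      qed
      have "norm (crd (N X) - ?m2 X X - ?m3 X) \<le> Cr * norm X ^ 4 + e2 * norm X ^ k"
        by (rule \<delta>(2)) (use nX elim(2) in \<open>auto simp: n_def\<close>)
      also have "\<dots> \<le> Cr * (cX * n) ^ 4 + e2 * (cX * n) ^ k"
        using Cr e2 nX by (intro add_mono mult_left_mono power_mono) auto
      also have "\<dots> = Cr * cX ^ 4 * n ^ 4 + (e2 * cX ^ k) * n ^ k" by (simp add: power_mult_distrib)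
      also have "\<dots> \<le> Cr * cX ^ 4 * W\<^sup>2 + e / 3 * n ^ k"
        unfolding e2(2) using Cr by (intro add_right_mono mult_left_mono n4W) simp
      finally have B1: "norm (crd (N X) - ?m2 X X - ?m3 X) \<le> Cr * cX ^ 4 * W\<^sup>2 + e / 3 * n ^ k" .
      have B2: "norm (?m2 V (Y4, 0) + ?m2 (Y4, 0) V) \<le> 4 * K2 * KE * c4 * W\<^sup>2 + e / 3 * n ^ k"
      proof -
        have "norm (?m2 V (Y4, 0) + ?m2 (Y4, 0) V) \<le> norm V * norm (Y4, 0 :: 'w) * K2 + norm (Y4, 0 :: 'w) * norm V * K2"
          by (rule order_trans[OF norm_triangle_ineq add_mono[OF K2(2) K2(2)]])
        also have "\<dots> = 2 * K2 * (norm V * norm Y4)" by simp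
        also have "\<dots> \<le> 2 * K2 * ((KE * a) * (c4 * (b * n + n ^ 3) + e1 * n ^ k))"
          using K2 KE pos by (intro mult_left_mono mult_mono nV Y4) auto
        also have "\<dots> = 2 * K2 * KE * c4 * (a * b * n + a * n ^ 3) + 2 * K2 * KE * e1 * (a * n ^ k)"
          by (simp add: algebra_simps)
        also have "\<dots> \<le> 2 * K2 * KE * c4 * (W\<^sup>2 + W\<^sup>2) + e / 3 * n ^ k"
        proof (intro add_mono mult_left_mono)
          have "a * b * n \<le> n * b * n" using an pos by (intro mult_right_mono) auto
          also have "\<dots> = b * n\<^sup>2" by (simp add: power2_eq_square)
          also have "\<dots> \<le> W * W" using nW pos by (intro mult_mono) (auto simp: W_def)
          finally show "a * b * n \<le> W\<^sup>2" by (simp add: power2_eq_square)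
          have "a * n ^ 3 \<le> n * n ^ 3" using an pos by (intro mult_right_mono) auto
          also have "\<dots> = n ^ 4" by (simp add: eval_nat_numeral)
          finally show "a * n ^ 3 \<le> W\<^sup>2" using n4W by simp
          have "a * n ^ k \<le> n ^ k" using an n1' pos by (intro mult_left_le_one_le) auto
          then show "2 * K2 * KE * e1 * (a * n ^ k) \<le> e / 3 * n ^ k"
            using e1 e pos K2 KE by (intro mult_mono) auto
        qed (use K2 KE c4 in auto)
        finally show ?thesis by (simp add: algebra_simps)
      qed
      have B3: "norm (?m2 Z Z) \<le> K2 * cz\<^sup>2 * W\<^sup>2"
      proof -
        have "norm (?m2 Z Z) \<le> norm Z * norm Z * K2" by (rule K2)
        also have "\<dots> \<le> (cz * W) * (cz * W) * K2" using K2 cz pos by (intro mult_right_mono mult_mono nZ) auto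
        finally show ?thesis by (simp add: power2_eq_square mult_ac)
      qed
      have B4: "norm (?m3 X - ?m3 V) \<le> C3 * cz * (cX + KE)\<^sup>2 * W\<^sup>2"
      proof -
        have "norm (?m3 X - ?m3 V) \<le> C3 * norm Z * (norm X + norm V)\<^sup>2"
          using C3(2)[of X V] by (simp add: XVZ)
        also have "\<dots> \<le> C3 * (cz * W) * (cX * n + KE * n)\<^sup>2"
          using C3 cz pos order_trans[OF nV mult_left_mono[OF an, of KE]] KE
          by (intro mult_mono mult_left_mono power_mono add_mono nZ nX) auto
        also have "\<dots> = C3 * cz * (cX + KE)\<^sup>2 * (W * n\<^sup>2)" by (simp add: power2_eq_square algebra_simps)
        also have "\<dots> \<le> C3 * cz * (cX + KE)\<^sup>2 * (W * W)"
          using C3 cz pos by (intro mult_left_mono nW) auto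
        finally show ?thesis by (simp add: power2_eq_square)
      qed
      have B5: "cmod (cubic A - of_real \<beta> * A * of_real (a\<^sup>2)) \<le> e / 3 * n ^ k"
        using elim(3) by (simp add: x n_def a_def)
      have VV: "?m2 V V = 0" unfolding V_def by (rule crd_n2_EE)
      have "reduced_field x = crd (N X)" by (simp add: reduced_field_def X_def x)
      moreover have "mixed A w = of_real (\<alpha> w) * A" unfolding \<alpha>_def by (rule mixed_normal_form)
      moreover have "?m2 X X = mixed A w + (cubic A - ?m3 V) + (?m2 V (Y4, 0) + ?m2 (Y4, 0) V) + ?m2 Z Z"
      proof -
        have "?m2 X X = ?m2 V V + ?m2 V Z + ?m2 Z V + ?m2 Z Z"
          unfolding XVZ by (simp add: m2.add_left m2.add_right)
        moreover have "?m2 V Z = ?m2 V (\<psi>1 w, w) + ?m2 V (Q A, 0) + ?m2 V (Y4, 0)"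
          unfolding Z_def by (simp only: m2.add_right)
        moreover have "?m2 Z V = ?m2 (\<psi>1 w, w) V + ?m2 (Q A, 0) V + ?m2 (Y4, 0) V"
          unfolding Z_def by (simp only: m2.add_left)
        ultimately show ?thesis unfolding VV by (simp add: mixed_def cubic_def V_def crd.add)
      qed
      ultimately have "reduced_field x - of_real (\<alpha> w) * A - of_real \<beta> * A * of_real (a\<^sup>2) =
        (crd (N X) - ?m2 X X - ?m3 X) + (?m2 V (Y4, 0) + ?m2 (Y4, 0) V) + ?m2 Z Z + (?m3 X - ?m3 V)
          + (cubic A - of_real \<beta> * A * of_real (a\<^sup>2))" by simp
      also have "cmod \<dots> \<le> cmod (crd (N X) - ?m2 X X - ?m3 X) + cmod (?m2 V (Y4, 0) + ?m2 (Y4, 0) V) + cmod (?m2 Z Z)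
          + cmod (?m3 X - ?m3 V) + cmod (cubic A - of_real \<beta> * A * of_real (a\<^sup>2))"
        by (intro norm_triangle_le add_mono order_refl)
      also have "\<dots> \<le> C * W\<^sup>2 + e * n ^ k"
        using B1 B2 B3 B4 B5 by (simp add: C_def algebra_simps)
      finally show ?case by (simp add: x a_def n_def W_def b_def)
    qed
  qed
qed

end

section \<open>The invariance equation\<close>

definition lipschitz_at_0 :: "('a::real_normed_vector \<Rightarrow> 'b::real_normed_vector) \<Rightarrow> bool" where
  "lipschitz_at_0 f \<longleftrightarrow> (\<exists>\<delta>>0. \<exists>K\<ge>0. \<forall>x y. norm x < \<delta> \<longrightarrow> norm y < \<delta> \<longrightarrow> norm (f x - f y) \<le> K * norm (x - y))"

lemma continuously_differentiable_lipschitz_at_0: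
  assumes U: "open U" "0 \<in> U" and f': "\<And>x. x \<in> U \<Longrightarrow> (f has_derivative f' x) (at x)"
    and cont: "\<And>e. e > 0 \<Longrightarrow> \<forall>\<^sub>F x in nhds 0. \<forall>h. norm (f' x h - f' 0 h) \<le> e * norm h"
  shows "lipschitz_at_0 f"
proof -
  obtain d1 where d1: "d1 > 0" "ball 0 d1 \<subseteq> U" using U by (meson openE)
  obtain d2 where d2: "d2 > 0" "\<And>x h. norm x < d2 \<Longrightarrow> norm (f' x h - f' 0 h) \<le> 1 * norm h"
    using cont[of 1] unfolding eventually_nhds_metric by auto
  have bl: "bounded_linear (f' 0)" by (rule has_derivative_bounded_linear[OF f'[OF U(2)]])
  obtain K where K: "K > 0" "\<And>h. norm (f' 0 h) \<le> norm h * K" using bounded_linear.pos_bounded[OF bl] by auto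
  define d where "d = min d1 d2"
  have "norm (f x - f y) \<le> (K + 1) * norm (x - y)" if x: "norm x < d" and y: "norm y < d" for x y
  proof (rule differentiable_bound[of "ball 0 d" f f'])
    fix z :: 'a assume z: "z \<in> ball 0 d"
    then have zU: "z \<in> U" using d1 by (auto simp: d_def)
    show "(f has_derivative f' z) (at z within ball 0 d)"
      by (rule has_derivative_at_withinI[OF f'[OF zU]])
    show "onorm (f' z) \<le> K + 1"
    proof (rule onorm_bound)
      fix h
      have "norm (f' z h) \<le> norm (f' 0 h) + norm (f' z h - f' 0 h)" by (rule norm_triangle_sub)
      also have "\<dots> \<le> norm h * K + 1 * norm h" using z by (intro add_mono K d2) (auto simp: d_def)
      finally show "norm (f' z h) \<le> (K + 1) * norm h" by (simp add: algebra_simps)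
    qed (use K in simp)
  qed (use x y in auto)
  moreover have "d > 0" "K + 1 \<ge> 0" using d1(1) d2(1) K(1) by (auto simp: d_def)
  ultimately show ?thesis unfolding lipschitz_at_0_def by blast
qed

lemma lipschitz_at_0E:
  assumes "lipschitz_at_0 f"
  obtains \<delta> K where "\<delta> > 0" "K \<ge> 0"
    "\<And>x y. norm x < \<delta> \<Longrightarrow> norm y < \<delta> \<Longrightarrow> norm (f x - f y) \<le> K * norm (x - y)"
  using assms unfolding lipschitz_at_0_def by blast

text \<open>
  The clause of the definition that lifts solutions of the reduced equation to the full system.
\<close>

lemma reduction_function_flow:
  assumes "reduction_function j F G Pc k \<Psi>"
  shows "\<exists>Nu Nv N\<mu> N\<epsilon>. open Nu \<and> 0 \<in> Nu \<and> open Nv \<and> 0 \<in> Nv \<and>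
        open N\<mu> \<and> 0 \<in> N\<mu> \<and> open N\<epsilon> \<and> 0 \<in> N\<epsilon> \<and>
        (\<forall>\<mu>\<in>N\<mu>. \<forall>\<epsilon>\<in>N\<epsilon>. \<forall>T\<ge>0. \<forall>uc v.
              (\<forall>t\<in>{0..T}. uc t \<in> range Pc \<and> uc t + \<Psi> (uc t, v t, \<mu>, \<epsilon>) \<in> Nu \<and> v t \<in> Nv) \<longrightarrow>
              (full_solution j F G \<mu> \<epsilon> {0..T} (\<lambda>t. uc t + \<Psi> (uc t, v t, \<mu>, \<epsilon>)) v \<longleftrightarrow>
               reduced_solution F G Pc \<Psi> \<mu> \<epsilon> {0..T} uc v))"
  using assms unfolding reduction_function_def
  apply (elim conjE exE)
  apply (intro exI conjI)
  apply assumption+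
  apply (intro ballI)
  apply (thin_tac "0 \<in> _")+
  apply (drule (1) bspec, drule (1) bspec)
  apply (elim conjE)
  apply assumption
  done

text \<open>
  Through every point near the origin there is a solution of the reduced equation, by the
  Picard-Lindeloef theorem.  It lifts to a solution of the full system on the manifold; comparing its
  initial velocity with the field gives the invariance equation at that point.  Solutions of the full
  system could not be used instead, since its initial value problem may be ill-posed.
\<close>

lemma reduced_flow_invariance:
  fixes j :: "'z::banach \<Rightarrow> 'x::banach"
    and N :: "'z \<times> 'v::euclidean_space \<times> 'p::euclidean_space \<times> real \<Rightarrow> 'x"
    and G :: "'z \<times> 'v \<times> 'p \<times> real \<Rightarrow> 'v" and E :: "complex \<Rightarrow> 'z"
  assumes red: "reduction_function j F G Pc k \<Psi>" and F: "\<And>u w. F (u, w) = L u + N (u, w)"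
    and j: "bounded_linear j" and L: "bounded_linear L" and E: "bounded_linear E"
    and crd: "bounded_linear crd"
    and E_crd: "\<And>x. E (crd x) = Pc x" and range_E: "range E = range Pc"
    and LE: "\<And>A. L (E A) = 0" and crdL: "\<And>u. crd (L u) = 0"
    and \<psi>: "\<psi> = (\<lambda>(A, w). \<Psi> (E A, w))" and \<psi>0: "\<psi> 0 = 0"
    and d\<psi>: "\<And>x. (\<psi> has_derivative d\<psi> x) (at x)"
    and lip: "lipschitz_at_0 N" "lipschitz_at_0 G" "lipschitz_at_0 \<psi>"
  shows "\<forall>\<^sub>F x in nhds 0. L (\<psi> x) + N (E (fst x) + \<psi> x, snd x) =
     j (E (crd (N (E (fst x) + \<psi> x, snd x)))) +
     j (d\<psi> x (crd (N (E (fst x) + \<psi> x, snd x)), snd (snd (snd x)) *\<^sub>R G (E (fst x) + \<psi> x, snd x), 0, 0))"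
proof -
  interpret j: bounded_linear j by (rule j)
  interpret L: bounded_linear L by (rule L)
  interpret E: bounded_linear E by (rule E)
  interpret crd: bounded_linear crd by (rule crd)
  obtain Nu Nv N\<mu> N\<epsilon> where nb: "open Nu" "0 \<in> Nu" "open Nv" "0 \<in> Nv" "open N\<mu>" "0 \<in> N\<mu>" "open N\<epsilon>" "0 \<in> N\<epsilon>"
    and flow: "\<forall>\<mu>\<in>N\<mu>. \<forall>\<epsilon>\<in>N\<epsilon>. \<forall>T\<ge>0. \<forall>uc v.
              (\<forall>t\<in>{0..T}. uc t \<in> range Pc \<and> uc t + \<Psi> (uc t, v t, \<mu>, \<epsilon>) \<in> Nu \<and> v t \<in> Nv) \<longrightarrow>
              (full_solution j F G \<mu> \<epsilon> {0..T} (\<lambda>t. uc t + \<Psi> (uc t, v t, \<mu>, \<epsilon>)) v \<longleftrightarrow>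
               reduced_solution F G Pc \<Psi> \<mu> \<epsilon> {0..T} uc v)"
    using reduction_function_flow[OF red] by (elim exE conjE) (rule that; assumption)
  obtain dN KN where N: "dN > 0" "KN \<ge> 0" "\<And>x y. norm x < dN \<Longrightarrow> norm y < dN \<Longrightarrow> norm (N x - N y) \<le> KN * norm (x - y)"
    using lip(1) by (rule lipschitz_at_0E) blast
  obtain dG KG where G: "dG > 0" "KG \<ge> 0" "\<And>x y. norm x < dG \<Longrightarrow> norm y < dG \<Longrightarrow> norm (G x - G y) \<le> KG * norm (x - y)"
    using lip(2) by (rule lipschitz_at_0E) blast
  obtain d\<psi>' K\<psi> where P: "d\<psi>' > 0" "K\<psi> \<ge> 0" "\<And>x y. norm x < d\<psi>' \<Longrightarrow> norm y < d\<psi>' \<Longrightarrow> norm (\<psi> x - \<psi> y) \<le> K\<psi> * norm (x - y)"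
    using lip(3) by (rule lipschitz_at_0E) blast
  obtain KE where KE: "KE > 0" "\<And>A. norm (E A) \<le> norm A * KE" using E.pos_bounded by auto
  obtain Kc where Kc: "Kc > 0" "\<And>x. norm (crd x) \<le> norm x * Kc" using crd.pos_bounded by auto
  define X where "X x = (E (fst x) + \<psi> x, snd x)" for x
  define KX where "KX = KE + K\<psi> + 1"
  have KX: "KX > 0" using KE P by (simp add: KX_def)
  have Xlip: "norm (X x - X y) \<le> KX * norm (x - y)" if "norm x < d\<psi>'" "norm y < d\<psi>'" for x y
  proof -
    have "norm (X x - X y) \<le> norm (E (fst x) + \<psi> x - (E (fst y) + \<psi> y)) + norm (snd x - snd y)"
      unfolding X_def diff_Pair by (rule norm_Pair_le)
    also have "E (fst x) + \<psi> x - (E (fst y) + \<psi> y) = E (fst (x - y)) + (\<psi> x - \<psi> y)" by (simp add: E.diff)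
    also have "norm \<dots> \<le> norm (E (fst (x - y))) + norm (\<psi> x - \<psi> y)" by (rule norm_triangle_ineq)
    also have "norm (E (fst (x - y))) \<le> norm (x - y) * KE"
      using KE by (intro order_trans[OF KE(2)] mult_right_mono) (metis norm_fst_le prod.collapse, simp)
    also have "norm (\<psi> x - \<psi> y) \<le> K\<psi> * norm (x - y)" by (rule P(3)[OF that])
    also have "norm (snd x - snd y) \<le> norm (x - y)" by (metis norm_snd_le prod.collapse snd_diff)
    finally show ?thesis by (simp add: KX_def algebra_simps)
  qed
  have X0: "X 0 = 0" unfolding X_def fst_zero snd_zero \<psi>0 E.zero by (simp add: zero_prod_def)
  obtain du where du: "du > 0" "ball 0 du \<subseteq> Nu" using nb by (meson openE)
  obtain dv where dv: "dv > 0" "ball 0 dv \<subseteq> Nv" using nb by (meson openE)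
  obtain dm where dm: "dm > 0" "ball 0 dm \<subseteq> N\<mu>" using nb by (meson openE)
  obtain de where de: "de > 0" "ball 0 de \<subseteq> N\<epsilon>" using nb by (meson openE)
  define dX where "dX = min (min dN dG) du"
  have dX: "dX > 0" using N G du by (simp add: dX_def)
  \<comment> \<open>Points of norm below \<open>r0\<close> stay inside all the neighbourhoods; starting at half of it leaves room for the flow.\<close>
  define r0 where "r0 = min (min d\<psi>' (dX / KX)) (min dv (min dm de))"
  have r0: "r0 > 0" using P dX KX dv dm de by (simp add: r0_def)
  have Xsmall: "norm (X x) < dX" if x: "norm x < r0" for x
  proof -
    have "norm (X x) \<le> KX * norm x" using Xlip[of x 0] x P by (simp add: X0 r0_def)
    also have "\<dots> < KX * (dX / KX)" using x KX by (intro mult_strict_left_mono) (auto simp: r0_def)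
    finally show ?thesis using KX by simp
  qed
  define f where "f x = crd (N (X x))" for x
  define h where "h x = snd (snd (snd x)) *\<^sub>R G (X x)" for x :: "complex \<times> 'v \<times> 'p \<times> real"
  have main: "L (\<psi> x) + N (X x) = j (E (f x)) + j (d\<psi> x (f x, h x, 0, 0))" if xr: "norm x < r0 / 2" for x
  proof -
    obtain A0 v0 \<mu> \<epsilon> where x: "x = (A0, v0, \<mu>, \<epsilon>)" by (cases x)
    define emb where "emb y = (fst y, snd y, \<mu>, \<epsilon>)" for y :: "complex \<times> 'v"
    have emb_diff: "norm (emb y - emb y') = norm (y - y')" for y y'
      by (simp add: emb_def norm_Pair norm_prod_def zero_prod_def)
    have emb_x: "emb (A0, v0) = x" by (simp add: emb_def x)
    have emb_small: "norm (emb y) < r0" if "y \<in> cball (A0, v0) (r0 / 4)" for y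
    proof -
      have "norm (emb y) \<le> norm x + norm (emb y - x)" by (rule norm_triangle_sub)
      also have "norm (emb y - x) = norm (y - (A0, v0))" using emb_diff[of y "(A0, v0)"] by (simp add: emb_x)
      also have "\<dots> \<le> r0 / 4" using that by (simp add: dist_norm norm_minus_commute)
      finally show ?thesis using xr r0 by simp
    qed
    have \<mu>\<epsilon>: "\<mu> \<in> N\<mu>" "\<epsilon> \<in> N\<epsilon>"
    proof -
      have "norm \<mu> \<le> norm x" "norm \<epsilon> \<le> norm x" unfolding x
        by (meson norm_fst_le norm_snd_le order_trans)+
      then have "norm \<mu> < r0" "norm \<epsilon> < r0" using xr r0 by linarith+
      then have "\<mu> \<in> ball 0 dm" "\<epsilon> \<in> ball 0 de" by (auto simp: r0_def)
      then show "\<mu> \<in> N\<mu>" "\<epsilon> \<in> N\<epsilon>" using dm de by auto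
    qed
    define g where "g y = (f (emb y), h (emb y))" for y
    define K where "K = KN * KX * Kc + \<bar>\<epsilon>\<bar> * (KG * KX)"
    have K: "K \<ge> 0" using N G KX Kc by (simp add: K_def)
    have glip: "norm (g y - g y') \<le> K * norm (y - y')"
      if y: "y \<in> cball (A0, v0) (r0 / 4)" and y': "y' \<in> cball (A0, v0) (r0 / 4)" for y y'
    proof -
      note s = emb_small[OF y] emb_small[OF y']
      have Xl: "norm (X (emb y) - X (emb y')) \<le> KX * norm (y - y')"
        using Xlip[of "emb y" "emb y'"] s by (simp add: r0_def emb_diff)
      have 1: "norm (f (emb y) - f (emb y')) \<le> KN * KX * Kc * norm (y - y')"
      proof -
        have "norm (f (emb y) - f (emb y')) \<le> norm (N (X (emb y)) - N (X (emb y'))) * Kc"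
          unfolding f_def crd.diff[symmetric] by (rule Kc(2))
        also have "\<dots> \<le> KN * (KX * norm (y - y')) * Kc"
          using Kc N(2) Xsmall[OF s(1)] Xsmall[OF s(2)]
          by (intro mult_right_mono order_trans[OF N(3)] mult_left_mono Xl) (auto simp: dX_def)
        finally show ?thesis by (simp add: mult_ac)
      qed
      have 2: "norm (h (emb y) - h (emb y')) \<le> \<bar>\<epsilon>\<bar> * (KG * KX) * norm (y - y')"
      proof -
        have "norm (h (emb y) - h (emb y')) = \<bar>\<epsilon>\<bar> * norm (G (X (emb y)) - G (X (emb y')))"
          by (simp add: h_def emb_def flip: scaleR_diff_right)
        also have "\<dots> \<le> \<bar>\<epsilon>\<bar> * (KG * (KX * norm (y - y')))"
          using G(2) Xsmall[OF s(1)] Xsmall[OF s(2)]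
          by (intro mult_left_mono order_trans[OF G(3)] Xl) (auto simp: dX_def)
        finally show ?thesis by (simp add: mult_ac)
      qed
      have "norm (g y - g y') \<le> norm (f (emb y) - f (emb y')) + norm (h (emb y) - h (emb y'))"
        unfolding g_def diff_Pair by (rule norm_Pair_le)
      with 1 2 show ?thesis by (simp add: K_def algebra_simps)
    qed
    have r4: "r0 / 4 > 0" using r0 by simp
    obtain T y where T: "T > 0" and y0: "y 0 = (A0, v0)"
      and yB: "\<And>t. t \<in> {0..T} \<Longrightarrow> y t \<in> cball (A0, v0) (r0 / 4)"
      and y': "\<And>t. t \<in> {0..T} \<Longrightarrow> (y has_vector_derivative g (y t)) (at t within {0..T})"
      by (rule picard_lindeloef[OF r4 K glip]) blast+
    have ycont: "continuous_on {0..T} y" using y' has_vector_derivative_continuous by (metis continuous_on_eq_continuous_within)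
    have gcont: "continuous_on (cball (A0, v0) (r0 / 4)) g"
      by (rule lipschitz_on_continuous_on[of K]) (rule lipschitz_onI, use glip K in \<open>auto simp: dist_norm\<close>)
    have gy: "continuous_on {0..T} (\<lambda>t. g (y t))"
      by (rule continuous_on_compose2[OF gcont ycont]) (use yB in auto)
    define uc where "uc t = E (fst (y t))" for t
    define v where "v t = snd (y t)" for t
    have Xy: "X (emb (y t)) = (uc t + \<Psi> (uc t, v t, \<mu>, \<epsilon>), v t, \<mu>, \<epsilon>)" for t
      by (simp add: X_def emb_def uc_def v_def \<psi>)
    have PF: "Pc (F (uc t + \<Psi> (uc t, v t, \<mu>, \<epsilon>), v t, \<mu>, \<epsilon>)) = E (fst (g (y t)))" for t
      unfolding F E_crd[symmetric] crd.add crdL by (simp add: g_def f_def Xy)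
    have Gh: "\<epsilon> *\<^sub>R G (uc t + \<Psi> (uc t, v t, \<mu>, \<epsilon>), v t, \<mu>, \<epsilon>) = snd (g (y t))" for t
      unfolding Xy[symmetric] by (simp add: g_def h_def emb_def)
    have "reduced_solution F G Pc \<Psi> \<mu> \<epsilon> {0..T} uc v"
      unfolding reduced_solution_def C1_derivative_on_def PF Gh
    proof (intro conjI ballI)
      fix t assume t: "t \<in> {0..T}"
      show "(uc has_vector_derivative E (fst (g (y t)))) (at t within {0..T})"
        unfolding uc_def
        by (rule bounded_linear.has_vector_derivative[OF bounded_linear_compose[OF E bounded_linear_fst] y'[OF t]])
      show "(v has_vector_derivative snd (g (y t))) (at t within {0..T})"
        unfolding v_def by (rule bounded_linear.has_vector_derivative[OF bounded_linear_snd y'[OF t]])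
    next
      show "continuous_on {0..T} (\<lambda>t. E (fst (g (y t))))"
        by (intro E.continuous_on continuous_on_fst gy)
      show "continuous_on {0..T} (\<lambda>t. snd (g (y t)))" by (intro continuous_on_snd gy)
    qed
    moreover have "\<forall>t\<in>{0..T}. uc t \<in> range Pc \<and> uc t + \<Psi> (uc t, v t, \<mu>, \<epsilon>) \<in> Nu \<and> v t \<in> Nv"
    proof (intro ballI conjI)
      fix t assume t: "t \<in> {0..T}"
      note s = emb_small[OF yB[OF t]]
      show "uc t \<in> range Pc" unfolding uc_def range_E[symmetric] by simp
      have "norm (uc t + \<Psi> (uc t, v t, \<mu>, \<epsilon>)) \<le> norm (X (emb (y t)))" unfolding Xy by (rule norm_fst_le)
      then have "uc t + \<Psi> (uc t, v t, \<mu>, \<epsilon>) \<in> ball 0 du" using Xsmall[OF s] by (simp add: dX_def)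
      then show "uc t + \<Psi> (uc t, v t, \<mu>, \<epsilon>) \<in> Nu" using du by auto
      have "norm (v t) \<le> norm (emb (y t))" unfolding emb_def v_def by (meson norm_fst_le norm_snd_le order_trans)
      then have "v t \<in> ball 0 dv" using s by (simp add: r0_def)
      then show "v t \<in> Nv" using dv by auto
    qed
    ultimately have full: "full_solution j F G \<mu> \<epsilon> {0..T} (\<lambda>t. uc t + \<Psi> (uc t, v t, \<mu>, \<epsilon>)) v"
      using flow[rule_format, OF \<mu>\<epsilon>, of T uc v] T by simp
    have zero: "(0::real) \<in> {0..T}" using T by simp
    have D1: "((\<lambda>t. j (uc t + \<Psi> (uc t, v t, \<mu>, \<epsilon>))) has_vector_derivative
        F (uc 0 + \<Psi> (uc 0, v 0, \<mu>, \<epsilon>), v 0, \<mu>, \<epsilon>)) (at 0 within {0..T})"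
      using full zero unfolding full_solution_def C1_derivative_on_def by blast
    have e0: "emb (y 0) = x" by (simp add: y0 emb_x)
    have F0: "F (uc 0 + \<Psi> (uc 0, v 0, \<mu>, \<epsilon>), v 0, \<mu>, \<epsilon>) = L (\<psi> x) + N (X x)"
      unfolding Xy[symmetric] e0 by (simp add: X_def F L.add LE)
    have embd: "((\<lambda>t. emb (y t)) has_vector_derivative (fst (g (y 0)), snd (g (y 0)), 0, 0)) (at 0 within {0..T})"
      unfolding emb_def
      by (intro has_vector_derivative_Pair has_vector_derivative_const
        bounded_linear.has_vector_derivative[OF bounded_linear_fst y'[OF zero]]
        bounded_linear.has_vector_derivative[OF bounded_linear_snd y'[OF zero]])
    have \<psi>d: "((\<lambda>t. \<psi> (emb (y t))) has_vector_derivative d\<psi> x (f x, h x, 0, 0)) (at 0 within {0..T})"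
    proof -
      have "((\<lambda>t. \<psi> (emb (y t))) has_derivative (\<lambda>s. d\<psi> (emb (y 0)) (s *\<^sub>R (fst (g (y 0)), snd (g (y 0)), 0, 0)))) (at 0 within {0..T})"
        by (rule has_derivative_compose[OF embd[unfolded has_vector_derivative_def] d\<psi>])
      moreover have "(\<lambda>s. d\<psi> x (s *\<^sub>R (f x, h x, 0, 0))) = (\<lambda>s. s *\<^sub>R d\<psi> x (f x, h x, 0, 0))"
        using linear_scale[OF bounded_linear.linear[OF has_derivative_bounded_linear[OF d\<psi>]]] by blast
      ultimately show ?thesis by (simp only: e0 g_def fst_conv snd_conv has_vector_derivative_def)
    qed
    have Ed: "((\<lambda>t. E (fst (y t))) has_vector_derivative E (f x)) (at 0 within {0..T})"
      using bounded_linear.has_vector_derivative[OF bounded_linear_compose[OF E bounded_linear_fst] y'[OF zero]]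
      by (simp add: g_def e0)
    have "((\<lambda>t. j (E (fst (y t)) + \<psi> (emb (y t)))) has_vector_derivative j (E (f x) + d\<psi> x (f x, h x, 0, 0))) (at 0 within {0..T})"
      by (intro bounded_linear.has_vector_derivative[OF j] has_vector_derivative_add Ed \<psi>d)
    moreover have "(\<lambda>t. j (E (fst (y t)) + \<psi> (emb (y t)))) = (\<lambda>t. j (uc t + \<Psi> (uc t, v t, \<mu>, \<epsilon>)))"
      by (simp add: uc_def v_def \<psi> emb_def)
    ultimately have D2: "((\<lambda>t. j (uc t + \<Psi> (uc t, v t, \<mu>, \<epsilon>))) has_vector_derivative j (E (f x) + d\<psi> x (f x, h x, 0, 0))) (at 0 within {0..T})"
      by simp
    have "F (uc 0 + \<Psi> (uc 0, v 0, \<mu>, \<epsilon>), v 0, \<mu>, \<epsilon>) = j (E (f x) + d\<psi> x (f x, h x, 0, 0))"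
      using vector_derivative_unique_within_closed_interval[OF T, of 0] D1 D2 T by simp
    then show ?thesis unfolding F0 j.add .
  qed
  show ?thesis
    unfolding eventually_nhds_metric
    by (intro exI[of _ "r0 / 2"] conjI allI impI) (use main r0 in \<open>auto simp: X_def f_def h_def\<close>)
qed

section \<open>The normal form\<close>

lemma (in equivariant_reduction) \<psi>_bound:
  "\<exists>c\<ge>0. \<forall>\<^sub>F x in nhds 0. norm (\<psi> x) \<le> c * (norm (snd x) + (cmod (fst x))\<^sup>2)"
proof -
  obtain Kp where Kp: "Kp > 0" "\<And>x y. norm (p2 x y) \<le> norm x * norm y * Kp" using p2.pos_bounded by auto
  obtain K1 where K1: "K1 > 0" "\<And>x. norm (d\<psi> 0 x) \<le> norm x * K1" using d\<psi>0.pos_bounded by auto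
  obtain c4 where c4: "c4 \<ge> 0" "\<And>e. e > 0 \<Longrightarrow> \<forall>\<^sub>F x in nhds 0. norm (\<psi> x - \<psi>1 (snd x) - Q (fst x))
     \<le> c4 * (norm (snd x) * norm x + norm x ^ 3) + e * norm x ^ k" using \<psi>_expansion by blast
  have small: "\<forall>\<^sub>F x in nhds (0 :: complex \<times> 'w). norm x \<le> 1"
    unfolding eventually_nhds_metric by (intro exI[of _ 1]) auto
  show ?thesis
  proof (intro exI[of _ "K1 + Kp + 2 * c4 + 1"] conjI)
    show "0 \<le> K1 + Kp + 2 * c4 + 1" using K1 Kp c4 by simp
    from c4(2)[OF zero_less_one] small
    show "\<forall>\<^sub>F x in nhds 0. norm (\<psi> x) \<le> (K1 + Kp + 2 * c4 + 1) * (norm (snd x) + (cmod (fst x))\<^sup>2)"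
    proof eventually_elim
      case (elim x)
      obtain A w where x: "x = (A, w)" by (cases x)
      define n where "n = norm x"
      define W where "W = norm w + (cmod A)\<^sup>2"
      have pos: "n \<ge> 0" "W \<ge> 0" by (simp_all add: n_def W_def)
      have n1: "n \<le> 1" using elim(2) by (simp add: n_def)
      have wn: "norm w \<le> n" unfolding n_def x by (rule norm_snd_le)
      have nsq: "n\<^sup>2 = (cmod A)\<^sup>2 + (norm w)\<^sup>2" by (simp add: n_def x norm_Pair)
      have "(norm w)\<^sup>2 \<le> norm w" using wn n1 by (simp add: power2_eq_square mult_left_le)
      then have nW: "n\<^sup>2 \<le> W" by (simp add: nsq W_def)
      have n3: "n ^ 3 \<le> W" using nW power_decreasing[of 2 3 n] pos n1 by simp
      have nk: "n ^ k \<le> W" using nW power_decreasing[of 2 k n] pos n1 k by simp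
      have wn': "norm w * n \<le> W"
      proof -
        have "norm w * n \<le> norm w" using pos n1 by (simp add: mult_left_le)
        then show ?thesis by (simp add: W_def add_increasing2)
      qed
      have 1: "norm (\<psi>1 w) \<le> K1 * norm w" using K1(2)[of "(0, w)"] by (simp add: \<psi>1_def mult.commute)
      have 2: "norm (Q A) \<le> Kp * (cmod A)\<^sup>2" using Kp(2)[of "(A, 0)" "(A, 0)"] by (simp add: Q_def power2_eq_square mult_ac)
      have 3: "norm (\<psi> x - \<psi>1 w - Q A) \<le> c4 * (W + W) + W"
      proof -
        have "norm (\<psi> x - \<psi>1 w - Q A) \<le> c4 * (norm w * n + n ^ 3) + 1 * n ^ k"
          using elim(1) by (simp add: x n_def)
        also have "\<dots> \<le> c4 * (W + W) + 1 * W"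
          using c4 wn' n3 nk by (intro add_mono mult_left_mono) auto
        finally show ?thesis by simp
      qed
      have "\<psi> x = \<psi>1 w + Q A + (\<psi> x - \<psi>1 w - Q A)" by simp
      then have "norm (\<psi> x) \<le> norm (\<psi>1 w) + norm (Q A) + norm (\<psi> x - \<psi>1 w - Q A)"
        by (metis norm_triangle_ineq norm_triangle_le add_right_mono)
      also have "\<dots> \<le> (K1 * norm w + Kp * (cmod A)\<^sup>2) + (c4 * (W + W) + W)" using 1 2 3 by simp
      also have "\<dots> \<le> (K1 + Kp + 2 * c4 + 1) * W"
      proof -
        have "0 \<le> K1 * (cmod A)\<^sup>2" "0 \<le> Kp * norm w" using K1 Kp by auto
        then have "K1 * norm w + Kp * (cmod A)\<^sup>2 \<le> (K1 + Kp) * W" by (simp add: W_def algebra_simps)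
        then show ?thesis by (simp add: algebra_simps)
      qed
      finally show ?case by (simp add: W_def x)
    qed
  qed
qed

text \<open>
  For \<open>k \<ge> 4\<close> the Peano error is dominated by \<open>|x|\<^sup>4 \<le> W\<^sup>2\<close> and joins the weighted error.
\<close>

lemma error_split:
  fixes err :: "complex \<times> 'v::real_normed_vector \<times> 'p::real_normed_vector \<times> real \<Rightarrow> complex"
  assumes C: "C \<ge> 0" and err: "\<And>e. e > 0 \<Longrightarrow> \<forall>\<^sub>F x in nhds 0.
      cmod (err x) \<le> C * (norm (snd x) + (cmod (fst x))\<^sup>2)\<^sup>2 + e * norm x ^ k"
  shows "\<exists>\<rho> \<tau>. (\<forall>x. err x = \<rho> x + \<tau> x) \<and>
     (\<lambda>x. norm (\<rho> x)) \<in> O[nhds 0](\<lambda>(A, B, \<mu>, \<epsilon>). (norm B + norm \<mu> + \<bar>\<epsilon>\<bar> + (cmod A)\<^sup>2)\<^sup>2) \<and>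
     (\<lambda>x. norm (\<tau> x)) \<in> o[nhds 0](\<lambda>x. norm x ^ k) \<and>
     (k \<ge> 4 \<longrightarrow> (\<forall>x. \<tau> x = 0))"
proof -
  define W where "W = (\<lambda>(A, B :: 'v, \<mu> :: 'p, \<epsilon>). norm B + norm \<mu> + \<bar>\<epsilon> :: real\<bar> + (cmod A)\<^sup>2)"
  have W: "norm (snd x) + (cmod (fst x))\<^sup>2 \<le> W x" for x
  proof -
    obtain A B \<mu> \<epsilon> where x: "x = (A, B, \<mu>, \<epsilon>)" by (cases x)
    have "norm (B, \<mu>, \<epsilon>) \<le> norm B + norm (\<mu>, \<epsilon>)" by (rule norm_Pair_le)
    also have "norm (\<mu>, \<epsilon>) \<le> norm \<mu> + norm \<epsilon>" by (rule norm_Pair_le)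
    finally show ?thesis by (simp add: x W_def)
  qed
  have W0: "W x \<ge> 0" for x using W[of x] by (metis add_nonneg_nonneg norm_ge_zero order_trans zero_le_power2)
  have W2: "(norm (snd x) + (cmod (fst x))\<^sup>2)\<^sup>2 \<le> (W x)\<^sup>2" for x
    by (intro power_mono W) auto
  have Weq: "(\<lambda>(A, B, \<mu>, \<epsilon>). (norm B + norm \<mu> + \<bar>\<epsilon>\<bar> + (cmod A)\<^sup>2)\<^sup>2) = (\<lambda>x. (W x)\<^sup>2)"
    by (auto simp: W_def)
  show ?thesis
  proof (cases "k \<ge> 4")
    case True
    have small: "\<forall>\<^sub>F x in nhds (0 :: complex \<times> 'v \<times> 'p \<times> real). norm x \<le> 1"
      unfolding eventually_nhds_metric by (intro exI[of _ 1]) auto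
    have "\<forall>\<^sub>F x in nhds 0. norm (norm (err x)) \<le> (C + 1) * norm ((W x)\<^sup>2)"
      using err[OF zero_less_one] small
    proof eventually_elim
      case (elim x)
      have "(norm x)\<^sup>2 = (cmod (fst x))\<^sup>2 + (norm (snd x))\<^sup>2" by (simp add: norm_prod_def)
      moreover have "norm (snd x) \<le> norm x" by (metis norm_snd_le prod.collapse)
      then have "norm (snd x) \<le> 1" using elim(2) by simp
      then have "(norm (snd x))\<^sup>2 \<le> norm (snd x)" by (simp add: power2_eq_square mult_left_le)
      ultimately have "(norm x)\<^sup>2 \<le> W x" using W[of x] by simp
      then have "((norm x)\<^sup>2)\<^sup>2 \<le> (W x)\<^sup>2" by (intro power_mono) auto
      moreover have "norm x ^ k \<le> norm x ^ 4" using elim(2) True by (intro power_decreasing) auto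
      ultimately have "norm x ^ k \<le> (W x)\<^sup>2" by (simp flip: power_mult)
      moreover have "C * (norm (snd x) + (cmod (fst x))\<^sup>2)\<^sup>2 \<le> C * (W x)\<^sup>2" by (intro mult_left_mono W2 C)
      ultimately have "cmod (err x) \<le> C * (W x)\<^sup>2 + (W x)\<^sup>2" using elim(1) by simp
      then show ?case by (simp add: algebra_simps)
    qed
    then have "(\<lambda>x. norm (err x)) \<in> O[nhds 0](\<lambda>x. (W x)\<^sup>2)" by (rule bigoI)
    then show ?thesis unfolding Weq by (intro exI[of _ err] exI[of _ "\<lambda>_. 0"]) simp
  next
    case False
    \<comment> \<open>\<open>\<rho>\<close> is the error cut off at the size \<open>C W\<^sup>2\<close>, and \<open>\<tau>\<close> the excess.\<close>
    define \<rho> where "\<rho> x = (if cmod (err x) \<le> C * (W x)\<^sup>2 then err x else (C * (W x)\<^sup>2 / cmod (err x)) *\<^sub>R err x)" for x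
    define \<tau> where "\<tau> x = err x - \<rho> x" for x
    have CW: "C * (W x)\<^sup>2 \<ge> 0" for x using C by simp
    have \<rho>: "cmod (\<rho> x) \<le> C * (W x)\<^sup>2" for x
      using CW[of x] by (auto simp: \<rho>_def)
    have \<tau>: "cmod (\<tau> x) \<le> e * norm x ^ k" if "cmod (err x) \<le> C * (W x)\<^sup>2 + e * norm x ^ k" "e > 0" for x e
    proof (cases "cmod (err x) \<le> C * (W x)\<^sup>2")
      case True
      then show ?thesis using that by (simp add: \<tau>_def \<rho>_def)
    next
      case False
      then have pos: "cmod (err x) > 0" using CW[of x] by linarith
      have "\<tau> x = (1 - C * (W x)\<^sup>2 / cmod (err x)) *\<^sub>R err x"
        using False by (simp add: \<tau>_def \<rho>_def scaleR_diff_left)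
      then have "cmod (\<tau> x) = \<bar>1 - C * (W x)\<^sup>2 / cmod (err x)\<bar> * cmod (err x)" by simp
      also have "1 - C * (W x)\<^sup>2 / cmod (err x) \<ge> 0" using False pos by (simp add: divide_le_eq_1)
      then have "\<bar>1 - C * (W x)\<^sup>2 / cmod (err x)\<bar> * cmod (err x) = cmod (err x) - C * (W x)\<^sup>2"
        using pos by (simp add: left_diff_distrib)
      finally show ?thesis using that(1) by simp
    qed
    have "(\<lambda>x. norm (\<rho> x)) \<in> O[nhds 0](\<lambda>x. (W x)\<^sup>2)"
      by (rule bigoI[of _ C]) (use \<rho> in auto)
    moreover have "(\<lambda>x. norm (\<tau> x)) \<in> o[nhds 0](\<lambda>x. norm x ^ k)"
    proof (rule landau_o.smallI)
      fix e :: real assume e: "e > 0"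
      from err[OF e] show "\<forall>\<^sub>F x in nhds 0. norm (norm (\<tau> x)) \<le> e * norm (norm x ^ k)"
      proof eventually_elim
        case (elim x)
        have "C * (norm (snd x) + (cmod (fst x))\<^sup>2)\<^sup>2 \<le> C * (W x)\<^sup>2" by (intro mult_left_mono W2 C)
        then have "cmod (err x) \<le> C * (W x)\<^sup>2 + e * norm x ^ k" using elim by simp
        from \<tau>[OF this e] show ?case by simp
      qed
    qed
    moreover have "err x = \<rho> x + \<tau> x" for x by (simp add: \<tau>_def)
    ultimately show ?thesis unfolding Weq using False by blast
  qed
qed

lemma C1_derivative_on_linear_iso:
  assumes E: "bounded_linear E" and g: "bounded_linear g" and gE: "\<And>A. g (E A) = A"
  shows "C1_derivative_on I (\<lambda>t. E (A t)) (\<lambda>t. E (y t)) \<longleftrightarrow> C1_derivative_on I A y"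
proof
  assume H: "C1_derivative_on I (\<lambda>t. E (A t)) (\<lambda>t. E (y t))"
  show "C1_derivative_on I A y"
    unfolding C1_derivative_on_def
  proof (intro conjI ballI)
    fix t assume "t \<in> I"
    then have "((\<lambda>t. E (A t)) has_vector_derivative E (y t)) (at t within I)"
      using H by (simp add: C1_derivative_on_def)
    from bounded_linear.has_vector_derivative[OF g this]
    show "(A has_vector_derivative y t) (at t within I)" by (simp add: gE)
  next
    have "continuous_on I (\<lambda>t. E (y t))" using H by (simp add: C1_derivative_on_def)
    from bounded_linear.continuous_on[OF g this] show "continuous_on I y" by (simp add: gE)
  qed
next
  assume H: "C1_derivative_on I A y"
  then show "C1_derivative_on I (\<lambda>t. E (A t)) (\<lambda>t. E (y t))"
    unfolding C1_derivative_on_def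
    by (auto intro: bounded_linear.has_vector_derivative[OF E] bounded_linear.continuous_on[OF E])
qed

lemma Ck_on_zero: "Ck_on k UNIV U (\<lambda>_. 0)"
  unfolding Ck_on_def bounded_multilinear_on_def
  by (intro exI[of _ "\<lambda>_ _ _. 0"]) (auto intro!: exI[of _ 0] always_eventually mult_nonneg_nonneg prod_list_norm_nonneg)

text \<open>
  The image of \<open>u\<close> under the symmetry is unique by injectivity of the embedding, hence the same for all
  parameters and linear in \<open>u\<close>.  Differentiating the field at the origin shows that it commutes with \<open>L\<close>.
\<close>

lemma field_symmetry_partner:
  fixes j :: "'z::banach \<Rightarrow> 'x::banach" and N :: "'z \<times> 'w::real_normed_vector \<Rightarrow> 'x"
  assumes j: "bounded_linear j" "inj j" and L: "bounded_linear L"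
    and F: "\<And>u w. F (u, w) = L u + N (u, w)" and N0: "N 0 = 0"
    and dN: "((\<lambda>u. N (u, 0)) has_derivative (\<lambda>_. 0)) (at 0)"
    and B: "bounded_linear B" and comm: "commutes_with_field j F B"
  shows "\<exists>BZ. linear BZ \<and> (\<forall>u. j (BZ u) = B (j u)) \<and> (\<forall>u. L (BZ u) = B (L u)) \<and> (\<forall>u w. N (BZ u, w) = B (N (u, w)))"
proof -
  interpret j: bounded_linear j by (rule j)
  interpret L: bounded_linear L by (rule L)
  interpret B: bounded_linear B by (rule B)
  note inj = injD[OF j(2)]
  have "\<forall>u. \<exists>u'. j u' = B (j u) \<and> (\<forall>w. F (u', w) = B (F (u, w)))"
  proof
    fix u
    obtain u' where u': "j u' = B (j u)" using comm unfolding commutes_with_field_def by blast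
    have "F (u', w) = B (F (u, w))" for w
    proof -
      obtain u'' where "j u'' = B (j u)" "F (u'', w) = B (F (u, w))"
        using comm unfolding commutes_with_field_def by blast
      then show ?thesis using u' inj by metis
    qed
    then show "\<exists>u'. j u' = B (j u) \<and> (\<forall>w. F (u', w) = B (F (u, w)))" using u' by blast
  qed
  then obtain BZ where BZ: "\<And>u. j (BZ u) = B (j u)" "\<And>u w. F (BZ u, w) = B (F (u, w))" by metis
  have lin: "linear BZ"
    by (rule linearI; rule inj) (simp_all add: BZ j.add j.scaleR B.add B.scaleR)
  have dF: "((\<lambda>u. F (u, 0)) has_derivative L) (at 0)"
  proof -
    have "((\<lambda>u. L u + N (u, 0)) has_derivative (\<lambda>u. L u + 0)) (at 0)"
      by (intro has_derivative_add dN bounded_linear_imp_has_derivative L)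
    then show ?thesis by (simp add: F)
  qed
  have LB: "L (BZ u) = B (L u)" for u
  proof -
    have ray: "((\<lambda>s. F (s *\<^sub>R v, 0)) has_vector_derivative L v) (at 0)" for v
    proof -
      have "((\<lambda>s. s *\<^sub>R v) has_derivative (\<lambda>s. s *\<^sub>R v)) (at 0)" by (intro derivative_intros)
      moreover have "((\<lambda>u. F (u, 0)) has_derivative L) (at (0 *\<^sub>R v))" using dF by simp
      ultimately have "((\<lambda>s. F (s *\<^sub>R v, 0)) has_derivative (\<lambda>s. L (s *\<^sub>R v))) (at 0)"
        by (rule has_derivative_compose)
      then show ?thesis by (simp add: has_vector_derivative_def L.scaleR)
    qed
    have "F (s *\<^sub>R BZ u, 0) = B (F (s *\<^sub>R u, 0))" for s
      using BZ(2)[of "s *\<^sub>R u" 0] by (simp add: linear_scale[OF lin])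
    then have "((\<lambda>s. F (s *\<^sub>R BZ u, 0)) has_vector_derivative B (L u)) (at 0)"
      using bounded_linear.has_vector_derivative[OF B ray[of u]] by simp
    from vector_derivative_unique_at[OF ray[of "BZ u"] this] show ?thesis .
  qed
  have "N (BZ u, w) = B (N (u, w))" for u w
  proof -
    have "L (BZ u) + N (BZ u, w) = B (L u) + B (N (u, w))" using BZ(2)[of u w] by (simp add: F B.add)
    then show ?thesis by (simp add: LB)
  qed
  with lin BZ(1) LB show ?thesis by blast
qed

lemma lipschitz_at_0_compose_linear:
  assumes "lipschitz_at_0 f" "bounded_linear B"
  shows "lipschitz_at_0 (\<lambda>x. B (f x))"
proof -
  interpret B: bounded_linear B by (rule assms(2))
  obtain M where M: "M > 0" "\<And>x. norm (B x) \<le> norm x * M" using B.pos_bounded by auto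
  obtain \<delta> K where K: "\<delta> > 0" "K \<ge> 0"
    "\<And>x y. norm x < \<delta> \<Longrightarrow> norm y < \<delta> \<Longrightarrow> norm (f x - f y) \<le> K * norm (x - y)"
    using assms(1) by (rule lipschitz_at_0E) blast
  have "norm (B (f x) - B (f y)) \<le> (K * M) * norm (x - y)" if "norm x < \<delta>" "norm y < \<delta>" for x y
  proof -
    have "norm (B (f x) - B (f y)) \<le> norm (f x - f y) * M" unfolding B.diff[symmetric] by (rule M)
    also have "\<dots> \<le> (K * norm (x - y)) * M" using M by (intro mult_right_mono K that) auto
    finally show ?thesis by (simp add: mult_ac)
  qed
  then show ?thesis unfolding lipschitz_at_0_def using K M
    by (intro exI[of _ \<delta>] exI[of _ "K * M"] conjI) auto
qed

text \<open>
  \<open>\<zeta>\<close> is chosen such that \<open>A \<zeta> + cnj A cconj \<zeta>\<close> is \<open>E A\<close>; the sum doubles the real part, whence the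
  factor \<open>1 / 2\<close>.
\<close>

lemma real_coordinates_of_kernel:
  fixes E :: "complex \<Rightarrow> 'z::real_vector" and L :: "'z \<Rightarrow> 'x::real_vector"
  assumes E: "linear E" "inj E" and ker: "\<And>u. L u = 0 \<longleftrightarrow> u \<in> range E"
  defines "\<zeta> \<equiv> ((1/2) *\<^sub>R E 1, - (1/2) *\<^sub>R E \<i>)"
  shows "real_combination A \<zeta> = E A" "conjugate_basis_of_kernel L \<zeta>"
proof -
  have comb: "cscale c \<zeta> + cscale d (cconj \<zeta>) = (E ((c + cnj d) / 2), E (- \<i> * (c - cnj d) / 2))" for c d
  proof -
    have e: "E z = Re z *\<^sub>R E 1 + Im z *\<^sub>R E \<i>" for z by (rule real_linear_complex[OF E(1)])
    show ?thesis
      unfolding e[of "(c + cnj d) / 2"] e[of "- \<i> * (c - cnj d) / 2"]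
      by (simp add: cscale_def cconj_def \<zeta>_def add_divide_distrib diff_divide_distrib scaleR_add_left scaleR_diff_left)
  qed
  show "real_combination A \<zeta> = E A"
    unfolding real_combination_def comb by simp
  have k: "L (r *\<^sub>R E A) = 0" "L (- (r *\<^sub>R E A)) = 0" for r A
    using ker by (auto simp flip: linear_scale[OF E(1)] linear_neg[OF E(1)])
  show "conjugate_basis_of_kernel L \<zeta>"
    unfolding conjugate_basis_of_kernel_def
  proof (intro conjI allI impI)
    show "cmap L \<zeta> = 0" "cmap L (cconj \<zeta>) = 0"
      using k[of "1/2" 1] k[of "1/2" \<i>] by (simp_all add: cmap_def cconj_def \<zeta>_def zero_prod_def)
    fix w :: "'z \<times> 'z" assume w: "cmap L w = 0"
    obtain w1 w2 where ww: "w = (w1, w2)" by (cases w)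
    have "L w1 = 0" "L w2 = 0" using w by (simp_all add: ww cmap_def zero_prod_def)
    then obtain a b where ab: "w1 = E a" "w2 = E b" using ker by blast
    have eq: "w = cscale c \<zeta> + cscale d (cconj \<zeta>) \<longleftrightarrow> c = a + \<i> * b \<and> d = cnj a + \<i> * cnj b" for c d
    proof -
      have "w = cscale c \<zeta> + cscale d (cconj \<zeta>) \<longleftrightarrow> a = (c + cnj d) / 2 \<and> b = - \<i> * (c - cnj d) / 2"
        unfolding comb ww ab using E(2) by (simp add: inj_eq)
      also have "\<dots> \<longleftrightarrow> c = a + \<i> * b \<and> d = cnj a + \<i> * cnj b"
        by (auto simp: complex_eq_iff field_simps)
      finally show ?thesis .
    qed
    show "\<exists>!cd. w = cscale (fst cd) \<zeta> + cscale (snd cd) (cconj \<zeta>)"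
      unfolding eq by (rule ex1I[of _ "(a + \<i> * b, cnj a + \<i> * cnj b)"]) (auto simp: prod_eq_iff)
  qed
qed

theorem lemma5p9:
  fixes iZY :: "'z::banach \<Rightarrow> 'y::banach" and iYX :: "'y \<Rightarrow> 'x::banach"
    and L :: "'z \<Rightarrow> 'x"
    and R :: "'z \<times> (real^'m) \<times> (real^'p) \<times> real \<Rightarrow> 'y"
    and G :: "'z \<times> (real^'m) \<times> (real^'p) \<times> real \<Rightarrow> (real^'m)"
    and F :: "'z \<times> (real^'m) \<times> (real^'p) \<times> real \<Rightarrow> 'x"
    and \<Psi> :: "'z \<times> (real^'m) \<times> (real^'p) \<times> real \<Rightarrow> 'z"
    and Vu :: "'z set" and Vv :: "(real^'m) set" and V\<mu> :: "(real^'p) set" and V\<epsilon> :: "real set"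
    and T :: "real \<Rightarrow> 'x \<Rightarrow> 'x" and S :: "'x \<Rightarrow> 'x"
    and iZX :: "'z \<Rightarrow> 'x" and Pc :: "'x \<Rightarrow> 'z" and Ec :: "'z set"
    and k :: nat and \<gamma> l :: real
  assumes embeddings: "bounded_linear iZY" "inj iZY" "bounded_linear iYX" "inj iYX"
    and iZX: "iZX = iYX \<circ> iZY"
    and F: "F = (\<lambda>(u, v, \<mu>, \<epsilon>). L u + iYX (R (u, v, \<mu>, \<epsilon>)))"
    \<comment> \<open>vector field assumption\<close>
    and L: "bounded_linear L"
    and k: "k \<ge> 2"
    and V: "open Vu" "0 \<in> Vu" "open Vv" "0 \<in> Vv" "open V\<mu>" "0 \<in> V\<mu>" "open V\<epsilon>" "0 \<in> V\<epsilon>"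
    and R: "Ck_on k UNIV (Vu \<times> Vv \<times> V\<mu> \<times> V\<epsilon>) R"
    and R0: "R (0, 0, 0, 0) = 0"
    and DR0: "((\<lambda>u. R (u, 0, 0, 0)) has_derivative (\<lambda>_. 0)) (at 0)"
    and G: "Ck_on k UNIV (Vu \<times> Vv \<times> V\<mu> \<times> V\<epsilon>) G"
    \<comment> \<open>spectral decomposition and hyperbolic linear equation\<close>
    and spec: "spectral_decomposition iZX L \<gamma>"
    and Pc: "Pc = centre_projector iZX L"
    and Ec: "Ec = range Pc"
    and hyp: "hyperbolic_linear_equation iZY iYX L Pc \<gamma>"
    \<comment> \<open>centre-manifold data\<close>
    and \<Psi>: "reduction_function iZX F G Pc k \<Psi>"
    \<comment> \<open>symmetries\<close>
    and l: "l \<noteq> 0"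
    and T_lin: "\<And>\<phi>. bounded_linear (T \<phi>)"
    and T_cont: "\<And>x. continuous_on UNIV (\<lambda>\<phi>. T \<phi> x)"
    and T_periodic: "\<And>\<phi>. T (\<phi> + 2 * l) = T \<phi>"
    and T_add: "\<And>\<phi> \<psi>. T \<phi> \<circ> T \<psi> = T (\<phi> + \<psi>)"
    and T_0: "T 0 = id"
    and S_lin: "bounded_linear S"
    and S_T: "\<And>\<phi>. S \<circ> T \<phi> = T (- \<phi>) \<circ> S"
    and S_S: "S \<circ> S = id"
    and F_T: "\<And>\<phi>. commutes_with_field iZX F (T \<phi>)"
    and F_S: "commutes_with_field iZX F S"
    \<comment> \<open>centre spectrum and action on the centre space\<close>
    and double: "eigenvalue iZX L 0" "alg_mult iZX L 0 = 2"
    and only: "\<And>z. eigenvalue iZX L z \<Longrightarrow> z \<in> centre_spectrum iZX L \<Longrightarrow> z = 0"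
    and nontrivial: "\<exists>\<phi>. \<exists>u\<in>Ec. T \<phi> (iZX u) \<noteq> iZX u"
  shows "\<exists>Ou Ov O\<mu> O\<epsilon> OA (\<zeta> :: 'z \<times> 'z)
           (\<Phi> :: 'z \<times> (real^'m) \<times> (real^'p) \<times> real \<Rightarrow> 'z)
           (c :: nat \<Rightarrow> nat \<Rightarrow> (real^'m) \<times> (real^'p) \<times> real \<Rightarrow> 'z \<times> 'z)
           (\<alpha> :: (real^'m) \<times> (real^'p) \<times> real \<Rightarrow> real) (\<beta> :: real)
           (\<rho> :: complex \<times> (real^'m) \<times> (real^'p) \<times> real \<Rightarrow> complex)
           (\<tau> :: complex \<times> (real^'m) \<times> (real^'p) \<times> real \<Rightarrow> complex)
           (\<rho>B :: complex \<times> (real^'m) \<times> (real^'p) \<times> real \<Rightarrow> (real^'m)).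
     openin (top_of_set Ec) Ou \<and> 0 \<in> Ou \<and> open Ov \<and> 0 \<in> Ov \<and>
     open O\<mu> \<and> 0 \<in> O\<mu> \<and> open O\<epsilon> \<and> 0 \<in> O\<epsilon> \<and> open OA \<and> 0 \<in> OA \<and>
     conjugate_basis_of_kernel L \<zeta> \<and>
     \<comment> \<open>\<open>\<Phi>\<close> is a polynomial of degree \<open>k\<close> with values in the centre space\<close>
     (\<forall>u\<in>Ec. \<forall>w\<in>Ov \<times> O\<mu> \<times> O\<epsilon>. \<Phi> (u, w) \<in> Ec) \<and>
     (\<forall>A. \<forall>w\<in>Ov \<times> O\<mu> \<times> O\<epsilon>. (\<Phi> (real_combination A \<zeta>, w), 0) =
        (\<Sum>i\<le>k. \<Sum>j\<le>k - i. cscale (A ^ i * cnj A ^ j) (c i j w))) \<and>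
     (\<forall>i j. i + j \<le> k \<longrightarrow> Ck_on (k - (i + j)) UNIV (Ov \<times> O\<mu> \<times> O\<epsilon>) (c i j)) \<and>
     \<Phi> (0, 0, 0, 0) = 0 \<and>
     ((\<lambda>u. \<Phi> (u, 0, 0, 0)) has_derivative (\<lambda>_. 0)) (at 0 within Ec) \<and>
     \<comment> \<open>\<open>u\<^sub>c = A \<zeta> + cnj A cconj \<zeta> + \<Phi>\<close>, \<open>v = B\<close> is a change of coordinates\<close>
     (\<forall>uc\<in>Ou. \<forall>w\<in>Ov \<times> O\<mu> \<times> O\<epsilon>. \<exists>!A. A \<in> OA \<and> uc = normal_form_chart \<zeta> \<Phi> A w) \<and>
     \<comment> \<open>the reduced equation in the coordinates \<open>(A, B)\<close>; \<open>\<tau>\<close> is the Taylor remainder of order \<open>k\<close>,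
       which for \<open>k \<ge> 4\<close> is part of \<open>\<rho>\<close>, and \<open>\<rho>B\<close> is the effect of \<open>\<Psi>\<close> in the slow equation\<close>
     linear \<alpha> \<and>
     (\<lambda>x. norm (\<rho> x)) \<in> O[nhds 0](\<lambda>(A, B, \<mu>, \<epsilon>). (norm B + norm \<mu> + \<bar>\<epsilon>\<bar> + (cmod A)\<^sup>2)\<^sup>2) \<and>
     (\<lambda>x. norm (\<tau> x)) \<in> o[nhds 0](\<lambda>x. norm x ^ k) \<and>
     (k \<ge> 4 \<longrightarrow> (\<forall>x. \<tau> x = 0)) \<and>
     (\<lambda>x. norm (\<rho>B x)) \<in>
        O[nhds 0](\<lambda>(A, B, \<mu>, \<epsilon>). \<bar>\<epsilon>\<bar> * (norm B + norm \<mu> + \<bar>\<epsilon>\<bar> + (cmod A)\<^sup>2)) \<and>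
     (\<forall>\<mu>\<in>O\<mu>. \<forall>\<epsilon>\<in>O\<epsilon>. \<forall>I A B. is_interval I \<longrightarrow>
        (\<forall>t\<in>I. A t \<in> OA \<and> B t \<in> Ov \<and> normal_form_chart \<zeta> \<Phi> (A t) (B t, \<mu>, \<epsilon>) \<in> Ou) \<longrightarrow>
        (reduced_solution F G Pc \<Psi> \<mu> \<epsilon> I (\<lambda>t. normal_form_chart \<zeta> \<Phi> (A t) (B t, \<mu>, \<epsilon>)) B \<longleftrightarrow>
         C1_derivative_on I A (\<lambda>t. of_real (\<alpha> (B t, \<mu>, \<epsilon>)) * A t
            + of_real \<beta> * A t * of_real ((cmod (A t))\<^sup>2)
            + \<rho> (A t, B t, \<mu>, \<epsilon>) + \<tau> (A t, B t, \<mu>, \<epsilon>)) \<and>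
         C1_derivative_on I B (\<lambda>t.
            \<epsilon> *\<^sub>R G (normal_form_chart \<zeta> \<Phi> (A t) (B t, \<mu>, \<epsilon>), B t, \<mu>, \<epsilon>)
            + \<rho>B (A t, B t, \<mu>, \<epsilon>))))"
proof -
  interpret iz: isolated_zero iZX L \<gamma>
  proof (rule isolated_zero_spectral[OF _ L spec only])
    show "bounded_linear iZX" unfolding iZX o_def by (rule bounded_linear_compose[OF embeddings(3,1)])
  qed
  have j: "bounded_linear iZX" by (rule iz.j)
  interpret j: bounded_linear iZX by (rule j)
  have inj_j: "inj iZX" unfolding iZX by (rule inj_compose[OF embeddings(4,2)])
  have cs: "centre_spectrum iZX L = {0}" by (rule centre_spectrum_eq_0[OF spec only])
  have Pc_eq: "Pc = iz.pc" unfolding Pc centre_projector_def cs by (simp add: fun_eq_iff iz.pc_def iz.P_def)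
  have fin: "finite_alg_mult iZX L 0" using spec cs by (simp add: spectral_decomposition_def)
  interpret Lb: bounded_linear L by (rule L)

  \<comment> \<open>\<open>F = L + N\<close>, with \<open>N\<close> taken as a map into the large space\<close>
  define N where "N = (\<lambda>x. iYX (R x))"
  define U where "U = Vu \<times> Vv \<times> V\<mu> \<times> V\<epsilon>"
  have U: "open U" "0 \<in> U" unfolding U_def using V by (auto intro!: open_Times simp: zero_prod_def)
  have FN: "F (u, w) = L u + N (u, w)" for u w by (cases w) (simp add: F N_def)
  interpret Y: bounded_linear iYX by (rule embeddings(3))
  have N0: "N 0 = 0" by (simp add: N_def zero_prod_def R0 Y.zero)
  obtain R' r2 r3 where Rjet: "cubic_jet k R (R' 0) r2 r3"
    and R': "\<And>x. x \<in> U \<Longrightarrow> (R has_derivative R' x) (at x)"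
    and R'c: "\<And>e. e > 0 \<Longrightarrow> \<forall>\<^sub>F x in nhds 0. \<forall>h. norm (R' x h - R' 0 h) \<le> e * norm h"
    by (rule Ck_on_cubic_jet[OF R[folded U_def] U k]) blast
  have Njet: "cubic_jet k N (\<lambda>x. iYX (R' 0 x)) (\<lambda>x y. iYX (r2 x y)) (\<lambda>x. iYX (r3 x))"
    unfolding N_def by (rule cubic_jet_compose_linear[OF Rjet embeddings(3)])
  have "lipschitz_at_0 R" by (rule continuously_differentiable_lipschitz_at_0[OF U R' R'c])
  then have Nlip: "lipschitz_at_0 N" unfolding N_def by (rule lipschitz_at_0_compose_linear[OF _ embeddings(3)])
  have slice: "((\<lambda>u. (u, 0)) has_derivative (\<lambda>h. (h, 0))) (at x)" for x
    by (intro derivative_intros)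
  have R'u: "R' 0 (u, 0) = 0" for u
  proof -
    have "(R has_derivative R' 0) (at (0, 0))" using R'[OF U(2)] by (simp add: zero_prod_def)
    from has_derivative_compose[OF slice[of 0] this]
    have "((\<lambda>u. R (u, 0)) has_derivative (\<lambda>h. R' 0 (h, 0))) (at 0)" .
    moreover have "((\<lambda>u. R (u, 0)) has_derivative (\<lambda>_. 0)) (at 0)" using DR0 by (simp add: zero_prod_def)
    ultimately have "(\<lambda>h. R' 0 (h, 0)) = (\<lambda>_. 0)" by (rule has_derivative_unique)
    then show ?thesis by (rule fun_cong)
  qed
  have dN: "((\<lambda>u. N (u, 0)) has_derivative (\<lambda>_. 0)) (at 0)"
    using has_derivative_compose[OF DR0 bounded_linear_imp_has_derivative[OF embeddings(3)]]
    by (simp add: N_def zero_prod_def Y.zero)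
  obtain G' g2 g3 where Gjet: "cubic_jet k G (G' 0) g2 g3"
    and G': "\<And>x. x \<in> U \<Longrightarrow> (G has_derivative G' x) (at x)"
    and G'c: "\<And>e. e > 0 \<Longrightarrow> \<forall>\<^sub>F x in nhds 0. \<forall>h. norm (G' x h - G' 0 h) \<le> e * norm h"
    by (rule Ck_on_cubic_jet[OF G[folded U_def] U k]) blast
  have Glip: "lipschitz_at_0 G" by (rule continuously_differentiable_lipschitz_at_0[OF U G' G'c])

  have "\<forall>\<phi>. \<exists>BZ. linear BZ \<and> (\<forall>u. iZX (BZ u) = T \<phi> (iZX u)) \<and> (\<forall>u. L (BZ u) = T \<phi> (L u)) \<and>
      (\<forall>u w. N (BZ u, w) = T \<phi> (N (u, w)))"
    using field_symmetry_partner[OF j inj_j L FN N0 dN T_lin F_T] by blast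
  then obtain TZ where TZ: "\<And>\<phi>. linear (TZ \<phi>)" "\<And>\<phi> u. iZX (TZ \<phi> u) = T \<phi> (iZX u)"
    "\<And>\<phi> u. L (TZ \<phi> u) = T \<phi> (L u)" "\<And>\<phi> u w. N (TZ \<phi> u, w) = T \<phi> (N (u, w))" by metis
  obtain SZ where SZ: "linear SZ" "\<And>u. iZX (SZ u) = S (iZX u)"
    "\<And>u. L (SZ u) = S (L u)" "\<And>u w. N (SZ u, w) = S (N (u, w))"
    using field_symmetry_partner[OF j inj_j L FN N0 dN S_lin F_S] by blast
  obtain E :: "complex \<Rightarrow> 'z" where E: "linear E" "inj E" and rE: "range E = range Pc"
    and TE: "\<And>c. cmod c = 1 \<Longrightarrow> \<exists>\<phi>. \<forall>A. T \<phi> (iZX (E A)) = iZX (E (c * A))"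
    and SE: "\<And>A. S (iZX (E A)) = iZX (E (cnj A))"
    and ker: "\<And>u. L u = 0 \<longleftrightarrow> u \<in> range Pc"
    using nontrivial unfolding Ec Pc_eq
    by (rule iz.circle_coordinates[OF inj_j fin double(2,1) l T_lin T_cont T_periodic T_add T_0 S_lin S_T S_S
      TZ(2,3) SZ(2,3)]) blast
  have blE: "bounded_linear E" using E(1) by (simp add: linear_conv_bounded_linear)
  interpret E: bounded_linear E by (rule blE)
  have LE: "L (E A) = 0" for A using ker rE by auto
  define crd where "crd x = inv E (Pc x)" for x
  have E_crd: "E (crd x) = Pc x" for x
    unfolding crd_def by (rule f_inv_into_f) (simp add: rE)
  note injE = injD[OF E(2)]
  interpret Pc: bounded_linear Pc unfolding Pc_eq by (rule iz.bounded_linear_pc)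
  have crd: "bounded_linear crd"
  proof -
    obtain K where K: "K > 0" "\<And>A. cmod A \<le> K * norm (E A)"
      by (rule inj_linear_complex_bounded_below[OF E]) blast
    obtain M where M: "M > 0" "\<And>x. norm (Pc x) \<le> norm x * M" using Pc.pos_bounded by auto
    show ?thesis
    proof (rule bounded_linear_intro)
      show "crd (x + y) = crd x + crd y" for x y by (rule injE) (simp add: E_crd E.add Pc.add)
      show "crd (r *\<^sub>R x) = r *\<^sub>R crd x" for r x by (rule injE) (simp add: E_crd E.scaleR Pc.scaleR)
      show "norm (crd x) \<le> norm x * (M * K)" for x
        using order_trans[OF K(2)[of "crd x", unfolded E_crd] mult_left_mono[OF M(2)[of x], of K]] K(1)
        by (simp add: mult_ac)
    qed
  qed
  interpret crd: bounded_linear crd by (rule crd)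
  have PcE: "Pc (iZX (E A)) = E A" for A unfolding Pc_eq by (rule iz.pc_fixes_kernel[OF LE])
  have crdE: "crd (iZX (E A)) = A" for A by (rule injE) (simp add: E_crd PcE)
  have crdL: "crd (L u) = 0" for u
  proof -
    have "iZX (Pc (L u)) = L (Pc (iZX u))" unfolding Pc_eq by (rule iz.pc_L)
    also have "\<dots> = 0" using ker by blast
    finally have "Pc (L u) = 0" using inj_j j.zero by (metis injD)
    then show ?thesis by (intro injE) (simp add: E_crd E.zero)
  qed
  have crd_sym: "crd (B x) = \<sigma> (crd x)"
    if "bounded_linear B" "\<And>u. iZX (BZ u) = B (iZX u)" "\<And>u. L (BZ u) = B (L u)"
      "\<And>A. B (iZX (E A)) = iZX (E (\<sigma> A))" for B BZ \<sigma> x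
  proof -
    have "iZX (Pc (B x)) = B (iZX (Pc x))" unfolding Pc_eq by (rule iz.pc_commutes[OF that(1-3)])
    also have "\<dots> = iZX (E (\<sigma> (crd x)))" by (simp add: that(4) flip: E_crd)
    finally have "Pc (B x) = E (\<sigma> (crd x))" by (rule injD[OF inj_j])
    then show ?thesis by (intro injE) (simp add: E_crd)
  qed

  define \<psi> where "\<psi> = (\<lambda>(A, w). \<Psi> (E A, w))"
  define emb where "emb = (\<lambda>x. (E (fst x), snd x :: (real^'m) \<times> (real^'p) \<times> real))"
  have \<psi>_emb: "\<psi> = \<Psi> \<circ> emb" by (simp add: \<psi>_def emb_def fun_eq_iff case_prod_beta)
  have EPc: "E A \<in> range Pc" for A unfolding rE[symmetric] by simp
  have emb: "bounded_linear emb" "inj emb" "range emb \<subseteq> range Pc \<times> UNIV" "emb -` (range Pc \<times> UNIV) = UNIV"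
    using E(2) EPc unfolding emb_def
    by (auto intro!: bounded_linear_Pair bounded_linear_compose[OF blE bounded_linear_fst] bounded_linear_snd
        simp: inj_def prod_eq_iff)
  note red = \<Psi>[unfolded reduction_function_def]
  have \<Psi>Ck: "Ck_on k (range Pc \<times> UNIV) (range Pc \<times> UNIV) \<Psi>"
    by (rule red[THEN conjunct1])
  have \<Psi>su: "\<Psi> ` (range Pc \<times> UNIV) \<subseteq> hyperbolic_part id iZX Pc"
    by (rule red[THEN conjunct2, THEN conjunct1])
  have \<Psi>0: "\<Psi> (0, 0, 0, 0) = 0"
    by (rule red[THEN conjunct2, THEN conjunct2, THEN conjunct1])
  have D\<Psi>0: "((\<lambda>u. \<Psi> (u, 0, 0, 0)) has_derivative (\<lambda>_. 0)) (at 0 within range Pc)"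
    by (rule red[THEN conjunct2, THEN conjunct2, THEN conjunct2, THEN conjunct1])
  from Ck_on_linear_pullback[OF \<Psi>Ck emb(1-3)]
  have \<psi>Ck: "Ck_on k UNIV UNIV \<psi>" unfolding emb(4) \<psi>_emb .
  obtain d\<psi> p2 p3 where \<psi>jet: "cubic_jet k \<psi> (d\<psi> 0) p2 p3"
    and d\<psi>: "\<And>x. (\<psi> has_derivative d\<psi> x) (at x)"
    and d\<psi>c: "\<And>e. e > 0 \<Longrightarrow> \<forall>\<^sub>F x in nhds 0. \<forall>h. norm (d\<psi> x h - d\<psi> 0 h) \<le> e * norm h"
    by (rule Ck_on_cubic_jet[OF \<psi>Ck open_UNIV UNIV_I k]) blast
  have \<psi>lip: "lipschitz_at_0 \<psi>"
    by (rule continuously_differentiable_lipschitz_at_0[OF open_UNIV UNIV_I d\<psi> d\<psi>c])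
  have \<psi>0: "\<psi> 0 = 0" by (simp add: \<psi>_def zero_prod_def E.zero \<Psi>0)
  have d\<psi>A: "d\<psi> 0 (A, 0) = 0" for A
  proof -
    have "(\<psi> has_derivative d\<psi> 0) (at (0, 0))" using d\<psi>[of 0] by (simp add: zero_prod_def)
    from has_derivative_compose[OF slice[of 0] this]
    have 1: "((\<lambda>A. \<psi> (A, 0)) has_derivative (\<lambda>h. d\<psi> 0 (h, 0))) (at 0)" .
    have "((\<lambda>A. \<Psi> (E A, 0, 0, 0)) has_derivative (\<lambda>h. 0)) (at 0)"
      using has_derivative_in_compose[of E E 0 UNIV "\<lambda>u. \<Psi> (u, 0, 0, 0)" "\<lambda>_. 0"]
        bounded_linear_imp_has_derivative[OF blE] D\<Psi>0 by (simp add: rE E.zero)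
    then have "((\<lambda>A. \<psi> (A, 0)) has_derivative (\<lambda>h. 0)) (at 0)" by (simp add: \<psi>_def zero_prod_def)
    from has_derivative_unique[OF 1 this] show ?thesis by (rule fun_cong)
  qed
  have crd\<psi>: "crd (iZX (\<psi> x)) = 0" for x
  proof -
    have "emb x \<in> range Pc \<times> UNIV" using emb(3) by blast
    then have "\<psi> x \<in> hyperbolic_part id iZX Pc" using \<Psi>su unfolding \<psi>_emb by auto
    then obtain w where "\<psi> x = w - Pc (iZX w)" unfolding hyperbolic_part_def by auto
    moreover have "Pc (iZX (Pc (iZX w))) = Pc (iZX w)" using PcE E_crd by metis
    ultimately have "Pc (iZX (\<psi> x)) = 0" by (simp add: j.diff Pc.diff)
    then show ?thesis by (intro injE) (simp add: E_crd E.zero)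
  qed
  define X where "X x = (E (fst x) + \<psi> x, snd x)" for x
  define drift where "drift x = (snd (snd (snd x)) *\<^sub>R G (X x), 0 :: real^'p, 0 :: real)"
    for x :: "complex \<times> (real^'m) \<times> (real^'p) \<times> real"
  define drift0 where "drift0 w = (snd (snd w) *\<^sub>R G 0, 0 :: real^'p, 0 :: real)"
    for w :: "(real^'m) \<times> (real^'p) \<times> real"
  have invariance: "\<forall>\<^sub>F x in nhds 0. L (\<psi> x) + N (E (fst x) + \<psi> x, snd x) =
     iZX (E (crd (N (E (fst x) + \<psi> x, snd x)))) + iZX (d\<psi> x (crd (N (E (fst x) + \<psi> x, snd x)), drift x))"
    unfolding drift_def X_def
    by (rule reduced_flow_invariance[OF \<Psi> FN j L blE crd E_crd rE LE crdL \<psi>_def \<psi>0 d\<psi> Nlip Glip \<psi>lip])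
  have drift_lim: "((\<lambda>s. drift (0, s *\<^sub>R w) /\<^sub>R s) \<longlongrightarrow> drift0 w) (at_right 0)" for w
  proof -
    have "isCont \<psi> 0" by (rule has_derivative_continuous[OF d\<psi>])
    have sw: "((\<lambda>s. s *\<^sub>R w) \<longlongrightarrow> 0) (at_right (0 :: real))"
      using tendsto_scaleR[OF at_right_ident_tendsto tendsto_const, of w] by simp
    have "((\<lambda>s. (0 :: complex, s *\<^sub>R w)) \<longlongrightarrow> 0) (at_right (0 :: real))"
      using tendsto_Pair[OF tendsto_const sw, of "0 :: complex"] by (simp add: zero_prod_def)
    from isCont_tendsto_compose[OF \<open>isCont \<psi> 0\<close> this]
    have "((\<lambda>s. \<psi> (0, s *\<^sub>R w)) \<longlongrightarrow> 0) (at_right (0 :: real))" unfolding \<psi>0 .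
    from tendsto_Pair[OF this sw]
    have Xl: "((\<lambda>s. X (0, s *\<^sub>R w)) \<longlongrightarrow> 0) (at_right (0 :: real))" by (simp add: X_def E.zero zero_prod_def)
    have "isCont G 0" by (rule has_derivative_continuous[OF G'[OF U(2)]])
    from isCont_tendsto_compose[OF this Xl]
    have Gl: "((\<lambda>s. G (X (0, s *\<^sub>R w))) \<longlongrightarrow> G 0) (at_right 0)" .
    have "((\<lambda>s. (snd (snd w) *\<^sub>R G (X (0, s *\<^sub>R w)), 0 :: real^'p, 0 :: real)) \<longlongrightarrow> drift0 w) (at_right 0)"
      unfolding drift0_def by (intro tendsto_intros Gl)
    then show ?thesis
      by (rule at_right_scale_cong) (simp add: drift_def)
  qed
  have rotation: "\<exists>B BZ. field_symmetry iZX L E crd N B BZ ((*) c)" if c: "cmod c = 1" for c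
  proof -
    obtain \<phi> where \<phi>: "\<And>A. T \<phi> (iZX (E A)) = iZX (E (c * A))" using TE[OF c] by blast
    have "TZ \<phi> (E A) = E (c * A)" for A by (rule injD[OF inj_j]) (simp add: TZ \<phi>)
    moreover have "crd (T \<phi> x) = c * crd x" for x by (rule crd_sym[OF T_lin TZ(2,3) \<phi>])
    moreover have "linear ((*) c)" by (rule linearI) (auto simp: algebra_simps)
    ultimately have "field_symmetry iZX L E crd N (T \<phi>) (TZ \<phi>) ((*) c)"
      unfolding field_symmetry_def using T_lin TZ by simp
    then show ?thesis by blast
  qed
  have reflection: "\<exists>B BZ. field_symmetry iZX L E crd N B BZ cnj"
  proof -
    have "SZ (E A) = E (cnj A)" for A by (rule injD[OF inj_j]) (simp add: SZ SE)
    moreover have "crd (S x) = cnj (crd x)" for x by (rule crd_sym[OF S_lin SZ(2,3) SE])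
    moreover have "linear cnj" by (rule bounded_linear.linear[OF bounded_linear_cnj])
    ultimately have "field_symmetry iZX L E crd N S SZ cnj"
      unfolding field_symmetry_def using S_lin SZ by simp
    then show ?thesis by blast
  qed
  interpret er: equivariant_reduction k iZX L E crd N "\<lambda>x. iYX (R' 0 x)" "\<lambda>x y. iYX (r2 x y)" "\<lambda>x. iYX (r3 x)"
    \<psi> d\<psi> p2 p3 drift drift0
  proof (rule equivariant_reduction.intro)
    show "u \<in> range E" if "L u = 0" for u using that ker rE by simp
    show "iYX (R' 0 (u, 0)) = 0" for u by (simp add: R'u Y.zero)
    show "linear (d\<psi> x)" for x by (rule bounded_linear.linear[OF has_derivative_bounded_linear[OF d\<psi>]])
    show "drift (A, 0) = 0" for A by (simp add: drift_def zero_prod_def)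
    show "drift0 (drift0 w) = 0" for w by (simp add: drift0_def zero_prod_def)
  qed (fact k j L blE crd LE crdE crdL Njet N0 \<psi>jet \<psi>0 d\<psi>A d\<psi>c crd\<psi> drift_lim invariance rotation reflection)+

  \<comment> \<open>\<open>\<rho> + \<tau>\<close> is, by definition, all that the leading terms leave of the field, so the reduced equation takes
    this form on the whole space, and every neighbourhood can be the whole space.\<close>
  let ?\<alpha> = er.\<alpha> and ?\<beta> = er.\<beta>
  define err where "err x = er.reduced_field x - of_real (?\<alpha> (snd x)) * fst x - of_real ?\<beta> * fst x * of_real ((cmod (fst x))\<^sup>2)" for x
  obtain C where C: "C \<ge> 0" "\<And>e. e > 0 \<Longrightarrow> \<forall>\<^sub>F x in nhds 0.
      cmod (err x) \<le> C * (norm (snd x) + (cmod (fst x))\<^sup>2)\<^sup>2 + e * norm x ^ k"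
    unfolding err_def using er.reduced_field_expansion by blast
  obtain \<rho> \<tau> where \<rho>\<tau>: "\<And>x. err x = \<rho> x + \<tau> x"
    and \<rho>: "(\<lambda>x. norm (\<rho> x)) \<in> O[nhds 0](\<lambda>(A, B, \<mu>, \<epsilon>). (norm B + norm \<mu> + \<bar>\<epsilon>\<bar> + (cmod A)\<^sup>2)\<^sup>2)"
    and \<tau>: "(\<lambda>x. norm (\<tau> x)) \<in> o[nhds 0](\<lambda>x. norm x ^ k)"
    and \<tau>4: "k \<ge> 4 \<longrightarrow> (\<forall>x. \<tau> x = 0)"
    using error_split[OF C] by blast
  define \<rho>B where "\<rho>B x = snd (snd (snd x)) *\<^sub>R G (X x) - snd (snd (snd x)) *\<^sub>R G (E (fst x), snd x)" for x
  have \<rho>B: "(\<lambda>x. norm (\<rho>B x)) \<in> O[nhds 0](\<lambda>(A, B, \<mu>, \<epsilon>). \<bar>\<epsilon>\<bar> * (norm B + norm \<mu> + \<bar>\<epsilon>\<bar> + (cmod A)\<^sup>2))"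
  proof -
    obtain \<delta> K where K: "\<delta> > 0" "K \<ge> 0" "\<And>x y. norm x < \<delta> \<Longrightarrow> norm y < \<delta> \<Longrightarrow> norm (G x - G y) \<le> K * norm (x - y)"
      using Glip by (rule lipschitz_at_0E) blast
    obtain c where c: "c \<ge> 0" "\<forall>\<^sub>F x in nhds 0. norm (\<psi> x) \<le> c * (norm (snd x) + (cmod (fst x))\<^sup>2)"
      using er.\<psi>_bound by blast
    have "isCont \<psi> 0" by (rule has_derivative_continuous[OF d\<psi>])
    then have \<psi>l: "filterlim \<psi> (nhds 0) (nhds 0)"
      using tendsto_at_iff_tendsto_nhds[of \<psi> 0] by (simp add: isCont_def \<psi>0)
    have fl: "filterlim fst (nhds 0) (nhds (0 :: complex \<times> (real^'m) \<times> (real^'p) \<times> real))"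
      "filterlim snd (nhds 0) (nhds (0 :: complex \<times> (real^'m) \<times> (real^'p) \<times> real))"
      using tendsto_fst[OF filterlim_ident, of "0 :: complex \<times> (real^'m) \<times> (real^'p) \<times> real"]
        tendsto_snd[OF filterlim_ident, of "0 :: complex \<times> (real^'m) \<times> (real^'p) \<times> real"] by auto
    have El: "filterlim (\<lambda>x. E (fst x)) (nhds 0) (nhds (0 :: complex \<times> (real^'m) \<times> (real^'p) \<times> real))"
      using E.tendsto[OF fl(1)] by (simp add: E.zero)
    have t: "filterlim X (nhds 0) (nhds 0)" 
      "filterlim (\<lambda>x :: complex \<times> (real^'m) \<times> (real^'p) \<times> real. (E (fst x), snd x)) (nhds 0) (nhds 0)"
      using tendsto_Pair[OF tendsto_add[OF El \<psi>l] fl(2)] tendsto_Pair[OF El fl(2)]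
      by (simp_all add: X_def[abs_def] zero_prod_def)
    have ball: "\<forall>\<^sub>F x in nhds (0 :: 'z \<times> (real^'m) \<times> (real^'p) \<times> real). norm x < \<delta>"
      unfolding eventually_nhds_metric using K(1) by (intro exI[of _ \<delta>]) auto
    have "\<forall>\<^sub>F x in nhds 0. norm (norm (\<rho>B x)) \<le> (K * c) * norm ((\<lambda>(A, B, \<mu>, \<epsilon>). \<bar>\<epsilon>\<bar> * (norm B + norm \<mu> + \<bar>\<epsilon>\<bar> + (cmod A)\<^sup>2)) x)"
      using c(2) eventually_compose_filterlim[OF ball t(1)] eventually_compose_filterlim[OF ball t(2)]
    proof eventually_elim
      case (elim x)
      obtain A B \<mu> \<epsilon> where x: "x = (A, B, \<mu>, \<epsilon>)" by (cases x)
      have nw: "norm (B, \<mu>, \<epsilon>) \<le> norm B + norm \<mu> + \<bar>\<epsilon>\<bar>"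
        using order_trans[OF norm_Pair_le[of B "(\<mu>, \<epsilon>)"] add_left_mono[OF norm_Pair_le[of \<mu> \<epsilon>]]] by simp
      have "norm (G (X x) - G (E (fst x), snd x)) \<le> K * norm (X x - (E (fst x), snd x))"
        by (rule K(3)[OF elim(2,3)])
      also have "X x - (E (fst x), snd x) = (\<psi> x, 0)" by (simp add: X_def)
      also have "K * norm (\<psi> x, 0 :: (real^'m) \<times> (real^'p) \<times> real) \<le> K * (c * (norm B + norm \<mu> + \<bar>\<epsilon>\<bar> + (cmod A)\<^sup>2))"
        using K(2) c(1) nw elim(1) by (intro mult_left_mono) (auto simp: x intro: order_trans[OF _ mult_left_mono])
      finally have "norm (\<rho>B x) \<le> \<bar>\<epsilon>\<bar> * (K * (c * (norm B + norm \<mu> + \<bar>\<epsilon>\<bar> + (cmod A)\<^sup>2)))"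
        unfolding \<rho>B_def by (simp add: x mult_left_mono flip: scaleR_diff_right)
      then show ?case by (simp add: x mult_ac)
    qed
    then show ?thesis by (rule bigoI)
  qed

  \<comment> \<open>The field is already in normal form in these coordinates: the chart is linear, with \<open>\<Phi> = 0\<close>.\<close>
  define \<zeta> where "\<zeta> = ((1/2) *\<^sub>R E 1, - (1/2) *\<^sub>R E \<i>)"
  have ker': "\<And>u. L u = 0 \<longleftrightarrow> u \<in> range E" using ker rE by simp
  note coords = real_coordinates_of_kernel[OF E ker', folded \<zeta>_def]
  have chart: "normal_form_chart \<zeta> (\<lambda>_. 0) A w = E A" for A and w :: "(real^'m) \<times> (real^'p) \<times> real"
    by (simp add: normal_form_chart_def coords(1))
  have \<alpha>: "linear ?\<alpha>" unfolding er.\<alpha>_def[abs_def] by (rule er.mixed_linear)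
  have field: "Pc (F (E A + \<Psi> (E A, B, \<mu>, \<epsilon>), B, \<mu>, \<epsilon>)) =
      E (of_real (?\<alpha> (B, \<mu>, \<epsilon>)) * A + of_real ?\<beta> * A * of_real ((cmod A)\<^sup>2) + \<rho> (A, B, \<mu>, \<epsilon>) + \<tau> (A, B, \<mu>, \<epsilon>))"
    for A B \<mu> \<epsilon>
  proof -
    have "of_real (?\<alpha> (B, \<mu>, \<epsilon>)) * A + of_real ?\<beta> * A * of_real ((cmod A)\<^sup>2) + \<rho> (A, B, \<mu>, \<epsilon>) + \<tau> (A, B, \<mu>, \<epsilon>)
        = er.reduced_field (A, B, \<mu>, \<epsilon>)"
      using \<rho>\<tau>[of "(A, B, \<mu>, \<epsilon>)"] by (simp add: err_def algebra_simps)
    also have "\<dots> = crd (F (E A + \<Psi> (E A, B, \<mu>, \<epsilon>), B, \<mu>, \<epsilon>))"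
      unfolding er.reduced_field_def FN crd.add crdL by (simp add: \<psi>_def)
    finally show ?thesis by (simp add: E_crd)
  qed
  have slow: "\<epsilon> *\<^sub>R G (E A, B, \<mu>, \<epsilon>) + \<rho>B (A, B, \<mu>, \<epsilon>) = \<epsilon> *\<^sub>R G (E A + \<Psi> (E A, B, \<mu>, \<epsilon>), B, \<mu>, \<epsilon>)" for A B \<mu> \<epsilon>
    by (simp add: \<rho>B_def X_def \<psi>_def)
  have bl_crdj: "bounded_linear (\<lambda>u. crd (iZX u))" by (rule bounded_linear_compose[OF crd j])
  show ?thesis
  proof (rule exI[of _ Ec], rule exI[of _ UNIV], rule exI[of _ UNIV], rule exI[of _ UNIV], rule exI[of _ UNIV], rule exI[of _ \<zeta>], rule exI[of _ "\<lambda>_. 0"], rule exI[of _ "\<lambda>_ _ _. 0"], rule exI[of _ ?\<alpha>], rule exI[of _ ?\<beta>], rule exI[of _ \<rho>], rule exI[of _ \<tau>], rule exI[of _ \<rho>B], intro conjI)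
    show "0 \<in> Ec" unfolding Ec using rE E.zero by (metis rangeI)
    show "\<forall>u\<in>Ec. \<forall>w\<in>UNIV \<times> UNIV \<times> UNIV. 0 \<in> Ec" using \<open>0 \<in> Ec\<close> by blast
    show "\<forall>A. \<forall>w\<in>UNIV \<times> UNIV \<times> UNIV. (0, 0) = (\<Sum>i\<le>k. \<Sum>j\<le>k - i. cscale (A ^ i * cnj A ^ j) 0)"
      unfolding cscale_simps(4) by (simp flip: zero_prod_def)
    show "\<forall>i j. i + j \<le> k \<longrightarrow> Ck_on (k - (i + j)) UNIV (UNIV \<times> UNIV \<times> UNIV) (\<lambda>_. 0)"
      by (intro allI impI Ck_on_zero)
    show "\<forall>uc\<in>Ec. \<forall>w\<in>(UNIV :: (real^'m) set) \<times> (UNIV :: (real^'p) set) \<times> (UNIV :: real set). \<exists>!A. A \<in> UNIV \<and> uc = normal_form_chart \<zeta> (\<lambda>_. 0) A w"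
      unfolding chart Ec rE[symmetric] using E(2) by (auto simp: inj_eq)
    show "\<forall>\<mu>\<in>UNIV. \<forall>\<epsilon>\<in>UNIV. \<forall>I A B. is_interval I \<longrightarrow>
        (\<forall>t\<in>I. A t \<in> UNIV \<and> B t \<in> UNIV \<and> normal_form_chart \<zeta> (\<lambda>_. 0) (A t) (B t, \<mu>, \<epsilon>) \<in> Ec) \<longrightarrow>
        (reduced_solution F G Pc \<Psi> \<mu> \<epsilon> I (\<lambda>t. normal_form_chart \<zeta> (\<lambda>_. 0) (A t) (B t, \<mu>, \<epsilon>)) B \<longleftrightarrow>
         C1_derivative_on I A (\<lambda>t. of_real (?\<alpha> (B t, \<mu>, \<epsilon>)) * A t
            + of_real ?\<beta> * A t * of_real ((cmod (A t))\<^sup>2)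
            + \<rho> (A t, B t, \<mu>, \<epsilon>) + \<tau> (A t, B t, \<mu>, \<epsilon>)) \<and>
         C1_derivative_on I B (\<lambda>t.
            \<epsilon> *\<^sub>R G (normal_form_chart \<zeta> (\<lambda>_. 0) (A t) (B t, \<mu>, \<epsilon>), B t, \<mu>, \<epsilon>)
            + \<rho>B (A t, B t, \<mu>, \<epsilon>)))"
      unfolding reduced_solution_def chart field slow
        C1_derivative_on_linear_iso[OF blE bl_crdj crdE] by blast
  qed (use coords(2) \<alpha> \<rho> \<tau> \<tau>4 \<rho>B in auto)
qed

end
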